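(* Let $M>0$, $p\ge1$ and $a>1$. Assume that an $n$-sample $Y_1,\dots,Y_n$ is observed in the multivariate convolution model $Y_i=X_i+\varepsilon_i$ in $\mathbb{R}^d$, where the coordinates $\varepsilon_{1,1},\dots,\varepsilon_{1,d}$ of $\varepsilon_1$ are independent, with $\varepsilon_{1,j}\sim\mu_{\varepsilon,j}$, and that $\mathbb{E}|\varepsilon_{1,j}|^{2p+a}<\infty$ for all $j\in\{1,\dots,d\}$. Let $r_j=1/\mu_{\varepsilon,j}^*$. Also assume that there exist $\beta>0$, $\tilde\beta\ge0$, $\gamma_2>0$ and $c_2>0$ such that for every $j\in\{1,\dots,d\}$, every $\ell\in\{0,1,\dots,\lceil p\rceil+1\}$ and every $t\in\mathbb{R}$, $$\big|r_j^{(\ell)}(t)\big|\le c_2\,(1+|t|^{\tilde\beta})\exp\big(|t|^\beta/\gamma_2\big).$$ Then, taking $h_1=\dots=h_d=\big(4d/(\gamma_2\log n)\big)^{1/\beta}$ in the definition of the deconvolution estimator $\hat\mu_n$ (given in the context), there exists a positive constant $C$ such that for all $n\ge2$, $$\sup_{\mu\in\mathcal{D}(M,p,a)}\mathbb{E}_{(\mu\star\mu_\varepsilon)^{\otimes n}}\big(W_p^p(\mu,\hat\mu_n)\big)\le C\,(\log n)^{-p/\beta}.$$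
   Context: Convolution model: $Y_i=X_i+\varepsilon_i$, $i=1,\dots,n$, in $\mathbb{R}^d$, where the $X_i$ are i.i.d. with unknown distribution $\mu$, the $\varepsilon_i$ are i.i.d. with known distribution $\mu_\varepsilon$, and $(X_i)$ and $(\varepsilon_i)$ are independent, so that the $Y_i$ are i.i.d. with distribution $\mu\star\mu_\varepsilon$ (convolution). Here $\mu_\varepsilon=\mu_{\varepsilon,1}\otimes\dots\otimes\mu_{\varepsilon,d}$. $\mathbb{E}_{(\mu\star\mu_\varepsilon)^{\otimes n}}$ is the expectation when $(Y_1,\dots,Y_n)$ has law $(\mu\star\mu_\varepsilon)^{\otimes n}$. We write $Y_{i,j}$ for the $j$-th coordinate of $Y_i$. For $p\ge1$, $W_p(\mu,\mu')=\inf_{\pi\in\Pi(\mu,\mu')}\left(\int_{\mathbb{R}^d\times\mathbb{R}^d}\|x-y\|^p\,\pi(dx,dy)\right)^{1/p}$, where $\Pi(\mu,\mu')$ is the set of probability measures on $\mathbb{R}^d\times\mathbb{R}^d$ with marginals $\mu$ and $\mu'$ and $\|\cdot\|$ is the Euclidean norm. Fourier transforms: $\nu^*(x)=\int e^{itx}\,\nu(dt)$ for a probability measure $\nu$ on $\mathbb{R}$, $f^*(x)=\int e^{itx}f(t)\,dt$ for an integrable function $f$ on $\mathbb{R}$. $\lceil p\rceil$ is the smallest integer greater than or equal to $p$. $\mathcal{D}(M,p,a)$ is the set of probability measures $\mu$ on $\mathbb{R}^d$ such that, with $X_1=(X_{1,1},\dots,X_{1,d})\sim\mu$, $$\sup_{1\le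 j\le d}\mathbb{E}_\mu\Big(\big(1+|X_{1,j}|^{2p+a}\big)\prod_{1\le\ell\le d,\ \ell\ne j}\big(1+|X_{1,\ell}|^{a}\big)\Big)\le M.$$ Deconvolution estimator. Let $m=2\lceil p/2\rceil+2$ and $$k(x)=c_p\left\{\frac{m\,\sin(x/m)}{x}\right\}^{m},$$ with $c_p$ such that $\int k(x)\,dx=1$; then $k$ is a symmetric density and $k^*$ is supported in $[-1,1]$. For $j\in\{1,\dots,d\}$ and $h_j>0$ let $$\tilde k_{j,h_j}(x)=\frac1{2\pi}\int e^{-iux}\,\frac{k^*(u)}{\mu_{\varepsilon,j}^*(u/h_j)}\,du,$$ and $$\hat f_n(x_1,\dots,x_d)=\frac1n\sum_{i=1}^n\prod_{j=1}^d\frac1{h_j}\tilde k_{j,h_j}\Big(\frac{x_j-Y_{i,j}}{h_j}\Big).$$ Let $\hat f_n^+=\max\{0,\hat f_n\}$, $\alpha_n=1/\int_{\mathbb{R}^d}\hat f_n^+(x)\,dx$ and $\hat g_n=\alpha_n\hat f_n^+$. The estimator $\hat\mu_n$ is the probability measure on $\mathbb{R}^d$ with density $\hat g_n$. *)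

theory Defs
  imports "HOL-Probability.Probability"
begin

section \<open>Wasserstein distance\<close>

text \<open>Powers with exponent \<^term>\<open>r > 0\<close> on the extended half-line, so that an infinite transport
  cost gives an infinite distance.\<close>

definition ennreal_powr :: "ennreal \<Rightarrow> real \<Rightarrow> ennreal" where
  "ennreal_powr x r = (if x = \<infinity> then \<infinity> else ennreal (enn2real x powr r))"

definition couplings ::
  "(real ^ 'd) measure \<Rightarrow> (real ^ 'd) measure \<Rightarrow> ((real ^ 'd) \<times> (real ^ 'd)) measure set" where
  "couplings \<mu> \<nu> = {\<pi>. prob_space \<pi> \<and> sets \<pi> = sets borel \<and>
     distr \<pi> borel fst = \<mu> \<and> distr \<pi> borel snd = \<nu>}"

definition wasserstein ::
  "real \<Rightarrow> (real ^ 'd) measure \<Rightarrow> (real ^ 'd) measure \<Rightarrow> ennreal" where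
  "wasserstein p \<mu> \<nu> =
     (INF \<pi> \<in> couplings \<mu> \<nu>.
        ennreal_powr (\<integral>\<^sup>+ z. ennreal (norm (fst z - snd z) powr p) \<partial>\<pi>) (1 / p))"


section \<open>The convolution model\<close>

definition product_law :: "('d::finite \<Rightarrow> real measure) \<Rightarrow> (real ^ 'd) measure" where
  "product_law \<mu>\<epsilon> = distr (Pi\<^sub>M UNIV \<mu>\<epsilon>) borel (\<lambda>x. \<chi> j. x j)"

definition sample_law ::
  "nat \<Rightarrow> (real ^ 'd) measure \<Rightarrow> ('d::finite \<Rightarrow> real measure) \<Rightarrow> (nat \<Rightarrow> real ^ 'd) measure" where
  "sample_law n \<mu> \<mu>\<epsilon> = Pi\<^sub>M {..<n} (\<lambda>_. convolution \<mu> (product_law \<mu>\<epsilon>))"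

definition moment_class :: "real \<Rightarrow> real \<Rightarrow> real \<Rightarrow> (real ^ 'd) measure set" where
  "moment_class M p a = {\<mu>. prob_space \<mu> \<and> sets \<mu> = sets borel \<and>
     (SUP j. \<integral>\<^sup>+ x. ennreal ((1 + \<bar>x $ j\<bar> powr (2 * p + a)) *
        (\<Prod>l \<in> UNIV - {j}. 1 + \<bar>x $ l\<bar> powr a)) \<partial>\<mu>) \<le> ennreal M}"


section \<open>The deconvolution estimator\<close>

text \<open>For probability measures on the line the Fourier transform is \<^const>\<open>char\<close>, with the same
  sign convention.\<close>

definition fourier :: "(real \<Rightarrow> complex) \<Rightarrow> real \<Rightarrow> complex" where
  "fourier f x = (CLINT t|lborel. iexp (x * t) * f t)"

definition kernel_order :: "real \<Rightarrow> nat" where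
  "kernel_order p = nat (2 * \<lceil>p / 2\<rceil> + 2)"

text \<open>Note that \<open>m sin (x/m) / x\<close> is \<open>sinc (x/m)\<close>, continuously extended by the value 1
  at 0.\<close>

definition kernel :: "real \<Rightarrow> real \<Rightarrow> real" where
  "kernel p x =
     (let m = kernel_order p;
          s = (\<lambda>y. sinc (y / real m) ^ m)
      in 1 / (LINT y|lborel. s y) * s x)"

text \<open>The integral below is a real number, since the transform of the kernel is real and even and
  \<^term>\<open>char \<nu> (- t) = cnj (char \<nu> t)\<close>; taking the real part only adjusts its type.\<close>

definition deconv_kernel :: "real \<Rightarrow> real measure \<Rightarrow> real \<Rightarrow> real \<Rightarrow> real" where
  "deconv_kernel p \<nu> h x =
     Re (complex_of_real (1 / (2 * pi)) *
       (CLINT u|lborel. iexp (- (u * x)) *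
          (fourier (\<lambda>t. complex_of_real (kernel p t)) u / char \<nu> (u / h))))"

definition f_hat ::
  "real \<Rightarrow> ('d::finite \<Rightarrow> real measure) \<Rightarrow> ('d \<Rightarrow> real) \<Rightarrow> nat \<Rightarrow> (nat \<Rightarrow> real ^ 'd) \<Rightarrow> real ^ 'd \<Rightarrow> real" where
  "f_hat p \<mu>\<epsilon> h n Y x =
     1 / real n * (\<Sum>i<n. \<Prod>j\<in>UNIV. 1 / h j * deconv_kernel p (\<mu>\<epsilon> j) (h j) ((x $ j - Y i $ j) / h j))"

definition f_hat_plus ::
  "real \<Rightarrow> ('d::finite \<Rightarrow> real measure) \<Rightarrow> ('d \<Rightarrow> real) \<Rightarrow> nat \<Rightarrow> (nat \<Rightarrow> real ^ 'd) \<Rightarrow> real ^ 'd \<Rightarrow> real" where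
  "f_hat_plus p \<mu>\<epsilon> h n Y x = max 0 (f_hat p \<mu>\<epsilon> h n Y x)"

definition g_hat ::
  "real \<Rightarrow> ('d::finite \<Rightarrow> real measure) \<Rightarrow> ('d \<Rightarrow> real) \<Rightarrow> nat \<Rightarrow> (nat \<Rightarrow> real ^ 'd) \<Rightarrow> real ^ 'd \<Rightarrow> real" where
  "g_hat p \<mu>\<epsilon> h n Y x =
     1 / (LINT y|lborel. f_hat_plus p \<mu>\<epsilon> h n Y y) * f_hat_plus p \<mu>\<epsilon> h n Y x"

definition mu_hat ::
  "real \<Rightarrow> ('d::finite \<Rightarrow> real measure) \<Rightarrow> ('d \<Rightarrow> real) \<Rightarrow> nat \<Rightarrow> (nat \<Rightarrow> real ^ 'd) \<Rightarrow> (real ^ 'd) measure" where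
  "mu_hat p \<mu>\<epsilon> h n Y = density lborel (\<lambda>x. ennreal (g_hat p \<mu>\<epsilon> h n Y x))"


section \<open>The regularity assumption on the noise\<close>

text \<open>Iterated derivative of a complex-valued function of a real variable; \<^const>\<open>deriv\<close> would
  need equal domain and codomain.\<close>

definition higher_derivative :: "nat \<Rightarrow> (real \<Rightarrow> complex) \<Rightarrow> real \<Rightarrow> complex" where
  "higher_derivative l f = ((\<lambda>g t. vector_derivative g (at t)) ^^ l) f"

text \<open>Division by zero has value 0 here, but a bound on \<^term>\<open>recip_char \<nu>\<close> that is locally
  uniform already forces \<^term>\<open>char \<nu>\<close> to have no zero, by continuity and
  \<^term>\<open>char \<nu> 0 = 1\<close>.\<close>

definition recip_char :: "real measure \<Rightarrow> real \<Rightarrow> complex" where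
  "recip_char \<nu> t = 1 / char \<nu> t"

text \<open>The power \<open>|t|\<^sup>b\<close> with \<open>|t|\<^sup>0 = 1\<close> also at 0, whereas \<^term>\<open>0 powr 0 = (0::real)\<close>.\<close>

definition abs_powr :: "real \<Rightarrow> real \<Rightarrow> real" where
  "abs_powr t b = (if b = 0 then 1 else \<bar>t\<bar> powr b)"

end

theory Submission
  imports Defs
begin

text \<open>The deconvolution kernel is built to be unbiased: averaged over the noise,
\<open>deconv_kernel ((y - e) / h)\<close> equals \<open>kernel (y / h)\<close>, because the factor \<open>char \<nu> (u / h)\<close> produced by the
noise cancels the division in its definition (\<open>expectation_deconv_kernel\<close>). Hence the mean of
the estimator \<open>f_hat\<close> is the density \<open>f\<close> of \<open>X + h Z\<close>, where \<open>X\<close> has law \<open>\<mu>\<close> and the coordinates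
of \<open>Z\<close> are independent with density \<open>kernel\<close>. The risk then has two sources.

\<^item> Smoothing. Moving \<open>X\<close> to \<open>X + h Z\<close> costs \<open>h\<^sup>p E|Z|\<^sup>p\<close>, and the bandwidth is chosen so that
  \<open>h\<^sup>p\<close> is a constant times \<open>(log n)\<close> to the power \<open>- p / \<beta>\<close>. This is the dominant term.

\<^item> Fluctuation. One coupling handles the smoothing and the passage from \<open>f\<close> to the normalised
  positive part of \<open>f_hat\<close> at once: keep the smoothed point with the largest possible probability
  and resample it otherwise (\<open>exists_coupling_le\<close>). It costs a multiple of the integral of
  \<open>(1 + |z|\<^sup>p) |f_hat z - f z|\<close> (\<open>wasserstein_estimator_le\<close>). The arithmetic-geometric mean
  inequality, with the integrable weight \<open>\<Prod>(1 + |z\<^sub>l|)\<^sup>-\<^sup>a\<close> and the free parameter \<open>h\<^sup>p\<close>, trades this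
  \<open>L\<^sup>1\<close> error for a weighted mean square error divided by \<open>h\<^sup>p\<close>
  (\<open>expected_weighted_L1_error_le\<close>), which is at most \<open>1/n\<close> times a weighted second moment of
  one summand.

That second moment factorises over the coordinates (\<open>second_moment_le\<close>) into moments of \<open>\<mu>\<close>,
moments of the noise, and integrals of \<open>(1 + v\<^sup>2\<^sup>q) deconv_kernel(v)\<^sup>2\<close> with \<open>q = \<lceil>p\<rceil> + 1\<close>. By
Bessel's inequality the last ones are controlled by \<open>q\<close>-fold differences of
\<open>kernel_spline u \<cdot> recip_char (u / h)\<close> (\<open>ft_weighted_bessel\<close>), hence by the assumed bound on the
derivatives of \<open>recip_char\<close> on an interval slightly longer than \<open>[-1/h, 1/h]\<close>. Up to powers of
\<open>1/h\<close>, that bound is \<open>exp((\<tau>/h)\<^sup>\<beta> / \<gamma>)\<close> with \<open>\<tau>\<^sup>\<beta> = 3/2\<close>, a power of \<open>n\<close> whose square, multiplied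
over the \<open>d\<close> coordinates, is \<open>n\<close> to the power \<open>3/4\<close>. So the fluctuation is \<open>n\<close> to the power \<open>-1/4\<close>
times powers of \<open>log n\<close>, which is negligible against \<open>h\<^sup>p\<close> (\<open>coord_bound_rate\<close>).\<close>

section \<open>Fourier inversion and Bessel's inequality\<close>

text \<open>Every exchange of two Fourier integrals below has this form: the exponential is the bounded
factor, the functions being transformed are the integrable ones.\<close>

lemma (in pair_sigma_finite) integrable_bounded_times_product:
  fixes f :: "'a \<Rightarrow> complex" and g :: "'b \<Rightarrow> complex"
  assumes f: "integrable M1 f" and g: "integrable M2 g"
    and k[measurable]: "k \<in> borel_measurable (M1 \<Otimes>\<^sub>M M2)" and C: "\<And>z. norm (k z) \<le> C"
  shows "integrable (M1 \<Otimes>\<^sub>M M2) (\<lambda>(x, y). k (x, y) * (f x * g y))"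
proof -
  have [measurable]: "f \<in> borel_measurable M1" "g \<in> borel_measurable M2"
    using f g by auto
  have C0: "0 \<le> C"
    using C[of undefined] norm_ge_zero order_trans by blast
  have fg: "integrable (M1 \<Otimes>\<^sub>M M2) (\<lambda>z. C * norm (f (fst z) * g (snd z)))"
  proof (intro integrable_mult_right integrable_norm Fubini_integrable)
    show "integrable M1 (\<lambda>x. \<integral>y. norm (f (fst (x, y)) * g (snd (x, y))) \<partial>M2)"
      using f g by (simp add: norm_mult)
    show "AE x in M1. integrable M2 (\<lambda>y. f (fst (x, y)) * g (snd (x, y)))"
      using g by simp
  qed measurable
  show ?thesis
    by (rule Bochner_Integration.integrable_bound[OF fg])
       (auto simp: norm_mult split_beta intro!: AE_I2 mult_right_mono
          order_trans[OF _ abs_ge_self] C)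
qed

lemma (in pair_sigma_finite) Fubini_bounded_times_product:
  fixes f :: "'a \<Rightarrow> complex" and g :: "'b \<Rightarrow> complex"
  assumes f: "integrable M1 f" and g: "integrable M2 g"
    and k: "k \<in> borel_measurable (M1 \<Otimes>\<^sub>M M2)" and C: "\<And>z. norm (k z) \<le> C"
  shows "(\<integral>y. (\<integral>x. k (x, y) * (f x * g y) \<partial>M1) \<partial>M2) =
    (\<integral>x. (\<integral>y. k (x, y) * (f x * g y) \<partial>M2) \<partial>M1)"
  using integrable_bounded_times_product[OF assms] by (rule Fubini_integral)

lemma norm_integral_le_nn_integral:
  fixes f :: "'a \<Rightarrow> 'b::{banach, second_countable_topology}"
  shows "ennreal (norm (integral\<^sup>L N f)) \<le> (\<integral>\<^sup>+ x. ennreal (norm (f x)) \<partial>N)"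
proof (cases "integrable N f")
  case True
  then show ?thesis by (rule integral_norm_bound_ennreal)
next
  case False
  then show ?thesis by (simp add: not_integrable_integral_eq)
qed

text \<open>The sign and the missing factor \<open>1/(2\<pi>)\<close> match the inner integral of \<^const>\<open>deconv_kernel\<close>.\<close>

definition ft :: "(real \<Rightarrow> complex) \<Rightarrow> real \<Rightarrow> complex" where
  "ft f x = (CLINT u|lborel. iexp (- (u * x)) * f u)"

lemma norm_iexp [simp]: "norm (iexp t) = 1"
  by (simp add: norm_exp_eq_Re)

lemma iexp_add: "iexp (s + t) = iexp s * iexp t"
  by (simp add: distrib_left exp_add)

lemma integrable_iexp_times:
  fixes f :: "'a \<Rightarrow> complex"
  assumes f: "integrable N f" and [measurable]: "t \<in> borel_measurable N"
  shows "integrable N (\<lambda>u. iexp (t u) * f u)"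
proof -
  have [measurable]: "f \<in> borel_measurable N" using f by simp
  show ?thesis
    using f by (rule Bochner_Integration.integrable_bound) (simp_all add: norm_mult)
qed

lemma norm_ft_le:
  "norm (ft f x) \<le> (LINT u|lborel. norm (f u))"
  unfolding ft_def by (rule order_trans[OF integral_norm_bound]) (simp add: norm_mult)

lemma borel_measurable_ft [measurable]:
  assumes [measurable]: "f \<in> borel_measurable borel"
  shows "ft f \<in> borel_measurable borel"
  unfolding ft_def by measurable

lemma integrable_gauss:
  assumes "s > 0" shows "integrable lborel (\<lambda>x. exp (- (s * x)\<^sup>2 / 2) :: real)"
proof -
  have "integrable lborel (\<lambda>x. sqrt (2 * pi) * std_normal_density (0 + s * x))"
    using assms by (intro integrable_mult_right lborel_integrable_real_affine) auto
  then show ?thesis by (simp add: std_normal_density_def)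
qed

text \<open>A Gaussian is its own transform up to scaling; this is the characteristic function of the
standard normal law after the substitution \<open>x \<mapsto> s x\<close>.\<close>

lemma gauss_integral:
  assumes "s > 0"
  shows "(CLINT x|lborel. iexp (x * t) * complex_of_real (exp (- (s * x)\<^sup>2 / 2)))
    = complex_of_real (2 * pi * (std_normal_density (t / s) / s))"
proof -
  have "char std_normal_distribution (t / s) = (CLINT x|lborel. std_normal_density x *\<^sub>R iexp (t / s * x))"
    unfolding char_def by (subst integral_density) (auto simp: normal_density_nonneg)
  also have "\<dots> = s *\<^sub>R (CLINT x|lborel. std_normal_density (s * x) *\<^sub>R iexp (t / s * (s * x)))"
    using assms by (subst lborel_integral_real_affine[where c = s and t = 0]) simp_all
  also have "(CLINT x|lborel. std_normal_density (s * x) *\<^sub>R iexp (t / s * (s * x)))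
    = (CLINT x|lborel. complex_of_real (1 / sqrt (2 * pi)) * (iexp (x * t) * complex_of_real (exp (- (s * x)\<^sup>2 / 2))))"
    using assms by (intro Bochner_Integration.integral_cong refl)
       (simp add: std_normal_density_def scaleR_conv_of_real mult_ac)
  finally have "complex_of_real (exp (- (t / s)\<^sup>2 / 2)) =
     complex_of_real (s / sqrt (2 * pi)) *
      (CLINT x|lborel. (iexp (x * t) * complex_of_real (exp (- (s * x)\<^sup>2 / 2))))"
    by (simp add: char_std_normal_distribution scaleR_conv_of_real)
  then have "(CLINT x|lborel. (iexp (x * t) * complex_of_real (exp (- (s * x)\<^sup>2 / 2))))
     = complex_of_real (sqrt (2 * pi) / s) * complex_of_real (exp (- (t / s)\<^sup>2 / 2))"
    using assms by (simp add: field_simps)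
  also have "\<dots> = complex_of_real (2 * pi * (std_normal_density (t / s) / s))"
    unfolding std_normal_density_def of_real_mult[symmetric] of_real_eq_iff
    using assms by (simp add: field_simps)
  finally show ?thesis .
qed

text \<open>Damping an inverse Fourier integral by a Gaussian makes the double integral absolutely
convergent. Exchanging the order leaves a mollification of \<open>f\<close> by a Gaussian of width \<open>s\<close>. Inversion
and Bessel's inequality both follow by letting \<open>s\<close> tend to 0.\<close>

lemma ft_gauss_regularised:
  assumes f: "integrable lborel f" and s: "s > 0"
  shows "(CLINT x|lborel. iexp (x * v) * ft f x * complex_of_real (exp (- (s * x)\<^sup>2 / 2)))
    = complex_of_real (2 * pi) * (CLINT u|lborel. f u * complex_of_real (std_normal_density ((v - u) / s) / s))"
proof -
  have [measurable]: "f \<in> borel_measurable borel"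
    using borel_measurable_integrable[OF f] by simp
  let ?e = "\<lambda>x. complex_of_real (exp (- (s * x)\<^sup>2 / 2))"
  have e: "integrable lborel ?e"
    using integrable_gauss[OF s] by (intro integrable_of_real)
  have "(CLINT x|lborel. iexp (x * v) * ft f x * ?e x)
     = (CLINT x|lborel. (CLINT u|lborel. iexp (x * (v - u)) * (f u * ?e x)))"
  proof (rule Bochner_Integration.integral_cong[OF refl])
    fix x
    have "iexp (x * v) * ft f x * ?e x = (iexp (x * v) * ?e x) * (CLINT u|lborel. iexp (- (u * x)) * f u)"
      unfolding ft_def by (simp add: mult_ac)
    also have "\<dots> = (CLINT u|lborel. (iexp (x * v) * ?e x) * (iexp (- (u * x)) * f u))"
      by (rule integral_mult_right_zero[symmetric])
    also have "\<dots> = (CLINT u|lborel. iexp (x * (v - u)) * (f u * ?e x))"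
    proof (intro Bochner_Integration.integral_cong refl)
      fix u
      have "x * (v - u) = x * v + - (u * x)" by (simp add: algebra_simps)
      then show "(iexp (x * v) * ?e x) * (iexp (- (u * x)) * f u) = iexp (x * (v - u)) * (f u * ?e x)"
        by (simp only: iexp_add mult_ac)
    qed
    finally show "iexp (x * v) * ft f x * ?e x = (CLINT u|lborel. iexp (x * (v - u)) * (f u * ?e x))" .
  qed
  also have "\<dots> = (CLINT u|lborel. (CLINT x|lborel. iexp (x * (v - u)) * (f u * ?e x)))"
    using lborel_pair.Fubini_bounded_times_product[OF f e, of "\<lambda>(u, x). iexp (x * (v - u))" 1]
    by (simp add: split_beta)
  also have "\<dots> = (CLINT u|lborel. complex_of_real (2 * pi) * (f u * complex_of_real (std_normal_density ((v - u) / s) / s)))"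
  proof (rule Bochner_Integration.integral_cong[OF refl])
    fix u
    have "(CLINT x|lborel. iexp (x * (v - u)) * (f u * ?e x)) = (CLINT x|lborel. f u * (iexp (x * (v - u)) * ?e x))"
      by (simp add: mult_ac)
    also have "\<dots> = f u * complex_of_real (2 * pi * (std_normal_density ((v - u) / s) / s))"
      using gauss_integral[OF s, of "v - u"] by (simp only: integral_mult_right_zero)
    finally show "(CLINT x|lborel. iexp (x * (v - u)) * (f u * ?e x))
       = complex_of_real (2 * pi) * (f u * complex_of_real (std_normal_density ((v - u) / s) / s))"
      by simp
  qed
  finally show ?thesis by (simp only: integral_mult_right_zero)
qed

text \<open>Let \<open>s\<close> tend to 0 in \<open>ft_gauss_regularised\<close>. On the left the integrable transform dominates; on
the right, after \<open>u = v - s w\<close>, boundedness dominates and continuity at \<open>v\<close> gives the limit.\<close>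

theorem ft_inversion:
  assumes f: "integrable lborel f" and bnd: "\<And>u. norm (f u) \<le> B"
    and cont: "isCont f v" and ft: "integrable lborel (ft f)"
  shows "(CLINT x|lborel. iexp (x * v) * ft f x) = complex_of_real (2 * pi) * f v"
proof -
  have [measurable]: "f \<in> borel_measurable borel"
    using borel_measurable_integrable[OF f] by simp
  define s where "s n = 1 / real (Suc n)" for n
  have s: "s n > 0" for n by (simp add: s_def)
  have s0: "s \<longlonglongrightarrow> 0"
    unfolding s_def using LIMSEQ_inverse_real_of_nat by (simp add: inverse_eq_divide)
  let ?L = "\<lambda>n. (CLINT x|lborel. iexp (x * v) * ft f x * complex_of_real (exp (- (s n * x)\<^sup>2 / 2)))"
  have lim1: "?L \<longlonglongrightarrow> (CLINT x|lborel. iexp (x * v) * ft f x)"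
  proof (rule integral_dominated_convergence[where w = "\<lambda>x. norm (ft f x)"])
    show "integrable lborel (\<lambda>x. norm (ft f x))" using ft by simp
    show "AE x in lborel. (\<lambda>n. iexp (x * v) * ft f x * complex_of_real (exp (- (s n * x)\<^sup>2 / 2)))
       \<longlonglongrightarrow> iexp (x * v) * ft f x"
    proof (rule AE_I2)
      fix x
      have "(\<lambda>n. iexp (x * v) * ft f x * complex_of_real (exp (- (s n * x)\<^sup>2 / 2)))
         \<longlonglongrightarrow> iexp (x * v) * ft f x * complex_of_real (exp (- (0 * x)\<^sup>2 / 2))"
        by (intro tendsto_intros s0) simp_all
      then show "(\<lambda>n. iexp (x * v) * ft f x * complex_of_real (exp (- (s n * x)\<^sup>2 / 2)))
         \<longlonglongrightarrow> iexp (x * v) * ft f x" by simp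
    qed
    show "AE x in lborel. norm (iexp (x * v) * ft f x * complex_of_real (exp (- (s n * x)\<^sup>2 / 2))) \<le> norm (ft f x)" for n
      by (auto simp: norm_mult mult_left_le)
  qed measurable
  have eq: "?L n = complex_of_real (2 * pi) * (CLINT w|lborel. f (v - s n * w) * complex_of_real (std_normal_density w))" for n
  proof -
    have "(CLINT u|lborel. f u * complex_of_real (std_normal_density ((v - u) / s n) / s n))
      = \<bar>- s n\<bar> *\<^sub>R (CLINT w|lborel. f (v + (- s n) * w) * complex_of_real (std_normal_density ((v - (v + (- s n) * w)) / s n) / s n))"
      using s[of n] by (intro lborel_integral_real_affine) simp
    also have "\<dots> = complex_of_real (s n) * (CLINT w|lborel. f (v - s n * w) * complex_of_real (std_normal_density w / s n))"
      using s[of n] by (simp add: scaleR_conv_of_real)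
    also have "\<dots> = (CLINT w|lborel. complex_of_real (s n) * (f (v - s n * w) * complex_of_real (std_normal_density w / s n)))"
      by (rule integral_mult_right_zero[symmetric])
    also have "\<dots> = (CLINT w|lborel. f (v - s n * w) * complex_of_real (std_normal_density w))"
      using s[of n] by (intro Bochner_Integration.integral_cong refl) (simp add: field_simps)
    finally show ?thesis
      using ft_gauss_regularised[OF f s[of n], of v] by simp
  qed
  have lim2: "(\<lambda>n. complex_of_real (2 * pi) * (CLINT w|lborel. f (v - s n * w) * complex_of_real (std_normal_density w)))
     \<longlonglongrightarrow> complex_of_real (2 * pi) * (CLINT w|lborel. f v * complex_of_real (std_normal_density w))"
  proof (intro tendsto_mult tendsto_const integral_dominated_convergence[where w = "\<lambda>w. B * std_normal_density w"])
    show "AE w in lborel. (\<lambda>n. f (v - s n * w) * complex_of_real (std_normal_density w)) \<longlonglongrightarrow> f v * complex_of_real (std_normal_density w)"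
    proof (intro AE_I2 tendsto_mult tendsto_const)
      fix w
      have "(\<lambda>n. v - s n * w) \<longlonglongrightarrow> v - 0 * w" by (intro tendsto_diff tendsto_const tendsto_mult s0)
      then show "(\<lambda>n. f (v - s n * w)) \<longlonglongrightarrow> f v"
        using isCont_tendsto_compose[OF cont] by simp
    qed
    show "AE w in lborel. norm (f (v - s n * w) * complex_of_real (std_normal_density w)) \<le> B * std_normal_density w" for n
      using bnd by (intro AE_I2) (simp add: norm_mult mult_right_mono)
    show "integrable lborel (\<lambda>w. B * std_normal_density w)"
      by simp
  qed measurable
  have one: "(CLINT w|lborel. f v * complex_of_real (std_normal_density w)) = f v"
    by (simp add: integral_complex_of_real)
  show ?thesis
    using LIMSEQ_unique[OF lim1[unfolded eq] lim2] unfolding one .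
qed

text \<open>One half of Plancherel's theorem. With Gaussian damping the left side is a double integral of
\<open>f u \<cdot> cnj (f v)\<close> against a probability density in \<open>v - u\<close>. Since
\<open>2 |f u| |f v| \<le> |f u|\<^sup>2 + |f v|\<^sup>2\<close>, it is bounded by the right side uniformly in the damping, which
Fatou's lemma then removes.\<close>

theorem ft_bessel:
  assumes f: "integrable lborel f" and f2: "integrable lborel (\<lambda>u. (norm (f u))\<^sup>2)"
  shows "(\<integral>\<^sup>+ x. ennreal ((norm (ft f x))\<^sup>2) \<partial>lborel) \<le> ennreal (2 * pi * (LINT u|lborel. (norm (f u))\<^sup>2))"
proof -
  have [measurable]: "f \<in> borel_measurable borel"
    using borel_measurable_integrable[OF f] by simp
  define D where "D s z = std_normal_density (z / s) / s" for s z :: real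
  have [measurable]: "D s \<in> borel_measurable borel" for s unfolding D_def by measurable
  have reg: "(\<integral>\<^sup>+ x. ennreal ((norm (ft f x))\<^sup>2 * exp (- (s * x)\<^sup>2 / 2)) \<partial>lborel)
      \<le> ennreal (2 * pi * (LINT u|lborel. (norm (f u))\<^sup>2))" if s: "s > 0" for s
  proof -
    let ?e = "\<lambda>x. exp (- (s * x)\<^sup>2 / 2) :: real"
    define I where "I = (LINT u|lborel. norm (f u))"
    have D0: "0 \<le> D s z" for z using s by (simp add: D_def)
    have D1: "(\<integral>\<^sup>+u. ennreal (D s (v - u)) \<partial>lborel) = 1" for v
    proof -
      have "(\<integral>\<^sup>+u. ennreal (D s (v - u)) \<partial>lborel) = ennreal \<bar>- s\<bar> * (\<integral>\<^sup>+w. ennreal (D s (v - (v + (- s) * w))) \<partial>lborel)"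
        using s by (intro nn_integral_real_affine) auto
      also have "\<dots> = (\<integral>\<^sup>+w. ennreal s * ennreal (D s (s * w)) \<partial>lborel)"
        using s by (subst nn_integral_cmult) auto
      also have "\<dots> = (\<integral>\<^sup>+w. ennreal (std_normal_density w) \<partial>lborel)"
        using s by (intro nn_integral_cong) (simp add: D_def ennreal_mult[symmetric])
      also have "\<dots> = 1" by (subst nn_integral_eq_integral) auto
      finally show ?thesis .
    qed
    have D1': "(\<integral>\<^sup>+v. ennreal (D s (v - u)) \<partial>lborel) = 1" for u
    proof -
      have "D s (v - u) = D s (u - v)" for v
        by (simp add: D_def std_normal_density_def power2_commute power_divide)
      then show ?thesis using D1[of u] by simp
    qed
    have ge: "integrable lborel (\<lambda>x. ft f x * complex_of_real (?e x))"
    proof (rule Bochner_Integration.integrable_bound[where f = "\<lambda>x. I * ?e x"])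
      show "integrable lborel (\<lambda>x. I * ?e x)" using integrable_gauss[OF s] by simp
      show "AE x in lborel. norm (ft f x * complex_of_real (?e x)) \<le> norm (I * ?e x)"
        using norm_ft_le[of f] by (auto simp: norm_mult I_def intro!: mult_right_mono AE_I2 order_trans[OF _ abs_ge_self])
    qed measurable
    have cf: "integrable lborel (\<lambda>v. cnj (f v))" using f by simp
    have sq: "integrable lborel (\<lambda>x. (norm (ft f x))\<^sup>2 * ?e x)"
    proof (rule Bochner_Integration.integrable_bound[where f = "\<lambda>x. I\<^sup>2 * ?e x"])
      show "integrable lborel (\<lambda>x. I\<^sup>2 * ?e x)" using integrable_gauss[OF s] by simp
      show "AE x in lborel. norm ((norm (ft f x))\<^sup>2 * ?e x) \<le> norm (I\<^sup>2 * ?e x)"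
        using norm_ft_le[of f] by (auto simp: I_def intro!: mult_right_mono power_mono AE_I2)
    qed measurable
    have "complex_of_real (LINT x|lborel. (norm (ft f x))\<^sup>2 * ?e x)
       = (CLINT x|lborel. complex_of_real ((norm (ft f x))\<^sup>2 * ?e x))"
      by (rule integral_complex_of_real[symmetric])
    also have "\<dots> = (CLINT x|lborel. (CLINT v|lborel. iexp (x * v) * (cnj (f v) * (ft f x * complex_of_real (?e x)))))"
    proof (rule Bochner_Integration.integral_cong[OF refl])
      fix x
      have "cnj (ft f x) = (CLINT v|lborel. iexp (x * v) * cnj (f v))"
        unfolding ft_def by (subst Bochner_Integration.integral_cnj[symmetric]) (simp add: exp_cnj mult_ac)
      then have "complex_of_real ((norm (ft f x))\<^sup>2 * ?e x)
         = (CLINT v|lborel. iexp (x * v) * cnj (f v)) * (ft f x * complex_of_real (?e x))"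
        unfolding of_real_mult complex_norm_square by (simp only: mult_ac)
      also have "\<dots> = (CLINT v|lborel. iexp (x * v) * (cnj (f v) * (ft f x * complex_of_real (?e x))))"
        by (subst integral_mult_left_zero[symmetric]) (simp add: mult_ac)
      finally show "complex_of_real ((norm (ft f x))\<^sup>2 * ?e x)
         = (CLINT v|lborel. iexp (x * v) * (cnj (f v) * (ft f x * complex_of_real (?e x))))" .
    qed
    also have "\<dots> = (CLINT v|lborel. (CLINT x|lborel. iexp (x * v) * (cnj (f v) * (ft f x * complex_of_real (?e x)))))"
      using lborel_pair.Fubini_bounded_times_product[OF cf ge, of "\<lambda>(v, x). iexp (x * v)" 1]
      by (simp add: split_beta)
    also have "\<dots> = (CLINT v|lborel. cnj (f v) * (complex_of_real (2 * pi) * (CLINT u|lborel. f u * complex_of_real (D s (v - u)))))"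
    proof (rule Bochner_Integration.integral_cong[OF refl])
      fix v
      have "(CLINT x|lborel. iexp (x * v) * (cnj (f v) * (ft f x * complex_of_real (?e x))))
        = (CLINT x|lborel. cnj (f v) * (iexp (x * v) * ft f x * complex_of_real (?e x)))"
        by (simp add: mult_ac)
      also have "\<dots> = cnj (f v) * (complex_of_real (2 * pi) * (CLINT u|lborel. f u * complex_of_real (D s (v - u))))"
        using ft_gauss_regularised[OF f s, of v] unfolding D_def by (simp only: integral_mult_right_zero)
      finally show "(CLINT x|lborel. iexp (x * v) * (cnj (f v) * (ft f x * complex_of_real (?e x)))) = \<dots>" .
    qed
    finally have eq: "complex_of_real (LINT x|lborel. (norm (ft f x))\<^sup>2 * ?e x) =
      (CLINT v|lborel. cnj (f v) * (complex_of_real (2 * pi) * (CLINT u|lborel. f u * complex_of_real (D s (v - u)))))" .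
    have "(\<integral>\<^sup>+ x. ennreal ((norm (ft f x))\<^sup>2 * ?e x) \<partial>lborel) = ennreal (LINT x|lborel. (norm (ft f x))\<^sup>2 * ?e x)"
      using sq by (intro nn_integral_eq_integral) auto
    also have "\<dots> = ennreal (norm (complex_of_real (LINT x|lborel. (norm (ft f x))\<^sup>2 * ?e x)))"
      unfolding norm_of_real by (rule arg_cong[where f = ennreal], rule abs_of_nonneg[symmetric]) (simp add: integral_nonneg_AE)
    also have "\<dots> \<le> (\<integral>\<^sup>+v. ennreal (norm (cnj (f v) * (complex_of_real (2 * pi) * (CLINT u|lborel. f u * complex_of_real (D s (v - u)))))) \<partial>lborel)"
      unfolding eq by (rule norm_integral_le_nn_integral) 
    also have "\<dots> \<le> (\<integral>\<^sup>+v. ennreal (norm (f v) * (2 * pi)) * (\<integral>\<^sup>+u. ennreal (norm (f u) * D s (v - u)) \<partial>lborel) \<partial>lborel)"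
    proof (rule nn_integral_mono)
      fix v
      have "ennreal (norm (CLINT u|lborel. f u * complex_of_real (D s (v - u)))) \<le> (\<integral>\<^sup>+u. ennreal (norm (f u * complex_of_real (D s (v - u)))) \<partial>lborel)"
        by (rule norm_integral_le_nn_integral)
      then have "ennreal (norm (CLINT u|lborel. f u * complex_of_real (D s (v - u)))) \<le> (\<integral>\<^sup>+u. ennreal (norm (f u) * D s (v - u)) \<partial>lborel)"
        using D0 by (simp add: norm_mult)
      then have "ennreal (norm (f v) * (2 * pi)) * ennreal (norm (CLINT u|lborel. f u * complex_of_real (D s (v - u)))) \<le> ennreal (norm (f v) * (2 * pi)) * (\<integral>\<^sup>+u. ennreal (norm (f u) * D s (v - u)) \<partial>lborel)"
        by (rule mult_left_mono) simp
      then show "ennreal (norm (cnj (f v) * (complex_of_real (2 * pi) * (CLINT u|lborel. f u * complex_of_real (D s (v - u))))))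
        \<le> ennreal (norm (f v) * (2 * pi)) * (\<integral>\<^sup>+u. ennreal (norm (f u) * D s (v - u)) \<partial>lborel)"
        by (simp add: norm_mult ennreal_mult[symmetric] mult_ac)
    qed
    also have "\<dots> = (\<integral>\<^sup>+v. (\<integral>\<^sup>+u. ennreal (2 * pi * (norm (f v) * norm (f u) * D s (v - u))) \<partial>lborel) \<partial>lborel)"
      using D0 by (subst nn_integral_cmult[symmetric])
        (auto simp: ennreal_mult[symmetric] mult_ac intro!: nn_integral_cong)
    also have "\<dots> \<le> (\<integral>\<^sup>+v. (\<integral>\<^sup>+u. ennreal (pi * (norm (f v))\<^sup>2) * ennreal (D s (v - u)) + ennreal (pi * (norm (f u))\<^sup>2) * ennreal (D s (v - u)) \<partial>lborel) \<partial>lborel)"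
    proof (intro nn_integral_mono)
      fix v u
      have "2 * (norm (f v) * norm (f u)) \<le> (norm (f v))\<^sup>2 + (norm (f u))\<^sup>2"
        using sum_squares_bound[of "norm (f v)" "norm (f u)"] by simp
      then have "pi * D s (v - u) * (2 * (norm (f v) * norm (f u))) \<le> pi * D s (v - u) * ((norm (f v))\<^sup>2 + (norm (f u))\<^sup>2)"
        using D0[of "v - u"] by (intro mult_left_mono) auto
      then have "2 * pi * (norm (f v) * norm (f u) * D s (v - u)) \<le> pi * (norm (f v))\<^sup>2 * D s (v - u) + pi * (norm (f u))\<^sup>2 * D s (v - u)"
        by (simp add: algebra_simps)
      then show "ennreal (2 * pi * (norm (f v) * norm (f u) * D s (v - u)))
         \<le> ennreal (pi * (norm (f v))\<^sup>2) * ennreal (D s (v - u)) + ennreal (pi * (norm (f u))\<^sup>2) * ennreal (D s (v - u))"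
        using D0[of "v - u"] by (simp add: ennreal_mult[symmetric] ennreal_plus[symmetric] del: ennreal_plus)
    qed
    also have "\<dots> = (\<integral>\<^sup>+v. (\<integral>\<^sup>+u. ennreal (pi * (norm (f v))\<^sup>2) * ennreal (D s (v - u)) \<partial>lborel) \<partial>lborel)
       + (\<integral>\<^sup>+v. (\<integral>\<^sup>+u. ennreal (pi * (norm (f u))\<^sup>2) * ennreal (D s (v - u)) \<partial>lborel) \<partial>lborel)"
      by (subst nn_integral_add, simp, simp, subst nn_integral_add) auto
    also have "(\<integral>\<^sup>+v. (\<integral>\<^sup>+u. ennreal (pi * (norm (f u))\<^sup>2) * ennreal (D s (v - u)) \<partial>lborel) \<partial>lborel)
      = (\<integral>\<^sup>+u. (\<integral>\<^sup>+v. ennreal (pi * (norm (f u))\<^sup>2) * ennreal (D s (v - u)) \<partial>lborel) \<partial>lborel)"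
      by (rule lborel_pair.Fubini') measurable
    also have "(\<integral>\<^sup>+v. (\<integral>\<^sup>+u. ennreal (pi * (norm (f v))\<^sup>2) * ennreal (D s (v - u)) \<partial>lborel) \<partial>lborel) = (\<integral>\<^sup>+v. ennreal (pi * (norm (f v))\<^sup>2) \<partial>lborel)"
      by (subst nn_integral_cmult) (auto simp: D1)
    also have "(\<integral>\<^sup>+u. (\<integral>\<^sup>+v. ennreal (pi * (norm (f u))\<^sup>2) * ennreal (D s (v - u)) \<partial>lborel) \<partial>lborel) = (\<integral>\<^sup>+v. ennreal (pi * (norm (f v))\<^sup>2) \<partial>lborel)"
      by (subst nn_integral_cmult) (auto simp: D1')
    also have "(\<integral>\<^sup>+v. ennreal (pi * (norm (f v))\<^sup>2) \<partial>lborel) = ennreal (pi * (LINT v|lborel. (norm (f v))\<^sup>2))"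
      using f2 by (subst nn_integral_eq_integral) auto
    finally show ?thesis
      by (simp add: ennreal_plus[symmetric] integral_nonneg_AE mult.assoc del: ennreal_plus)
  qed
  define s where "s n = 1 / real (Suc n)" for n
  have s: "s n > 0" for n by (simp add: s_def)
  have s0: "s \<longlonglongrightarrow> 0"
    unfolding s_def using LIMSEQ_inverse_real_of_nat by (simp add: inverse_eq_divide)
  let ?F = "\<lambda>n x. ennreal ((norm (ft f x))\<^sup>2 * exp (- (s n * x)\<^sup>2 / 2))"
  have lim: "(\<lambda>n. ?F n x) \<longlonglongrightarrow> ennreal ((norm (ft f x))\<^sup>2)" for x
  proof -
    have "(\<lambda>n. (norm (ft f x))\<^sup>2 * exp (- (s n * x)\<^sup>2 / 2)) \<longlonglongrightarrow> (norm (ft f x))\<^sup>2 * exp (- (0 * x)\<^sup>2 / 2)"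
      by (intro tendsto_intros s0) simp_all
    then show ?thesis by (intro tendsto_ennrealI) simp
  qed
  have "(\<integral>\<^sup>+ x. ennreal ((norm (ft f x))\<^sup>2) \<partial>lborel) = (\<integral>\<^sup>+ x. liminf (\<lambda>n. ?F n x) \<partial>lborel)"
    using lim_imp_Liminf[OF _ lim] by simp
  also have "\<dots> \<le> liminf (\<lambda>n. \<integral>\<^sup>+ x. ?F n x \<partial>lborel)"
    by (rule nn_integral_liminf) measurable
  also have "\<dots> \<le> ennreal (2 * pi * (LINT u|lborel. (norm (f u))\<^sup>2))"
    using reg[OF s] by (intro Liminf_le) (auto intro!: always_eventually)
  finally show ?thesis .
qed

section \<open>Finite differences and B-splines\<close>

text \<open>Smoothness enters the analysis of the deconvolution kernel only through bounds of the form
\<open>|fdiff d ^^ q| \<le> L d\<^sup>q\<close>. Such bounds hold for splines up to the order at which the derivative exists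
only piecewise, and they multiply by a Leibniz rule.\<close>

definition fdiff :: "real \<Rightarrow> (real \<Rightarrow> 'a::ab_group_add) \<Rightarrow> real \<Rightarrow> 'a" where
  "fdiff d f u = f (u + d) - f u"

lemma fdiff_funpow_Suc: "(fdiff d ^^ Suc l) f = (fdiff d ^^ l) (fdiff d f)"
  by (simp add: funpow_swap1)

lemma fdiff_funpow_add:
  "(fdiff d ^^ l) (\<lambda>u. f u + g u) u = (fdiff d ^^ l) f u + (fdiff d ^^ l) g u"
  by (induction l arbitrary: u) (simp_all add: fdiff_def)

lemma fdiff_funpow_shift:
  "(fdiff d ^^ l) (\<lambda>u. f (u + c)) u = (fdiff d ^^ l) f (u + c)"
  by (induction l arbitrary: u) (simp_all add: fdiff_def add_ac)

lemma fdiff_funpow_scale: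
  fixes h :: real
  shows "(fdiff d ^^ l) (\<lambda>u. f (u / h)) u = (fdiff (d / h) ^^ l) f (u / h)"
  by (induction l arbitrary: u) (simp_all add: fdiff_def add_divide_distrib)

lemma fdiff_funpow_eq_0:
  assumes "\<And>j. j \<le> l \<Longrightarrow> f (u + real j * d) = 0"
  shows "(fdiff d ^^ l) f u = 0"
  using assms
proof (induction l arbitrary: u)
  case (Suc l)
  have "(fdiff d ^^ l) f u = 0"
    by (rule Suc.IH) (simp add: Suc.prems)
  moreover have "(fdiff d ^^ l) f (u + d) = 0"
  proof (rule Suc.IH)
    fix j assume "j \<le> l"
    then show "f (u + d + real j * d) = 0"
      using Suc.prems[of "Suc j"] by (simp add: algebra_simps)
  qed
  ultimately show ?case by (simp add: fdiff_def[of d "(fdiff d ^^ l) f"])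
qed simp

lemma borel_measurable_fdiff_funpow [measurable]:
  fixes f :: "real \<Rightarrow> complex"
  assumes f[measurable]: "f \<in> borel_measurable borel"
  shows "(fdiff d ^^ l) f \<in> borel_measurable borel"
proof (induction l)
  case (Suc l)
  note [measurable] = Suc
  show ?case unfolding funpow.simps o_def fdiff_def[of d "(fdiff d ^^ l) f", abs_def] by measurable
qed simp

text \<open>The Leibniz rule as an inequality: \<open>fdiff d (f g) = fdiff d f \<cdot> g(\<cdot> + d) + f \<cdot> fdiff d g\<close>, so
\<open>l\<close> steps produce \<open>2\<^sup>l\<close> terms. The hypotheses sample \<open>f\<close> and \<open>g\<close> only at the points between \<open>u\<close> and
\<open>u + l d\<close>, because the second factor will be bounded only locally.\<close>

lemma norm_fdiff_funpow_mult_le: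
  fixes f g :: "real \<Rightarrow> complex"
  assumes "d \<ge> 0" "A \<ge> 0" "B \<ge> 0"
    and "\<And>i j. i + j \<le> l \<Longrightarrow> norm ((fdiff d ^^ i) f (u + real j * d)) \<le> A * d ^ i"
    and "\<And>i j. i + j \<le> l \<Longrightarrow> norm ((fdiff d ^^ i) g (u + real j * d)) \<le> B * d ^ i"
  shows "norm ((fdiff d ^^ l) (\<lambda>u. f u * g u) u) \<le> 2 ^ l * A * B * d ^ l"
  using assms
proof (induction l arbitrary: f g A B)
  case 0
  have "norm (f u) \<le> A" "norm (g u) \<le> B" using "0.prems"(4,5)[of 0 0] by auto
  then show ?case by (simp add: norm_mult mult_mono' )
next
  case (Suc l)
  have split: "fdiff d (\<lambda>u. f u * g u) = (\<lambda>u. fdiff d f u * g (u + d) + f u * fdiff d g u)"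
    by (auto simp: fdiff_def algebra_simps)
  have 1: "norm ((fdiff d ^^ l) (\<lambda>u. fdiff d f u * g (u + d)) u) \<le> 2 ^ l * (A * d) * B * d ^ l"
  proof (rule Suc.IH)
    fix i j assume ij: "i + j \<le> l"
    show "norm ((fdiff d ^^ i) (fdiff d f) (u + real j * d)) \<le> A * d * d ^ i"
      using Suc.prems(4)[of "Suc i" j] ij by (simp add: fdiff_funpow_Suc mult_ac del: funpow.simps)
    show "norm ((fdiff d ^^ i) (\<lambda>u. g (u + d)) (u + real j * d)) \<le> B * d ^ i"
      using Suc.prems(5)[of i "Suc j"] ij by (simp add: fdiff_funpow_shift algebra_simps)
  qed (use Suc.prems in auto)
  have 2: "norm ((fdiff d ^^ l) (\<lambda>u. f u * fdiff d g u) u) \<le> 2 ^ l * A * (B * d) * d ^ l"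
  proof (rule Suc.IH)
    fix i j assume ij: "i + j \<le> l"
    show "norm ((fdiff d ^^ i) f (u + real j * d)) \<le> A * d ^ i"
      using Suc.prems(4)[of i j] ij by simp
    show "norm ((fdiff d ^^ i) (fdiff d g) (u + real j * d)) \<le> B * d * d ^ i"
      using Suc.prems(5)[of "Suc i" j] ij by (simp add: fdiff_funpow_Suc mult_ac del: funpow.simps)
  qed (use Suc.prems in auto)
  have "norm ((fdiff d ^^ Suc l) (\<lambda>u. f u * g u) u) \<le>
     norm ((fdiff d ^^ l) (\<lambda>u. fdiff d f u * g (u + d)) u) + norm ((fdiff d ^^ l) (\<lambda>u. f u * fdiff d g u) u)"
    unfolding fdiff_funpow_Suc split fdiff_funpow_add by (rule norm_triangle_ineq)
  also have "\<dots> \<le> 2 ^ l * (A * d) * B * d ^ l + 2 ^ l * A * (B * d) * d ^ l"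
    using 1 2 by (rule add_mono)
  finally show ?case by (simp add: algebra_simps)
qed

lemma fdiff_funpow_integral:
  fixes f :: "real \<Rightarrow> complex"
  assumes k: "integrable lborel k" and f: "f \<in> borel_measurable borel" "\<And>u. norm (f u) \<le> B"
  shows "(fdiff d ^^ l) (\<lambda>u. CLINT s|lborel. k s * f (u + s)) u = (CLINT s|lborel. k s * (fdiff d ^^ l) f (u + s))"
  using f
proof (induction l arbitrary: f B)
  case (Suc l)
  have [measurable]: "f \<in> borel_measurable borel" "k \<in> borel_measurable borel"
    using Suc.prems k by auto
  have int: "integrable lborel (\<lambda>s. k s * f (v + s))" for v
  proof (rule Bochner_Integration.integrable_bound)
    show "integrable lborel (\<lambda>s. B * norm (k s))" using k by simp
    show "AE s in lborel. norm (k s * f (v + s)) \<le> norm (B * norm (k s))"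
    proof (rule AE_I2)
      fix s
      have "norm (k s * f (v + s)) \<le> norm (k s) * B"
        unfolding norm_mult by (intro mult_left_mono Suc.prems) simp
      also have "\<dots> \<le> norm (B * norm (k s))" by (simp add: mult_ac)
      finally show "norm (k s * f (v + s)) \<le> norm (B * norm (k s))" .
    qed
  qed measurable
  have "fdiff d (\<lambda>u. CLINT s|lborel. k s * f (u + s)) = (\<lambda>u. CLINT s|lborel. k s * fdiff d f (u + s))"
  proof
    fix u
    have "fdiff d (\<lambda>u. CLINT s|lborel. k s * f (u + s)) u = (CLINT s|lborel. k s * f (u + d + s) - k s * f (u + s))"
      unfolding fdiff_def using int by (intro Bochner_Integration.integral_diff[symmetric])
    then show "fdiff d (\<lambda>u. CLINT s|lborel. k s * f (u + s)) u = (CLINT s|lborel. k s * fdiff d f (u + s))"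
      by (simp add: fdiff_def algebra_simps)
  qed
  then have "(fdiff d ^^ Suc l) (\<lambda>u. CLINT s|lborel. k s * f (u + s)) u
     = (fdiff d ^^ l) (\<lambda>u. CLINT s|lborel. k s * fdiff d f (u + s)) u"
    by (simp add: fdiff_funpow_Suc del: funpow.simps)
  also have "\<dots> = (CLINT s|lborel. k s * (fdiff d ^^ l) (fdiff d f) (u + s))"
  proof (rule Suc.IH)
    show "fdiff d f \<in> borel_measurable borel" by (simp add: fdiff_def[abs_def])
    show "norm (fdiff d f u) \<le> B + B" for u
      unfolding fdiff_def using Suc.prems(2) by (intro order_trans[OF norm_triangle_ineq4] add_mono) auto
  qed
  finally show ?case by (simp add: fdiff_funpow_Suc del: funpow.simps)
qed simp

lemma ft_shift: "ft (\<lambda>u. f (u + t)) x = iexp (t * x) * ft f x"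
proof -
  have "ft f x = (CLINT u|lborel. iexp (- ((t + 1 * u) * x)) * f (t + 1 * u))"
    unfolding ft_def by (subst lborel_integral_real_affine[where c = 1 and t = t]) simp_all
  also have "\<dots> = (CLINT u|lborel. iexp (- (t * x)) * (iexp (- (u * x)) * f (u + t)))"
  proof (intro Bochner_Integration.integral_cong refl)
    fix u
    have "- ((t + 1 * u) * x) = - (t * x) + - (u * x)" by (simp add: algebra_simps)
    then show "iexp (- ((t + 1 * u) * x)) * f (t + 1 * u) = iexp (- (t * x)) * (iexp (- (u * x)) * f (u + t))"
      by (simp only: iexp_add mult.assoc) (simp add: add.commute)
  qed
  also have "\<dots> = iexp (- (t * x)) * ft (\<lambda>u. f (u + t)) x"
    unfolding ft_def by (rule integral_mult_right_zero)
  finally have "iexp (t * x) * ft f x = iexp (t * x + - (t * x)) * ft (\<lambda>u. f (u + t)) x"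
    by (simp only: iexp_add mult.assoc)
  then show ?thesis by simp
qed

text \<open>The convolution theorem, written for \<open>f (u + t)\<close> instead of \<open>f (u - t)\<close>; this is why the
transform of \<open>k\<close> appears with the opposite sign.\<close>

lemma ft_correlation:
  fixes f k :: "real \<Rightarrow> complex"
  assumes k: "integrable lborel k" and f: "integrable lborel f"
  shows "ft (\<lambda>u. CLINT t|lborel. k t * f (u + t)) x = (CLINT t|lborel. iexp (t * x) * k t) * ft f x"
proof -
  have [measurable]: "f \<in> borel_measurable borel" "k \<in> borel_measurable borel"
    using f k by auto
  have fs: "integrable lborel (\<lambda>u. f (u + t))" for t
    using lborel_integrable_real_affine[OF f, of 1 t] by (simp add: add.commute)
  have nf: "(LINT u|lborel. norm (f (u + t))) = (LINT u|lborel. norm (f u))" for t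
    by (subst (2) lborel_integral_real_affine[where c = 1 and t = t]) (simp_all add: add.commute)
  have int: "integrable (lborel \<Otimes>\<^sub>M lborel) (\<lambda>(t, u). iexp (- (u * x)) * (k t * f (u + t)))"
  proof (rule lborel_pair.Fubini_integrable)
    show "integrable lborel (\<lambda>t. LINT u|lborel. norm (case (t, u) of (t, u) \<Rightarrow> iexp (- (u * x)) * (k t * f (u + t))))"
      using k by (simp add: norm_mult nf)
    show "AE t in lborel. integrable lborel (\<lambda>u. case (t, u) of (t, u) \<Rightarrow> iexp (- (u * x)) * (k t * f (u + t)))"
    proof (rule AE_I2)
      fix t
      have "integrable lborel (\<lambda>u. iexp (- (u * x)) * (k t * f (u + t)))"
        by (intro integrable_iexp_times integrable_mult_right fs) measurable
      then show "integrable lborel (\<lambda>u. case (t, u) of (t, u) \<Rightarrow> iexp (- (u * x)) * (k t * f (u + t)))"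
        by (simp only: prod.case)
    qed
  qed measurable
  have "ft (\<lambda>u. CLINT t|lborel. k t * f (u + t)) x
     = (CLINT u|lborel. (CLINT t|lborel. iexp (- (u * x)) * (k t * f (u + t))))"
    unfolding ft_def by (simp only: integral_mult_right_zero)
  also have "\<dots> = (CLINT t|lborel. (CLINT u|lborel. iexp (- (u * x)) * (k t * f (u + t))))"
    by (rule lborel_pair.Fubini_integral[OF int])
  also have "\<dots> = (CLINT t|lborel. (iexp (t * x) * k t) * ft f x)"
  proof (intro Bochner_Integration.integral_cong refl)
    fix t
    have "(CLINT u|lborel. iexp (- (u * x)) * (k t * f (u + t))) = (CLINT u|lborel. k t * (iexp (- (u * x)) * f (u + t)))"
      by (simp add: mult_ac)
    also have "\<dots> = k t * ft (\<lambda>u. f (u + t)) x"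
      unfolding ft_def by (rule integral_mult_right_zero)
    finally show "(CLINT u|lborel. iexp (- (u * x)) * (k t * f (u + t))) = (iexp (t * x) * k t) * ft f x"
      by (simp add: ft_shift)
  qed
  finally show ?thesis by (simp only: integral_mult_left_zero)
qed

lemma norm_integral_le:
  fixes f :: "'a \<Rightarrow> 'b::{banach, second_countable_topology}"
  assumes "integrable N g" and "\<And>x. norm (f x) \<le> g x"
  shows "norm (integral\<^sup>L N f) \<le> integral\<^sup>L N g"
proof -
  have "norm (integral\<^sup>L N f) \<le> (LINT x|N. norm (f x))"
    by (rule integral_norm_bound)
  also have "\<dots> \<le> integral\<^sup>L N g"
    using assms by (intro integral_mono_AE') (auto intro: order_trans[OF norm_ge_zero])
  finally show ?thesis .
qed

lemma integrable_indicator_Icc [simp]: "integrable lborel (indicator {a..b::real} :: real \<Rightarrow> real)"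
  by (intro integrable_real_indicator) (auto simp: emeasure_lborel_Icc_eq)

definition window :: "real \<Rightarrow> real \<Rightarrow> complex" where
  "window w t = complex_of_real (indicator {- w..w} t / (2 * w))"

text \<open>The density of a sum of \<open>Suc k\<close> independent uniform variables on \<open>[-w, w]\<close>. Its transform is
a power of sinc, so up to a constant it is the transform of the smoothing kernel. It has complex values
because it will be multiplied by a reciprocal characteristic function.\<close>

primrec bspline :: "real \<Rightarrow> nat \<Rightarrow> real \<Rightarrow> complex" where
  "bspline w 0 = window w"
| "bspline w (Suc k) = (\<lambda>u. CLINT t|lborel. window w t * bspline w k (u + t))"

lemma window_measurable [measurable]: "window w \<in> borel_measurable borel"
  unfolding window_def[abs_def] by measurable

lemma integrable_window [simp]: "integrable lborel (window w)"
  unfolding window_def[abs_def] by (intro integrable_of_real integrable_divide_zero) simp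

lemma norm_window: "w > 0 \<Longrightarrow> norm (window w t) = indicator {- w..w} t / (2 * w)"
  unfolding window_def norm_of_real by simp

lemma integral_norm_window: "w > 0 \<Longrightarrow> (LINT t|lborel. norm (window w t)) = 1"
  by (simp add: norm_window)

lemma fourier_window:
  assumes w: "w > 0"
  shows "(CLINT t|lborel. iexp (t * x) * window w t) = complex_of_real (sinc (w * x))"
proof (cases "x = 0")
  case True
  have "(CLINT t|lborel. iexp (t * x) * window w t) = complex_of_real (LINT t|lborel. indicator {- w..w} t / (2 * w))"
    unfolding True by (subst integral_complex_of_real[symmetric]) (simp add: window_def)
  then show ?thesis using True w by simp
next
  case False
  have "(CLINT t|lborel. indicator {- w..w} t *\<^sub>R iexp (t * x)) = iexp (w * x) / (\<i> * x) - iexp (- w * x) / (\<i> * x)"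
  proof (rule integral_FTC_Icc)
    show "((\<lambda>t. iexp (t * x) / (\<i> * complex_of_real x)) has_vector_derivative iexp (t * x)) (at t within {- w..w})" for t
    proof -
      have lin: "((\<lambda>t. t * x) has_vector_derivative x) (at t within {- w..w})"
        by (auto intro!: derivative_eq_intros)
      have "((\<lambda>t. iexp (t * x)) has_vector_derivative x *\<^sub>R (\<i> * iexp (t * x))) (at t within {- w..w})"
        using vector_diff_chain_within[OF lin has_vector_derivative_iexp] by (simp only: o_def)
      then have "((\<lambda>t. iexp (t * x) / (\<i> * complex_of_real x)) has_vector_derivative
          x *\<^sub>R (\<i> * iexp (t * x)) / (\<i> * complex_of_real x)) (at t within {- w..w})"
        by (rule has_vector_derivative_divide)
      then show ?thesis using False by (simp add: scaleR_conv_of_real)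
    qed
  qed (use w in \<open>auto intro!: continuous_intros\<close>)
  then have "(CLINT t|lborel. complex_of_real (1 / (2 * w)) * (indicator {- w..w} t *\<^sub>R iexp (t * x)))
     = complex_of_real (1 / (2 * w)) * (iexp (w * x) / (\<i> * x) - iexp (- w * x) / (\<i> * x))"
    by (simp only: integral_mult_right_zero)
  moreover have "(CLINT t|lborel. iexp (t * x) * window w t) = (CLINT t|lborel. complex_of_real (1 / (2 * w)) * (indicator {- w..w} t *\<^sub>R iexp (t * x)))"
    by (intro Bochner_Integration.integral_cong refl) (simp add: window_def scaleR_conv_of_real)
  moreover have "complex_of_real (1 / (2 * w)) * (iexp (w * x) / (\<i> * x) - iexp (- w * x) / (\<i> * x)) = complex_of_real (sinc (w * x))"
  proof -
    have "iexp (w * x) - iexp (- w * x) = 2 * \<i> * complex_of_real (sin (w * x))"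
      by (simp add: complex_eq_iff Re_exp Im_exp)
    then show ?thesis using w False by (simp add: diff_divide_distrib[symmetric])
  qed
  ultimately show ?thesis by simp
qed

lemma bspline_support:
  assumes w: "w > 0" shows "\<bar>u\<bar> > real (Suc k) * w \<Longrightarrow> bspline w k u = 0"
proof (induction k arbitrary: u)
  case 0
  then show ?case by (auto simp: window_def indicator_def abs_if split: if_splits)
next
  case (Suc k)
  have "window w t * bspline w k (u + t) = 0" for t
  proof (cases "\<bar>t\<bar> \<le> w")
    case True
    then have "\<bar>u + t\<bar> > real (Suc k) * w" using Suc.prems by (simp add: algebra_simps)
    then show ?thesis using Suc.IH by simp
  next
    case False
    then show ?thesis by (auto simp: window_def indicator_def abs_le_iff)
  qed
  then show ?case unfolding bspline.simps by (simp only: Bochner_Integration.integral_zero)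
qed

lemma bspline_measurable [measurable]: "bspline w k \<in> borel_measurable borel"
  by (induction k) simp_all

lemma norm_bspline_le:
  assumes w: "w > 0" shows "norm (bspline w k u) \<le> 1 / (2 * w)"
proof (induction k arbitrary: u)
  case 0
  show ?case using w by (simp add: norm_window indicator_def)
next
  case (Suc k)
  have "norm (bspline w (Suc k) u) \<le> (LINT t|lborel. norm (window w t) * (1 / (2 * w)))"
    unfolding bspline.simps
  proof (intro norm_integral_le integrable_mult_left integrable_norm integrable_window)
    fix t
    show "norm (window w t * bspline w k (u + t)) \<le> norm (window w t) * (1 / (2 * w))"
      unfolding norm_mult by (intro mult_left_mono Suc) simp
  qed
  then show ?case using integral_norm_window[OF w] by simp
qed

lemma integrable_bounded_support:
  fixes f :: "real \<Rightarrow> 'a::{banach, second_countable_topology}"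
  assumes "f \<in> borel_measurable borel" and "\<And>u. norm (f u) \<le> B" and "\<And>u. \<bar>u\<bar> > R \<Longrightarrow> f u = 0"
  shows "integrable lborel f"
proof (rule integrableI_bounded_set[where A = "{- R..R}" and B = B])
  show "AE x in lborel. x \<in> {- R..R} \<longrightarrow> norm (f x) \<le> B" using assms by auto
  show "AE x in lborel. x \<notin> {- R..R} \<longrightarrow> f x = 0" using assms(3) by (force intro!: AE_I2)
qed (use assms in \<open>auto simp: emeasure_lborel_Icc_eq\<close>)

lemma integrable_bspline: "w > 0 \<Longrightarrow> integrable lborel (bspline w k)"
  by (rule integrable_bounded_support[OF bspline_measurable norm_bspline_le bspline_support])

lemma ft_bspline:
  assumes w: "w > 0"
  shows "ft (bspline w k) x = complex_of_real (sinc (w * x) ^ Suc k)"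
proof (induction k)
  case 0
  have "ft (bspline w 0) x = (CLINT t|lborel. iexp (t * (- x)) * window w t)"
    by (simp add: ft_def)
  then show ?case using fourier_window[OF w, of "- x"] by simp
next
  case (Suc k)
  have "ft (bspline w (Suc k)) x = (CLINT t|lborel. iexp (t * x) * window w t) * ft (bspline w k) x"
    unfolding bspline.simps by (intro ft_correlation integrable_window integrable_bspline w)
  then show ?case using Suc fourier_window[OF w, of x] by simp
qed

lemma integral_norm_window_diff_le:
  assumes w: "w > 0" and d: "d \<ge> 0"
  shows "(LINT s|lborel. norm (window w (s - d) - window w s)) \<le> d / w"
proof -
  have "(LINT s|lborel. norm (window w (s - d) - window w s))
     \<le> (LINT s|lborel. indicator {w..w + d} s / (2 * w) + indicator {- w..d - w} s / (2 * w))"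
  proof (rule integral_mono_AE')
    show "AE s in lborel. norm (window w (s - d) - window w s) \<le> indicator {w..w + d} s / (2 * w) + indicator {- w..d - w} s / (2 * w)"
      using w d by (intro AE_I2) (auto simp: window_def indicator_def norm_divide norm_mult divide_right_mono divide_left_mono frac_le)
    show "AE s in lborel. 0 \<le> indicator {w..w + d} s / (2 * w) + indicator {- w..d - w} s / (2 * w)"
      using w by (intro AE_I2) (auto intro!: add_nonneg_nonneg)
  qed (auto intro!: Bochner_Integration.integrable_add integrable_divide_zero)
  also have "\<dots> = d / (2 * w) + d / (2 * w)"
    using d by simp
  finally show ?thesis by simp
qed

text \<open>Each averaging step absorbs one difference: shifting the window instead of the function
replaces \<open>window w\<close> by \<open>window w (\<cdot> - d) - window w\<close>, whose \<open>L\<^sup>1\<close> norm is at most \<open>d / w\<close>. The remaining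
differences fall on the spline with one average less.\<close>

lemma norm_fdiff_bspline_le:
  assumes w: "w > 0" and d: "d \<ge> 0"
  shows "l \<le> k \<Longrightarrow> norm ((fdiff d ^^ l) (bspline w k) u) \<le> 1 / (2 * w) * (1 / w) ^ l * d ^ l"
proof (induction k arbitrary: l u)
  case 0
  then show ?case using norm_bspline_le[OF w, of 0 u] by simp
next
  case (Suc k)
  show ?case
  proof (cases l)
    case 0
    then show ?thesis using norm_bspline_le[OF w, of "Suc k" u] by simp
  next
    case (Suc i)
    let ?k = "\<lambda>s. window w (s - d) - window w s"
    let ?B = "1 / (2 * w) * (1 / w) ^ i * d ^ i"
    have bd: "integrable lborel (\<lambda>s. window w (s - d))"
      using lborel_integrable_real_affine[OF integrable_window, of 1 w "- d"] by simp
    have prod: "integrable lborel (\<lambda>s. g s * bspline w k (v + s))"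
      if "integrable lborel g" for g v
    proof (rule Bochner_Integration.integrable_bound)
      show "integrable lborel (\<lambda>s. norm (g s) * (1 / (2 * w)))" using that by simp
      show "AE s in lborel. norm (g s * bspline w k (v + s)) \<le> norm (norm (g s) * (1 / (2 * w)))"
      proof (rule AE_I2)
        fix s
        have "norm (g s * bspline w k (v + s)) \<le> norm (g s) * (1 / (2 * w))"
          unfolding norm_mult by (intro mult_left_mono norm_bspline_le w) simp
        then show "norm (g s * bspline w k (v + s)) \<le> norm (norm (g s) * (1 / (2 * w)))" using w by simp
      qed
      have [measurable]: "g \<in> borel_measurable lborel" using that by simp
      show "(\<lambda>s. g s * bspline w k (v + s)) \<in> borel_measurable lborel"
        by measurable
    qed
    have "fdiff d (bspline w (Suc k)) = (\<lambda>u. CLINT s|lborel. ?k s * bspline w k (u + s))"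
    proof
      fix v
      have "(CLINT t|lborel. window w t * bspline w k (v + d + t))
         = (CLINT s|lborel. window w (s - d) * bspline w k (v + s))"
        by (subst lborel_integral_real_affine[where c = 1 and t = "- d"]) (simp_all add: algebra_simps)
      then have "fdiff d (bspline w (Suc k)) v = (CLINT s|lborel. window w (s - d) * bspline w k (v + s)) - (CLINT s|lborel. window w s * bspline w k (v + s))"
        by (simp add: fdiff_def)
      also have "\<dots> = (CLINT s|lborel. window w (s - d) * bspline w k (v + s) - window w s * bspline w k (v + s))"
        by (intro Bochner_Integration.integral_diff[symmetric] prod bd integrable_window)
      finally show "fdiff d (bspline w (Suc k)) v = (CLINT s|lborel. ?k s * bspline w k (v + s))"
        by (simp add: algebra_simps)
    qed
    then have eq: "(fdiff d ^^ l) (bspline w (Suc k)) u = (CLINT s|lborel. ?k s * (fdiff d ^^ i) (bspline w k) (u + s))"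
      unfolding Suc fdiff_funpow_Suc
      using fdiff_funpow_integral[OF _ bspline_measurable norm_bspline_le[OF w], where k = ?k and d = d and l = i and u = u] bd by simp
    have "norm ((fdiff d ^^ l) (bspline w (Suc k)) u) \<le> (LINT s|lborel. norm (?k s) * ?B)"
      unfolding eq
    proof (rule norm_integral_le)
      have "integrable lborel ?k"
        by (rule Bochner_Integration.integrable_diff[OF bd integrable_window])
      then show "integrable lborel (\<lambda>s. norm (?k s) * ?B)"
        by (intro integrable_mult_left integrable_norm)
    next
      fix s
      have "norm ((fdiff d ^^ i) (bspline w k) (u + s)) \<le> ?B"
        using Suc.prems \<open>l = Suc i\<close> by (intro Suc.IH) linarith
      then show "norm (?k s * (fdiff d ^^ i) (bspline w k) (u + s)) \<le> norm (?k s) * ?B"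
        unfolding norm_mult by (rule mult_left_mono) simp
    qed
    also have "\<dots> = (LINT s|lborel. norm (?k s)) * ?B"
      by (rule integral_mult_left_zero)
    also have "\<dots> \<le> d / w * ?B"
      using w d by (intro mult_right_mono integral_norm_window_diff_le) auto
    finally show ?thesis unfolding Suc by (simp add: mult_ac)
  qed
qed

lemma isCont_bspline:
  assumes w: "w > 0" and k: "k \<ge> 1" shows "isCont (bspline w k) u"
proof -
  let ?L = "1 / (2 * w) * (1 / w)"
  have L: "norm (bspline w k (v + d) - bspline w k v) \<le> ?L * d" if "d \<ge> 0" for v d
    using norm_fdiff_bspline_le[OF w that, of 1 k v] k by (simp add: fdiff_def)
  have "dist (bspline w k y) (bspline w k x) \<le> ?L * dist y x" for x y
  proof (cases "x \<le> y")
    case True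
    then show ?thesis using L[of "y - x" x] by (simp add: dist_norm)
  next
    case False
    then show ?thesis using L[of "x - y" y] by (simp add: dist_norm norm_minus_commute)
  qed
  then have "?L-lipschitz_on UNIV (bspline w k)"
    using w by (intro lipschitz_onI) auto
  then show ?thesis
    using lipschitz_on_continuous_on continuous_on_eq_continuous_at open_UNIV by blast
qed

section \<open>The smoothing kernel\<close>

text \<open>The weight against which the \<open>L\<^sup>1\<close> error is later balanced; for \<open>b = 2\<close> it also dominates the
moments of the smoothing kernel.\<close>

lemma nn_integral_weight_finite:
  assumes b: "b > 1"
  shows "(\<integral>\<^sup>+ x. ennreal ((1 + \<bar>x::real\<bar>) powr (- b)) \<partial>lborel) < \<infinity>"
proof -
  let ?f = "\<lambda>x::real. (1 + \<bar>x\<bar>) powr (- b)"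
  let ?I = "\<integral>\<^sup>+ x. ennreal (?f x) * indicator {0..} x \<partial>lborel"
  have "(\<integral>\<^sup>+ x. ennreal ((1 + x) powr (- b)) * indicator {0..} x \<partial>lborel)
     = ennreal (0 - (1 + 0) powr (1 - b) / (1 - b))"
  proof (rule nn_integral_FTC_atLeast)
    fix x :: real assume "0 \<le> x"
    then have "DERIV (\<lambda>x. (1 + x) powr (1 - b)) x :> (1 - b) * (1 + x) powr (1 - b - 1) * (0 + 1)"
      by (intro DERIV_chain2[OF has_real_derivative_powr] derivative_intros) auto
    from DERIV_cdivide[OF this, of "1 - b"]
    show "DERIV (\<lambda>x. (1 + x) powr (1 - b) / (1 - b)) x :> (1 + x) powr (- b)"
      using b by simp
  next
    have "((\<lambda>x::real. (1 + x) powr (1 - b)) \<longlongrightarrow> 0) at_top"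
      using b by (intro tendsto_neg_powr) (auto intro: filterlim_tendsto_add_at_top filterlim_ident)
    then show "((\<lambda>x::real. (1 + x) powr (1 - b) / (1 - b)) \<longlongrightarrow> 0) at_top"
      using tendsto_divide_zero by blast
  qed auto
  then have fin: "?I < \<infinity>"
    by (subst nn_integral_cong[of lborel _ "\<lambda>x. ennreal ((1 + x) powr (- b)) * indicator {0..} x"])
       (auto simp: indicator_def)
  have refl: "(\<integral>\<^sup>+ x. ennreal (?f x) * indicator {..0} x \<partial>lborel) = ?I"
    by (subst nn_integral_real_affine[where c = "-1" and t = 0])
       (auto intro!: nn_integral_cong simp: indicator_def)
  have "(\<integral>\<^sup>+ x. ennreal (?f x) \<partial>lborel)
      \<le> (\<integral>\<^sup>+ x. ennreal (?f x) * indicator {0..} x + ennreal (?f x) * indicator {..0} x \<partial>lborel)"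
    by (intro nn_integral_mono) (auto simp: indicator_def)
  also have "\<dots> = ?I + ?I"
    by (subst nn_integral_add) (auto simp: refl)
  finally show ?thesis using fin by (auto simp: less_top[symmetric] ennreal_add_eq_top top_unique)
qed

lemma integrable_weight:
  assumes "b > 1"
  shows "integrable lborel (\<lambda>x::real. (1 + \<bar>x\<bar>) powr (- b))"
  using nn_integral_weight_finite[OF assms] by (intro integrableI_nonneg) auto

lemma kernel_order_even: "even (kernel_order p)"
proof -
  have "even (nat (2 * k + 2))" for k :: int
    by (cases "0 \<le> 2 * k + 2") (auto simp: even_nat_iff)
  then show ?thesis by (simp only: kernel_order_def)
qed

text \<open>The order exceeds \<open>p\<close> by 2, which gives the smoothing kernel a finite \<open>p\<close>-th moment and the
spline enough averages for \<open>\<lceil>p\<rceil> + 1\<close> differences.\<close>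

lemma kernel_order_ge:
  assumes "p \<ge> 1"
  shows "kernel_order p \<ge> 4" "kernel_order p \<ge> nat \<lceil>p\<rceil> + 2" "p + 2 \<le> real (kernel_order p)"
proof -
  have "\<lceil>p / 2\<rceil> \<ge> 1" using assms by simp
  then have "4 \<le> 2 * \<lceil>p / 2\<rceil> + 2" by linarith
  from nat_mono[OF this] show "kernel_order p \<ge> 4" by (simp only: kernel_order_def nat_numeral)
  have "p \<le> of_int (2 * \<lceil>p / 2\<rceil>)"
    using le_of_int_ceiling[of "p / 2"] unfolding of_int_mult of_int_numeral by linarith
  then have c: "\<lceil>p\<rceil> \<le> 2 * \<lceil>p / 2\<rceil>" by (simp only: ceiling_le_iff)
  then show 2: "kernel_order p \<ge> nat \<lceil>p\<rceil> + 2"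
    using assms unfolding kernel_order_def by linarith
  have "p \<le> real (nat \<lceil>p\<rceil>)" by (rule real_nat_ceiling_ge)
  then show "p + 2 \<le> real (kernel_order p)" using 2 by linarith
qed

text \<open>The kernel of the estimator before normalisation.\<close>

definition sinc_pow :: "real \<Rightarrow> real \<Rightarrow> real" where
  "sinc_pow p y = sinc (y / real (kernel_order p)) ^ kernel_order p"

lemma sinc_pow_measurable [measurable]: "sinc_pow p \<in> borel_measurable borel"
  unfolding sinc_pow_def[abs_def] by measurable

lemma kernel_eq: "kernel p x = 1 / (LINT y|lborel. sinc_pow p y) * sinc_pow p x"
  by (simp add: kernel_def sinc_pow_def[abs_def] Let_def)

lemma sinc_pow_nonneg: "sinc_pow p x \<ge> 0"
  unfolding sinc_pow_def using kernel_order_even by (rule zero_le_even_power)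

lemma abs_sinc_le: "\<bar>sinc z\<bar> * (1 + \<bar>z\<bar>) \<le> 2"
proof (cases "z = 0")
  case False
  have "\<bar>sin z\<bar> \<le> \<bar>z\<bar>" "\<bar>sin z\<bar> \<le> 1" using abs_sin_x_le_abs_x abs_sin_le_one by auto
  then have "\<bar>sin z\<bar> * (1 + \<bar>z\<bar>) \<le> \<bar>z\<bar> * 1 + 1 * \<bar>z\<bar>"
    unfolding distrib_left by (intro add_mono mult_mono) auto
  then show ?thesis using False by (simp add: field_simps)
qed simp

lemma sinc_pow_le:
  assumes p: "p \<ge> 1"
  shows "(1 + \<bar>x\<bar>) powr p * sinc_pow p x \<le> (2 * real (kernel_order p)) ^ kernel_order p * (1 + \<bar>x\<bar>) powr (- 2)"
proof -
  let ?m = "kernel_order p" and ?z = "x / real (kernel_order p)"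
  note m = kernel_order_ge[OF p]
  have "(1 + \<bar>x\<bar>) * \<bar>sinc ?z\<bar> \<le> real ?m * (1 + \<bar>?z\<bar>) * \<bar>sinc ?z\<bar>"
    using m(1) by (intro mult_right_mono) (auto simp: field_simps)
  also have "\<dots> = real ?m * (\<bar>sinc ?z\<bar> * (1 + \<bar>?z\<bar>))" by (simp only: mult_ac)
  also have "\<dots> \<le> real ?m * 2" by (intro mult_left_mono abs_sinc_le) auto
  finally have "((1 + \<bar>x\<bar>) * \<bar>sinc ?z\<bar>) ^ ?m \<le> (2 * real ?m) ^ ?m"
    by (intro power_mono) (auto simp: mult_ac)
  moreover have "((1 + \<bar>x\<bar>) * \<bar>sinc ?z\<bar>) ^ ?m = (1 + \<bar>x\<bar>) ^ ?m * sinc_pow p x"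
    unfolding sinc_pow_def power_mult_distrib using kernel_order_even by (simp only: power_even_abs)
  ultimately have A: "(1 + \<bar>x\<bar>) ^ ?m * sinc_pow p x \<le> (2 * real ?m) ^ ?m" by simp
  have "(1 + \<bar>x\<bar>) powr p = (1 + \<bar>x\<bar>) powr (p + 2) * (1 + \<bar>x\<bar>) powr (- 2)"
    by (subst powr_add[symmetric]) simp
  also have "\<dots> \<le> (1 + \<bar>x\<bar>) powr (real ?m) * (1 + \<bar>x\<bar>) powr (- 2)"
    using m(3) by (intro mult_right_mono powr_mono) auto
  also have "(1 + \<bar>x\<bar>) powr (real ?m) = (1 + \<bar>x\<bar>) ^ ?m"
    by (intro powr_realpow) auto
  finally have "(1 + \<bar>x\<bar>) powr p * sinc_pow p x \<le> (1 + \<bar>x\<bar>) ^ ?m * (1 + \<bar>x\<bar>) powr (- 2) * sinc_pow p x"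
    by (intro mult_right_mono sinc_pow_nonneg)
  also have "\<dots> = ((1 + \<bar>x\<bar>) ^ ?m * sinc_pow p x) * (1 + \<bar>x\<bar>) powr (- 2)" by (simp only: mult_ac)
  also have "\<dots> \<le> (2 * real ?m) ^ ?m * (1 + \<bar>x\<bar>) powr (- 2)"
    using A by (intro mult_right_mono) auto
  finally show ?thesis .
qed

lemma integrable_moment_sinc_pow:
  assumes p: "p \<ge> 1"
  shows "integrable lborel (\<lambda>x. (1 + \<bar>x\<bar>) powr p * sinc_pow p x)"
proof (rule Bochner_Integration.integrable_bound)
  show "integrable lborel (\<lambda>x::real. (2 * real (kernel_order p)) ^ kernel_order p * (1 + \<bar>x\<bar>) powr (- 2))"
    by (intro integrable_mult_right integrable_weight) simp
  show "AE x in lborel. norm ((1 + \<bar>x\<bar>) powr p * sinc_pow p x)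
     \<le> norm ((2 * real (kernel_order p)) ^ kernel_order p * (1 + \<bar>x\<bar>) powr (- 2))"
    using sinc_pow_le[OF p] sinc_pow_nonneg[of p] by (intro AE_I2) (simp add: abs_mult power_abs)
qed measurable

lemma integrable_sinc_pow:
  assumes p: "p \<ge> 1" shows "integrable lborel (sinc_pow p)"
proof (rule Bochner_Integration.integrable_bound[OF integrable_moment_sinc_pow[OF p]])
  have "1 \<le> (1 + \<bar>x\<bar>) powr p" for x using p by (intro ge_one_powr_ge_zero) auto
  then have "1 * sinc_pow p x \<le> (1 + \<bar>x\<bar>) powr p * sinc_pow p x" for x
    by (intro mult_right_mono sinc_pow_nonneg)
  then show "AE x in lborel. norm (sinc_pow p x) \<le> norm ((1 + \<bar>x\<bar>) powr p * sinc_pow p x)"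
    using sinc_pow_nonneg[of p] by (intro AE_I2) (simp add: abs_mult)
qed measurable

lemma continuous_sinc_pow:
  assumes p: "p \<ge> 1" shows "continuous_on UNIV (sinc_pow p)"
proof -
  have "continuous_on UNIV (\<lambda>x. sinc (x / real (kernel_order p)))"
    using kernel_order_ge(1)[OF p] by (intro continuous_on_sinc continuous_intros) auto
  then show ?thesis unfolding sinc_pow_def[abs_def] by (rule continuous_on_power)
qed

lemma integral_sinc_pow_pos:
  assumes p: "p \<ge> 1" shows "(LINT y|lborel. sinc_pow p y) > 0"
proof -
  have "isCont (sinc_pow p) 0"
    using continuous_sinc_pow[OF p] continuous_on_eq_continuous_at open_UNIV by blast
  then have "\<forall>\<^sub>F x in at 0. sinc_pow p x > 1 / 2"
    unfolding isCont_def by (rule order_tendstoD) (simp add: sinc_pow_def)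
  then obtain d where d: "d > 0" "\<And>x. x \<noteq> 0 \<Longrightarrow> dist x 0 < d \<Longrightarrow> sinc_pow p x > 1 / 2"
    unfolding eventually_at by blast
  have "0 < d / 2 * (1 / 2)" using d by simp
  also have "\<dots> = (LINT y|lborel. indicator {0..d / 2} y * (1 / 2))"
    using d by simp
  also have "\<dots> \<le> (LINT y|lborel. sinc_pow p y)"
  proof (rule integral_mono[OF _ integrable_sinc_pow[OF p]])
    show "integrable lborel (\<lambda>y::real. indicator {0..d / 2} y * (1 / 2) :: real)"
      by (intro integrable_mult_left) simp
    show "indicator {0..d / 2} y * (1 / 2) \<le> sinc_pow p y" for y
      using d sinc_pow_nonneg[of p y] by (cases "y = 0") (auto simp: indicator_def sinc_pow_def dist_real_def intro: less_imp_le)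
  qed
  finally show ?thesis .
qed

lemma kernel_measurable [measurable]: "kernel p \<in> borel_measurable borel"
  unfolding kernel_eq[abs_def] by measurable

lemma kernel_nonneg: "p \<ge> 1 \<Longrightarrow> kernel p x \<ge> 0"
  unfolding kernel_eq using integral_sinc_pow_pos[of p] sinc_pow_nonneg[of p x] by simp

lemma integral_kernel: "p \<ge> 1 \<Longrightarrow> (LINT x|lborel. kernel p x) = 1"
  unfolding kernel_eq using integral_sinc_pow_pos[of p] by simp

lemma integrable_moment_kernel: "p \<ge> 1 \<Longrightarrow> integrable lborel (\<lambda>x. (1 + \<bar>x\<bar>) powr p * kernel p x)"
proof -
  assume p: "p \<ge> 1"
  have "(\<lambda>x. (1 + \<bar>x\<bar>) powr p * kernel p x)
     = (\<lambda>x. 1 / (LINT y|lborel. sinc_pow p y) * ((1 + \<bar>x\<bar>) powr p * sinc_pow p x))"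
    by (simp add: kernel_eq mult_ac)
  then show ?thesis using p by (simp only: integrable_mult_right integrable_moment_sinc_pow)
qed

lemma integrable_kernel: "p \<ge> 1 \<Longrightarrow> integrable lborel (kernel p)"
  unfolding kernel_eq[abs_def] by (intro integrable_mult_right integrable_sinc_pow)

abbreviation kernel_spline :: "real \<Rightarrow> real \<Rightarrow> complex" where
  "kernel_spline p \<equiv> bspline (1 / real (kernel_order p)) (kernel_order p - 1)"

lemma ft_kernel_spline:
  assumes p: "p \<ge> 1"
  shows "ft (kernel_spline p) x = complex_of_real (sinc_pow p x)"
  using kernel_order_ge(1)[OF p] by (subst ft_bspline) (simp_all add: sinc_pow_def)

text \<open>The spline has transform \<^const>\<open>sinc_pow\<close>; inversion, applicable because that transform is
integrable, goes back.\<close>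

lemma fourier_kernel:
  assumes p: "p \<ge> 1"
  shows "fourier (\<lambda>t. complex_of_real (kernel p t)) u
    = complex_of_real (2 * pi / (LINT y|lborel. sinc_pow p y)) * kernel_spline p u"
proof -
  let ?S = "LINT y|lborel. sinc_pow p y"
  note m = kernel_order_ge(1)[OF p]
  have "(CLINT x|lborel. iexp (x * u) * ft (kernel_spline p) x) = complex_of_real (2 * pi) * kernel_spline p u"
  proof (rule ft_inversion)
    show "integrable lborel (ft (kernel_spline p))"
      unfolding ft_kernel_spline[OF p, abs_def] by (intro integrable_of_real integrable_sinc_pow p)
  qed (use m in \<open>auto intro!: integrable_bspline norm_bspline_le isCont_bspline\<close>)
  then have "(CLINT t|lborel. complex_of_real (1 / ?S) * (iexp (t * u) * complex_of_real (sinc_pow p t)))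
     = complex_of_real (1 / ?S) * (complex_of_real (2 * pi) * kernel_spline p u)"
    unfolding ft_kernel_spline[OF p] integral_mult_right_zero by simp
  moreover have "fourier (\<lambda>t. complex_of_real (kernel p t)) u
     = (CLINT t|lborel. complex_of_real (1 / ?S) * (iexp (t * u) * complex_of_real (sinc_pow p t)))"
    unfolding fourier_def kernel_eq of_real_mult by (simp only: mult_ac)
  ultimately show ?thesis by simp
qed

lemma Re_of_real_mult: "Re (complex_of_real r * z) = r * Re z"
  by simp

lemma deconv_kernel_eq:
  assumes p: "p \<ge> 1"
  shows "deconv_kernel p \<nu> h x = 1 / (LINT y|lborel. sinc_pow p y) *
     Re (ft (\<lambda>u. kernel_spline p u * recip_char \<nu> (u / h)) x)"
proof -
  let ?S = "LINT y|lborel. sinc_pow p y"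
  have S: "?S \<noteq> 0" using integral_sinc_pow_pos[OF p] by simp
  have "(CLINT u|lborel. iexp (- (u * x)) * (fourier (\<lambda>t. complex_of_real (kernel p t)) u / char \<nu> (u / h)))
    = (CLINT u|lborel. complex_of_real (2 * pi / ?S) * (iexp (- (u * x)) * (kernel_spline p u * recip_char \<nu> (u / h))))"
    by (simp add: fourier_kernel[OF p] recip_char_def mult_ac)
  also have "\<dots> = complex_of_real (2 * pi / ?S) * ft (\<lambda>u. kernel_spline p u * recip_char \<nu> (u / h)) x"
    unfolding ft_def by (rule integral_mult_right_zero)
  finally have "deconv_kernel p \<nu> h x = Re (complex_of_real (1 / (2 * pi)) * (complex_of_real (2 * pi / ?S) *
      ft (\<lambda>u. kernel_spline p u * recip_char \<nu> (u / h)) x))"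
    unfolding deconv_kernel_def by (simp only:)
  also have "complex_of_real (1 / (2 * pi)) * (complex_of_real (2 * pi / ?S) *
      ft (\<lambda>u. kernel_spline p u * recip_char \<nu> (u / h)) x)
    = complex_of_real (1 / ?S) * ft (\<lambda>u. kernel_spline p u * recip_char \<nu> (u / h)) x"
    unfolding mult.assoc[symmetric] of_real_mult[symmetric] using S by simp
  also have "Re \<dots> = 1 / ?S * Re (ft (\<lambda>u. kernel_spline p u * recip_char \<nu> (u / h)) x)"
    by (rule Re_of_real_mult)
  finally show ?thesis .
qed

section \<open>Regularity of the reciprocal characteristic function\<close>

text \<open>Existentially quantified derivatives make closure under sums, products and reciprocals plain
inductions.\<close>

fun times_differentiable :: "nat \<Rightarrow> (real \<Rightarrow> complex) \<Rightarrow> bool" where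
  "times_differentiable 0 f = True"
| "times_differentiable (Suc k) f =
    (\<exists>f'. (\<forall>t. (f has_vector_derivative f' t) (at t)) \<and> times_differentiable k f')"

lemma times_differentiable_Suc_imp: "times_differentiable (Suc k) f \<Longrightarrow> times_differentiable k f"
proof (induction k arbitrary: f)
  case (Suc k)
  then obtain f' where "\<forall>t. (f has_vector_derivative f' t) (at t)" "times_differentiable (Suc k) f'"
    by (metis times_differentiable.simps(2))
  then show ?case using Suc.IH by auto
qed simp

lemma times_differentiable_uminus: "times_differentiable k f \<Longrightarrow> times_differentiable k (\<lambda>t. - f t)"
proof (induction k arbitrary: f)
  case (Suc k)
  then obtain f' where f': "\<forall>t. (f has_vector_derivative f' t) (at t)" "times_differentiable k f'"
    by auto
  then show ?case
    using Suc.IH[OF f'(2)] has_vector_derivative_minus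
    by (auto intro!: exI[of _ "\<lambda>t. - f' t"])
qed simp

lemma times_differentiable_add:
  "times_differentiable k f \<Longrightarrow> times_differentiable k g \<Longrightarrow> times_differentiable k (\<lambda>t. f t + g t)"
proof (induction k arbitrary: f g)
  case (Suc k)
  then obtain f' g' where f': "\<forall>t. (f has_vector_derivative f' t) (at t)" "times_differentiable k f'"
    and g': "\<forall>t. (g has_vector_derivative g' t) (at t)" "times_differentiable k g'"
    by auto
  then show ?case
    using Suc.IH[OF f'(2) g'(2)]
    by (auto intro!: exI[of _ "\<lambda>t. f' t + g' t"] has_vector_derivative_add)
qed simp

lemma times_differentiable_mult:
  "times_differentiable k f \<Longrightarrow> times_differentiable k g \<Longrightarrow> times_differentiable k (\<lambda>t. f t * g t)"
proof (induction k arbitrary: f g)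
  case (Suc k)
  then obtain f' g' where f': "\<forall>t. (f has_vector_derivative f' t) (at t)" "times_differentiable k f'"
    and g': "\<forall>t. (g has_vector_derivative g' t) (at t)" "times_differentiable k g'"
    by auto
  have "times_differentiable k (\<lambda>t. f t * g' t + f' t * g t)"
    using Suc.prems f'(2) g'(2)
    by (intro times_differentiable_add Suc.IH times_differentiable_Suc_imp[OF Suc.prems(1)]
        times_differentiable_Suc_imp[OF Suc.prems(2)])
  then show ?case
    using f'(1) g'(1)
    by (auto intro!: exI[of _ "\<lambda>t. f t * g' t + f' t * g t"] has_vector_derivative_mult)
qed simp

lemma times_differentiable_inverse:
  assumes nz: "\<And>t. f t \<noteq> 0"
  shows "times_differentiable k f \<Longrightarrow> times_differentiable k (\<lambda>t. inverse (f t))"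
proof (induction k)
  case (Suc k)
  then obtain f' where f': "\<forall>t. (f has_vector_derivative f' t) (at t)" "times_differentiable k f'"
    by auto
  have i: "times_differentiable k (\<lambda>t. inverse (f t))"
    by (rule Suc.IH[OF times_differentiable_Suc_imp[OF Suc.prems]])
  let ?d = "\<lambda>t. f' t * - (inverse (f t) * inverse (f t))"
  have "((\<lambda>t. inverse (f t)) has_vector_derivative ?d t) (at t)" for t
  proof -
    have "(inverse has_field_derivative - (inverse (f t) * inverse (f t))) (at (f t))"
      using DERIV_inverse[OF nz[of t]] by (simp add: power2_eq_square)
    then show ?thesis
      using field_vector_diff_chain_at[OF f'(1)[rule_format]] by (simp only: o_def)
  qed
  moreover have "times_differentiable k ?d"
    by (intro times_differentiable_mult times_differentiable_uminus i f')
  ultimately show ?case by (auto intro!: exI[of _ ?d])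
qed simp

lemma has_vector_derivative_fdiff_funpow:
  fixes f f' :: "real \<Rightarrow> complex"
  assumes "\<And>t. (f has_vector_derivative f' t) (at t)"
  shows "((fdiff d ^^ l) f has_vector_derivative (fdiff d ^^ l) f' t) (at t)"
proof (induction l arbitrary: t)
  case (Suc l)
  let ?g = "(fdiff d ^^ l) f" and ?g' = "(fdiff d ^^ l) f'"
  have lin: "((\<lambda>t. t + d) has_vector_derivative 1) (at t)"
    by (auto intro!: derivative_eq_intros)
  have "((\<lambda>t. ?g (t + d)) has_vector_derivative ?g' (t + d)) (at t)"
    using vector_diff_chain_at[OF lin, of ?g "?g' (t + d)"] Suc[of "t + d"] by (simp add: o_def)
  then have "((\<lambda>t. ?g (t + d) - ?g t) has_vector_derivative ?g' (t + d) - ?g' t) (at t)"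
    using Suc[of t] by (rule has_vector_derivative_diff)
  then show ?case
    unfolding funpow.simps o_def fdiff_def[of d ?g, abs_def] fdiff_def[of d ?g', abs_def] .
qed (simp add: assms)

lemma norm_diff_le_of_vector_derivative:
  fixes f f' :: "real \<Rightarrow> complex"
  assumes "\<And>t. (f has_vector_derivative f' t) (at t)" and "\<And>t. t \<in> {a..b} \<Longrightarrow> norm (f' t) \<le> B" and ab: "a \<le> b"
  shows "norm (f b - f a) \<le> B * (b - a)"
proof -
  have "norm (f b - f a) \<le> B * norm (b - a)"
  proof (rule differentiable_bound[where S = "{a..b}" and f' = "\<lambda>t x. x *\<^sub>R f' t"])
    show "(f has_derivative (\<lambda>x. x *\<^sub>R f' t)) (at t within {a..b})" for t
      using assms(1)[of t] unfolding has_vector_derivative_def by (rule has_derivative_at_withinI)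
    show "onorm (\<lambda>x. x *\<^sub>R f' t) \<le> B" if "t \<in> {a..b}" for t
      using assms(2)[OF that] by (intro onorm_le) (simp add: mult.commute[of B] mult_left_mono)
  qed (use ab in auto)
  then show ?thesis using ab by simp
qed

lemma higher_derivative_Suc:
  assumes "\<And>t. (f has_vector_derivative f' t) (at t)"
  shows "higher_derivative (Suc l) f = higher_derivative l f'"
proof -
  have "(\<lambda>t. vector_derivative f (at t)) = f'"
    using assms by (intro ext vector_derivative_at)
  then show ?thesis
    unfolding higher_derivative_def funpow_Suc_right by simp
qed

text \<open>The mean value inequality applied \<open>l\<close> times; a difference commutes with differentiation, so
the outermost difference can be estimated first.\<close>

lemma norm_fdiff_funpow_le_higher_derivative:
  assumes "times_differentiable l f" and d: "d \<ge> 0"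
    and "\<And>t. u \<le> t \<Longrightarrow> t \<le> u + real l * d \<Longrightarrow> norm (higher_derivative l f t) \<le> B"
  shows "norm ((fdiff d ^^ l) f u) \<le> B * d ^ l"
  using assms
proof (induction l arbitrary: f u)
  case 0
  then show ?case by (simp add: higher_derivative_def)
next
  case (Suc l)
  then obtain f' where f': "\<And>t. (f has_vector_derivative f' t) (at t)" "times_differentiable l f'"
    by auto
  have "norm ((fdiff d ^^ l) f (u + d) - (fdiff d ^^ l) f u) \<le> B * d ^ l * (u + d - u)"
  proof (rule norm_diff_le_of_vector_derivative)
    show "((fdiff d ^^ l) f has_vector_derivative (fdiff d ^^ l) f' t) (at t)" for t
      by (rule has_vector_derivative_fdiff_funpow[OF f'(1)])
    show "norm ((fdiff d ^^ l) f' t) \<le> B * d ^ l" if t: "t \<in> {u..u + d}" for t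
    proof (rule Suc.IH[OF f'(2) d])
      fix s assume s: "t \<le> s" "s \<le> t + real l * d"
      then have "u \<le> s" "s \<le> u + real (Suc l) * d" using t by (auto simp: algebra_simps)
      then show "norm (higher_derivative l f' s) \<le> B"
        using Suc.prems(3) higher_derivative_Suc[of f f' l] f'(1) by metis
    qed
  qed (use d in auto)
  then show ?case by (simp add: fdiff_def[of d "(fdiff d ^^ l) f"] mult_ac)
qed

text \<open>The form of the derivative to which the dominated convergence theorem for sequences applies.\<close>

lemma has_vector_derivative_iff_quotient:
  fixes f :: "real \<Rightarrow> complex"
  shows "(f has_vector_derivative D) (at t) \<longleftrightarrow> ((\<lambda>h. (f (t + h) - f t) /\<^sub>R h) \<longlongrightarrow> D) (at 0)"
proof -
  have "(f has_vector_derivative D) (at t) \<longleftrightarrow>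
      ((\<lambda>h. norm (f (t + h) - f t - h *\<^sub>R D) / norm h) \<longlongrightarrow> 0) (at 0)"
    unfolding has_vector_derivative_def has_derivative_at by (simp add: bounded_linear_scaleR_left)
  also have "\<dots> \<longleftrightarrow> ((\<lambda>h. norm ((f (t + h) - f t) /\<^sub>R h - D)) \<longlongrightarrow> 0) (at 0)"
  proof (rule filterlim_cong[OF refl refl])
    have "norm (f (t + h) - f t - h *\<^sub>R D) / norm h = norm ((f (t + h) - f t) /\<^sub>R h - D)" if "h \<noteq> 0" for h
    proof -
      have "(f (t + h) - f t) /\<^sub>R h - D = (f (t + h) - f t - h *\<^sub>R D) /\<^sub>R h"
        using that by (simp add: scaleR_diff_right)
      then show ?thesis by (simp add: divide_inverse mult.commute)
    qed
    then show "\<forall>\<^sub>F h in at 0. norm (f (t + h) - f t - h *\<^sub>R D) / norm h = norm ((f (t + h) - f t) /\<^sub>R h - D)"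
      by (auto simp: eventually_at_filter)
  qed
  also have "\<dots> \<longleftrightarrow> ((\<lambda>h. (f (t + h) - f t) /\<^sub>R h - D) \<longlongrightarrow> 0) (at 0)"
    by (rule tendsto_norm_zero_iff)
  also have "\<dots> \<longleftrightarrow> ((\<lambda>h. (f (t + h) - f t) /\<^sub>R h) \<longlongrightarrow> D) (at 0)"
    by (rule LIM_zero_iff)
  finally show ?thesis .
qed

text \<open>Differentiation under the integral sign: the difference quotients of the exponential are
bounded by \<open>|x|\<close>, so \<open>|x f x|\<close> dominates.\<close>

lemma (in real_distribution) has_vector_derivative_fourier:
  fixes f :: "real \<Rightarrow> complex"
  assumes f: "integrable M f" and xf: "integrable M (\<lambda>x. complex_of_real x * f x)"
  shows "((\<lambda>t. CLINT x|M. iexp (t * x) * f x) has_vector_derivative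
     (CLINT x|M. iexp (t * x) * (\<i> * (complex_of_real x * f x)))) (at t)"
proof -
  have [measurable]: "f \<in> borel_measurable borel" using f by simp
  let ?F = "\<lambda>t. CLINT x|M. iexp (t * x) * f x"
  let ?D = "CLINT x|M. iexp (t * x) * (\<i> * (complex_of_real x * f x))"
  have intF: "integrable M (\<lambda>x. iexp (t * x) * f x)" for t
    using f by (intro integrable_iexp_times) simp_all
  have "((\<lambda>h. (?F (t + h) - ?F t) /\<^sub>R h) \<longlongrightarrow> ?D) (at 0)"
  proof (subst tendsto_at_iff_sequentially, intro allI impI)
    fix X :: "nat \<Rightarrow> real" assume X: "\<forall>i. X i \<in> UNIV - {0}" "X \<longlonglongrightarrow> 0"
    have eq: "((\<lambda>h. (?F (t + h) - ?F t) /\<^sub>R h) \<circ> X)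
       = (\<lambda>n. CLINT x|M. ((iexp ((t + X n) * x) - iexp (t * x)) /\<^sub>R X n) * f x)"
    proof
      fix n
      have "?F (t + X n) - ?F t = (CLINT x|M. iexp ((t + X n) * x) * f x - iexp (t * x) * f x)"
        by (rule Bochner_Integration.integral_diff[symmetric, OF intF intF])
      then have "(?F (t + X n) - ?F t) /\<^sub>R X n = (CLINT x|M. (iexp ((t + X n) * x) * f x - iexp (t * x) * f x) /\<^sub>R X n)"
        by (simp only: integral_scaleR_right)
      then show "((\<lambda>h. (?F (t + h) - ?F t) /\<^sub>R h) \<circ> X) n = (CLINT x|M. ((iexp ((t + X n) * x) - iexp (t * x)) /\<^sub>R X n) * f x)"
        by (simp only: o_def left_diff_distrib scaleR_left_diff_distrib mult_scaleR_left scaleR_right_diff_distrib)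
    qed
    show "((\<lambda>h. (?F (t + h) - ?F t) /\<^sub>R h) \<circ> X) \<longlonglongrightarrow> ?D"
      unfolding eq
    proof (rule integral_dominated_convergence[where w = "\<lambda>x. norm (complex_of_real x * f x)"])
      show "integrable M (\<lambda>x. norm (complex_of_real x * f x))" using xf by (rule integrable_norm)
      show "AE x in M. (\<lambda>n. ((iexp ((t + X n) * x) - iexp (t * x)) /\<^sub>R X n) * f x)
          \<longlonglongrightarrow> iexp (t * x) * (\<i> * (complex_of_real x * f x))"
      proof (rule AE_I2)
        fix x
        have lin: "((\<lambda>t. t * x) has_vector_derivative x) (at t)"
          by (auto intro!: derivative_eq_intros)
        have "((\<lambda>t. iexp (t * x)) has_vector_derivative x *\<^sub>R (\<i> * iexp (t * x))) (at t)"
          using vector_diff_chain_at[OF lin has_vector_derivative_iexp] by (simp only: o_def)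
        then have "((\<lambda>h. (iexp ((t + h) * x) - iexp (t * x)) /\<^sub>R h) \<longlongrightarrow> x *\<^sub>R (\<i> * iexp (t * x))) (at 0)"
          by (simp only: has_vector_derivative_iff_quotient)
        then have "((\<lambda>h. (iexp ((t + h) * x) - iexp (t * x)) /\<^sub>R h) \<circ> X) \<longlonglongrightarrow> x *\<^sub>R (\<i> * iexp (t * x))"
          using X by (subst (asm) tendsto_at_iff_sequentially) blast
        then have "(\<lambda>n. ((iexp ((t + X n) * x) - iexp (t * x)) /\<^sub>R X n) * f x) \<longlonglongrightarrow> (x *\<^sub>R (\<i> * iexp (t * x))) * f x"
          unfolding o_def by (intro tendsto_mult tendsto_const)
        then show "(\<lambda>n. ((iexp ((t + X n) * x) - iexp (t * x)) /\<^sub>R X n) * f x)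
          \<longlonglongrightarrow> iexp (t * x) * (\<i> * (complex_of_real x * f x))"
          by (simp add: scaleR_conv_of_real mult_ac)
      qed
      show "AE x in M. norm (((iexp ((t + X n) * x) - iexp (t * x)) /\<^sub>R X n) * f x) \<le> norm (complex_of_real x * f x)" for n
      proof (rule AE_I2)
        fix x
        have "iexp ((t + X n) * x) - iexp (t * x) = iexp (t * x) * (iexp (X n * x) - 1)"
          by (simp add: distrib_left distrib_right exp_add algebra_simps)
        then have "norm (iexp ((t + X n) * x) - iexp (t * x)) = norm (iexp (X n * x) - 1)"
          by (simp only: norm_mult norm_iexp mult_1)
        also have "\<dots> \<le> \<bar>X n * x\<bar>" using iexp_approx1[of "X n * x" 0] by simp
        finally have le: "norm (iexp ((t + X n) * x) - iexp (t * x)) \<le> \<bar>X n * x\<bar>" .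
        have "norm ((iexp ((t + X n) * x) - iexp (t * x)) /\<^sub>R X n) = norm (iexp ((t + X n) * x) - iexp (t * x)) / \<bar>X n\<bar>"
          by (simp only: norm_scaleR abs_inverse divide_inverse mult.commute)
        also have "\<dots> \<le> \<bar>X n * x\<bar> / \<bar>X n\<bar>"
          using le by (rule divide_right_mono) simp
        also have "\<dots> = \<bar>x\<bar>" using X(1) by (simp add: abs_mult)
        finally show "norm (((iexp ((t + X n) * x) - iexp (t * x)) /\<^sub>R X n) * f x) \<le> norm (complex_of_real x * f x)"
          unfolding norm_mult by (intro mult_right_mono) auto
      qed
    qed measurable
  qed
  then show ?thesis
    by (simp only: has_vector_derivative_iff_quotient)
qed

lemma (in real_distribution) times_differentiable_fourier:
  fixes f :: "real \<Rightarrow> complex"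
  assumes "\<And>j. j \<le> k \<Longrightarrow> integrable M (\<lambda>x. complex_of_real x ^ j * f x)"
  shows "times_differentiable k (\<lambda>t. CLINT x|M. iexp (t * x) * f x)"
  using assms
proof (induction k arbitrary: f)
  case (Suc k)
  have "times_differentiable k (\<lambda>t. CLINT x|M. iexp (t * x) * (\<i> * (complex_of_real x * f x)))"
  proof (rule Suc.IH)
    fix j assume "j \<le> k"
    then have "integrable M (\<lambda>x. \<i> * (complex_of_real x ^ Suc j * f x))"
      using Suc.prems[of "Suc j"] by (intro integrable_mult_right) simp
    then show "integrable M (\<lambda>x. complex_of_real x ^ j * (\<i> * (complex_of_real x * f x)))"
      by (simp add: mult_ac)
  qed
  then show ?case
    using has_vector_derivative_fourier[of f] Suc.prems[of 0] Suc.prems[of 1]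
    unfolding times_differentiable.simps
    by (intro exI[of _ "\<lambda>t. CLINT x|M. iexp (t * x) * (\<i> * (complex_of_real x * f x))"]) simp
qed simp

lemma (in real_distribution) times_differentiable_char:
  assumes s: "integrable M (\<lambda>x. \<bar>x\<bar> powr s)" and k: "real k \<le> s"
  shows "times_differentiable k (char M)"
proof -
  have "integrable M (\<lambda>x. complex_of_real x ^ j * 1)" if "j \<le> k" for j
  proof (rule Bochner_Integration.integrable_bound)
    show "integrable M (\<lambda>x. 1 + \<bar>x\<bar> powr s)" using s by simp
    show "AE x in M. norm (complex_of_real x ^ j * 1) \<le> norm (1 + \<bar>x\<bar> powr s)"
    proof (rule AE_I2)
      fix x :: real
      have "\<bar>x\<bar> ^ j \<le> 1 + \<bar>x\<bar> powr s"
      proof (cases "\<bar>x\<bar> \<le> 1")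
        case True
        then show ?thesis using power_le_one[of "\<bar>x\<bar>" j] by (smt (verit) powr_ge_zero abs_ge_zero)
      next
        case False
        then have "\<bar>x\<bar> ^ j = \<bar>x\<bar> powr real j" by (simp add: powr_realpow)
        also have "\<dots> \<le> \<bar>x\<bar> powr s" using False that k by (intro powr_mono) auto
        finally show ?thesis by simp
      qed
      then show "norm (complex_of_real x ^ j * 1) \<le> norm (1 + \<bar>x\<bar> powr s)"
        by (simp add: norm_power)
    qed
  qed simp
  from times_differentiable_fourier[OF this] show ?thesis
    unfolding char_def[abs_def] by simp
qed

text \<open>Where it is not 0, \<open>|char M|\<close> is at least \<open>1/B\<close> on a bounded interval. It equals 1 at the origin
and is continuous, so by the intermediate value theorem it cannot jump over \<open>(0, 1/B)\<close> to reach 0.\<close>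

lemma (in real_distribution) char_nonzero:
  assumes B: "\<And>T. \<exists>B. \<forall>t. \<bar>t\<bar> \<le> T \<longrightarrow> norm (recip_char M t) \<le> B"
  shows "char M t \<noteq> 0"
proof
  assume t0: "char M t = 0"
  obtain B where B: "\<And>s. \<bar>s\<bar> \<le> \<bar>t\<bar> \<Longrightarrow> norm (recip_char M s) \<le> B" using B[of "\<bar>t\<bar>"] by auto
  define C where "C = max 1 B"
  have C1: "C \<ge> 1" by (simp add: C_def)
  let ?g = "\<lambda>s. norm (char M (s * t))"
  have "continuous_on {0..1} ?g"
  proof (intro continuous_on_norm continuous_at_imp_continuous_on ballI)
    show "isCont (\<lambda>s. char M (s * t)) x" for x
      by (rule isCont_o2[OF _ isCont_char]) (intro continuous_intros)
  qed
  then obtain s where s: "0 \<le> s" "s \<le> 1" "?g s = 1 / (2 * C)"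
  proof -
    have "1 / (2 * C) \<le> 1" "0 \<le> 1 / (2 * C)" using C1 by auto
    then show ?thesis
      using IVT2'[of ?g 1 "1 / (2 * C)" 0] that t0 char_zero \<open>continuous_on {0..1} ?g\<close> by auto
  qed
  have "\<bar>s * t\<bar> \<le> \<bar>t\<bar>" using s by (simp add: abs_mult mult_left_le_one_le)
  then have "norm (recip_char M (s * t)) \<le> C" using B by (force simp: C_def)
  moreover have "norm (recip_char M (s * t)) = 2 * C"
    using s(3) by (simp add: recip_char_def norm_divide)
  moreover have "C \<ge> 1" by (simp add: C_def)
  ultimately show False by simp
qed

lemma (in real_distribution) times_differentiable_recip_char:
  assumes "integrable M (\<lambda>x. \<bar>x\<bar> powr s)" and "real k \<le> s" and "\<And>t. char M t \<noteq> 0"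
  shows "times_differentiable k (recip_char M)"
  using times_differentiable_inverse[OF assms(3) times_differentiable_char[OF assms(1,2)]]
  by (simp add: recip_char_def[abs_def] inverse_eq_divide)

section \<open>The deconvolution kernel\<close>

lemma ft_fdiff_funpow:
  assumes f: "integrable lborel f"
  shows "integrable lborel ((fdiff d ^^ l) f)"
    and "ft ((fdiff d ^^ l) f) x = (iexp (d * x) - 1) ^ l * ft f x"
proof (induction l)
  case (Suc l)
  let ?g = "(fdiff d ^^ l) f"
  have [measurable]: "f \<in> borel_measurable borel" using f by simp
  case 1
  have s: "integrable lborel (\<lambda>u. ?g (u + d))"
    using lborel_integrable_real_affine[OF Suc(1), of 1 d] by (simp add: add.commute)
  have eq: "(fdiff d ^^ Suc l) f = (\<lambda>u. ?g (u + d) - ?g u)"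
    by (simp add: fdiff_def[of d ?g, abs_def])
  show ?case unfolding eq by (intro Bochner_Integration.integrable_diff s Suc(1))
  case 2
  have "ft ((fdiff d ^^ Suc l) f) x = (CLINT u|lborel. iexp (- (u * x)) * ?g (u + d) - iexp (- (u * x)) * ?g u)"
    unfolding ft_def eq by (simp only: right_diff_distrib)
  also have "\<dots> = ft (\<lambda>u. ?g (u + d)) x - ft ?g x"
    unfolding ft_def
    by (intro Bochner_Integration.integral_diff integrable_iexp_times s Suc(1)) measurable
  also have "\<dots> = (iexp (d * x) - 1) ^ Suc l * ft f x"
    unfolding ft_shift Suc(2) by (simp add: algebra_simps)
  finally show ?case .
qed (use f in simp_all)

lemma norm_iexp_quotient_tendsto:
  assumes "d \<longlonglongrightarrow> 0" "\<And>n. d n > 0"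
  shows "(\<lambda>n. norm (iexp (d n * v) - 1) / d n) \<longlonglongrightarrow> \<bar>v\<bar>"
proof -
  have lin: "((\<lambda>t. t * v) has_vector_derivative v) (at 0)"
    by (auto intro!: derivative_eq_intros)
  have "((\<lambda>t. iexp (t * v)) has_vector_derivative v *\<^sub>R (\<i> * iexp (0 * v))) (at 0)"
    using vector_diff_chain_at[OF lin has_vector_derivative_iexp] by (simp only: o_def)
  then have "((\<lambda>h. (iexp ((0 + h) * v) - iexp (0 * v)) /\<^sub>R h) \<longlongrightarrow> v *\<^sub>R (\<i> * iexp (0 * v))) (at 0)"
    by (simp only: has_vector_derivative_iff_quotient)
  then have "((\<lambda>h. (iexp ((0 + h) * v) - iexp (0 * v)) /\<^sub>R h) \<circ> d) \<longlonglongrightarrow> v *\<^sub>R (\<i> * iexp (0 * v))"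
    using assms by (subst (asm) tendsto_at_iff_sequentially) (auto simp: less_imp_neq[symmetric] dest: less_imp_neq)
  from tendsto_norm[OF this] have "(\<lambda>n. norm ((iexp (d n * v) - 1) /\<^sub>R d n)) \<longlonglongrightarrow> \<bar>v\<bar>"
    by (simp add: o_def norm_mult)
  moreover have "norm ((iexp (d n * v) - 1) /\<^sub>R d n) = norm (iexp (d n * v) - 1) / d n" for n
  proof -
    have "\<bar>d n\<bar> = d n" using assms(2)[of n] by simp
    then show ?thesis by (simp only: norm_scaleR abs_inverse divide_inverse mult.commute)
  qed
  ultimately show ?thesis by (simp only:)
qed

text \<open>The transform of a \<open>q\<close>-fold difference is \<open>(iexp (d v) - 1)\<^sup>q ft f v\<close>. Bessel's inequality
bounds the integral of \<open>|(iexp (d v) - 1) / d|\<^sup>2\<^sup>q |ft f v|\<^sup>2\<close> uniformly in \<open>d\<close>, and Fatou's lemma lets \<open>d\<close>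
tend to 0. Thus a bound on differences takes the place of the \<open>q\<close>-th derivative.\<close>

lemma ft_weighted_bessel:
  assumes f[measurable]: "f \<in> borel_measurable borel" and bnd: "\<And>u. norm (f u) \<le> B"
    and supp: "\<And>u. \<bar>u\<bar> > 1 \<Longrightarrow> f u = 0"
    and d0: "d0 > 0" and L: "\<And>d u. 0 < d \<Longrightarrow> d \<le> d0 \<Longrightarrow> norm ((fdiff d ^^ q) f u) \<le> L * d ^ q"
  shows "(\<integral>\<^sup>+ v. ennreal (v ^ (2 * q) * (norm (ft f v))\<^sup>2) \<partial>lborel) \<le> ennreal (2 * pi * (2 + real q) * L\<^sup>2)"
proof -
  have intf: "integrable lborel f" by (rule integrable_bounded_support[OF f bnd supp])
  have main: "(\<integral>\<^sup>+ v. ennreal ((norm (iexp (d * v) - 1) / d) ^ (2 * q) * (norm (ft f v))\<^sup>2) \<partial>lborel)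
      \<le> ennreal (2 * pi * (2 + real q) * L\<^sup>2)" if d: "0 < d" "d \<le> d0" "d \<le> 1" for d
  proof -
    let ?D = "(fdiff d ^^ q) f"
    have suppD: "?D u = 0" if "u \<notin> {- 1 - real q..1}" for u
    proof (rule fdiff_funpow_eq_0)
      fix j assume j: "j \<le> q"
      have "real j * d \<le> real q * 1" using j d by (intro mult_mono) auto
      moreover have "0 \<le> real j * d" using d by simp
      ultimately show "f (u + real j * d) = 0"
        using that by (intro supp) auto
    qed
    have le: "(norm (?D u))\<^sup>2 \<le> indicator {- 1 - real q..1} u * (L * d ^ q)\<^sup>2" for u
      using L[OF d(1,2), of u] suppD[of u] by (auto simp: indicator_def intro!: power_mono)
    have int2: "integrable lborel (\<lambda>u. (norm (?D u))\<^sup>2)"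
    proof (rule Bochner_Integration.integrable_bound)
      show "integrable lborel (\<lambda>u. indicator {- 1 - real q..1} u * (L * d ^ q)\<^sup>2)"
        by (intro integrable_mult_left) simp
      show "AE u in lborel. norm ((norm (?D u))\<^sup>2) \<le> norm (indicator {- 1 - real q..1} u * (L * d ^ q)\<^sup>2)"
        using le by (intro AE_I2) (auto intro: order_trans[OF _ abs_ge_self])
    qed measurable
    have "(LINT u|lborel. (norm (?D u))\<^sup>2) \<le> (LINT u|lborel. indicator {- 1 - real q..1} u * (L * d ^ q)\<^sup>2)"
      using le by (intro integral_mono int2 integrable_mult_left) simp_all
    also have "\<dots> = (2 + real q) * (L * d ^ q)\<^sup>2" by simp
    finally have i2: "(LINT u|lborel. (norm (?D u))\<^sup>2) \<le> (2 + real q) * (L * d ^ q)\<^sup>2" .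
    have eq: "(norm (iexp (d * v) - 1) / d) ^ (2 * q) * (norm (ft f v))\<^sup>2 = (1 / d ^ (2 * q)) * (norm (ft ?D v))\<^sup>2" for v
      unfolding ft_fdiff_funpow(2)[OF intf] norm_mult norm_power
      by (simp add: power_divide power_mult_distrib power_mult[symmetric] mult.commute[of q 2])
    have "(\<integral>\<^sup>+ v. ennreal ((norm (iexp (d * v) - 1) / d) ^ (2 * q) * (norm (ft f v))\<^sup>2) \<partial>lborel)
       = ennreal (1 / d ^ (2 * q)) * (\<integral>\<^sup>+ v. ennreal ((norm (ft ?D v))\<^sup>2) \<partial>lborel)"
      unfolding eq using d by (subst nn_integral_cmult[symmetric]) (auto simp: ennreal_mult[symmetric])
    also have "\<dots> \<le> ennreal (1 / d ^ (2 * q)) * ennreal (2 * pi * (LINT u|lborel. (norm (?D u))\<^sup>2))"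
      by (intro mult_left_mono ft_bessel ft_fdiff_funpow intf int2) simp
    also have "\<dots> \<le> ennreal (1 / d ^ (2 * q)) * ennreal (2 * pi * ((2 + real q) * (L * d ^ q)\<^sup>2))"
      using i2 by (intro mult_left_mono ennreal_leI) auto
    also have "\<dots> = ennreal (1 / d ^ (2 * q) * (2 * pi * ((2 + real q) * (L * d ^ q)\<^sup>2)))"
      using d by (intro ennreal_mult[symmetric]) auto
    also have "1 / d ^ (2 * q) * (2 * pi * ((2 + real q) * (L * d ^ q)\<^sup>2)) = 2 * pi * (2 + real q) * L\<^sup>2"
      using d by (simp add: power_mult_distrib power_mult[symmetric] mult.commute[of q 2])
    finally show ?thesis .
  qed
  define d where "d n = min 1 d0 / real (Suc n)" for n
  have d: "0 < d n" "d n \<le> d0" "d n \<le> 1" for n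
  proof -
    show "0 < d n" using d0 by (simp add: d_def)
    have "d n \<le> min 1 d0 / 1" unfolding d_def using d0 by (intro divide_left_mono) auto
    then show "d n \<le> d0" "d n \<le> 1" by auto
  qed
  have d_lim: "d \<longlonglongrightarrow> 0"
    unfolding d_def using tendsto_mult_right[OF LIMSEQ_inverse_real_of_nat, of "min 1 d0"]
    by (simp add: divide_inverse mult.commute)
  let ?F = "\<lambda>n v. ennreal ((norm (iexp (d n * v) - 1) / d n) ^ (2 * q) * (norm (ft f v))\<^sup>2)"
  have lim: "(\<lambda>n. ?F n v) \<longlonglongrightarrow> ennreal (v ^ (2 * q) * (norm (ft f v))\<^sup>2)" for v
  proof -
    have "(\<lambda>n. (norm (iexp (d n * v) - 1) / d n) ^ (2 * q) * (norm (ft f v))\<^sup>2) \<longlonglongrightarrow> \<bar>v\<bar> ^ (2 * q) * (norm (ft f v))\<^sup>2"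
      by (intro tendsto_mult tendsto_power tendsto_const norm_iexp_quotient_tendsto d_lim d)
    moreover have "\<bar>v\<bar> ^ (2 * q) = v ^ (2 * q)" by (simp add: power_even_abs)
    ultimately show ?thesis by (intro tendsto_ennrealI) (simp only:)
  qed
  have "(\<integral>\<^sup>+ v. ennreal (v ^ (2 * q) * (norm (ft f v))\<^sup>2) \<partial>lborel) = (\<integral>\<^sup>+ v. liminf (\<lambda>n. ?F n v) \<partial>lborel)"
    using lim_imp_Liminf[OF _ lim] by simp
  also have "\<dots> \<le> liminf (\<lambda>n. \<integral>\<^sup>+ v. ?F n v \<partial>lborel)"
    by (rule nn_integral_liminf) measurable
  also have "\<dots> \<le> ennreal (2 * pi * (2 + real q) * L\<^sup>2)"
    using main[OF d] by (intro Liminf_le) (auto intro!: always_eventually)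
  finally show ?thesis .
qed

text \<open>With this \<open>q\<close> the weight \<open>1 + v\<^sup>2\<^sup>q\<close> dominates \<open>|v|\<close> to the power \<open>2 p + a\<close> for all \<open>a \<le> 2\<close>,
hence for some \<open>a > 1\<close>.\<close>

definition deriv_order :: "real \<Rightarrow> nat" where
  "deriv_order p = nat \<lceil>p\<rceil> + 1"

text \<open>The power of 2 comes from the Leibniz rule, the power of the order from the differences of a
spline made of windows of half-width \<open>1 / kernel_order p\<close>.\<close>

definition spline_const :: "real \<Rightarrow> real" where
  "spline_const p = 2 ^ deriv_order p * real (kernel_order p) ^ Suc (deriv_order p)"

definition deconv_const :: "real \<Rightarrow> real" where
  "deconv_const p = (1 / (LINT y|lborel. sinc_pow p y))\<^sup>2 *
     (2 * pi * (4 + real (deriv_order p)) * (spline_const p)\<^sup>2)"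

text \<open>One coordinate of the noise at a fixed bandwidth.\<close>

locale deconvolution = real_distribution \<nu> for \<nu> :: "real measure" +
  fixes p h :: real
  assumes p: "p \<ge> 1" and h: "h > 0" and char_nz: "\<And>t. char \<nu> t \<noteq> 0"
    and smooth: "times_differentiable (deriv_order p) (recip_char \<nu>)"
begin

abbreviation "m \<equiv> kernel_order p"
abbreviation "q \<equiv> deriv_order p"
abbreviation "kernel_mass \<equiv> LINT y|lborel. sinc_pow p y"

definition \<psi> :: "real \<Rightarrow> complex" where
  "\<psi> u = kernel_spline p u * recip_char \<nu> (u / h)"

lemma m_gt: "m \<ge> 4" "q \<le> m - 1" "m > 0"
  using kernel_order_ge[OF p] unfolding deriv_order_def by auto

lemma q_ge: "q \<ge> 2"
proof -
  have "0 < \<lceil>p\<rceil>" using p by simp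
  then have "1 \<le> nat \<lceil>p\<rceil>" by linarith
  then show ?thesis by (simp add: deriv_order_def)
qed

lemma deconv_kernel_psi: "deconv_kernel p \<nu> h x = 1 / kernel_mass * Re (ft \<psi> x)"
  using deconv_kernel_eq[OF p] by (simp only: \<psi>_def[abs_def])

lemma isCont_recip_char: "isCont (recip_char \<nu>) t"
  unfolding recip_char_def[abs_def] by (intro continuous_divide continuous_const isCont_char char_nz)

lemma isCont_psi: "isCont \<psi> u"
  unfolding \<psi>_def[abs_def] using m_gt h
  by (intro continuous_mult isCont_bspline isCont_o2[OF _ isCont_recip_char]) (auto intro!: continuous_intros)

lemma psi_measurable [measurable]: "\<psi> \<in> borel_measurable borel"
  by (intro borel_measurable_continuous_onI continuous_at_imp_continuous_on ballI isCont_psi)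

lemma kernel_spline_support: "\<bar>u\<bar> > 1 \<Longrightarrow> kernel_spline p u = 0"
  using m_gt by (intro bspline_support) auto

lemma psi_support: "\<bar>u\<bar> > 1 \<Longrightarrow> \<psi> u = 0"
  unfolding \<psi>_def by (subst kernel_spline_support) simp_all

lemma psi_bounded: "\<exists>B. \<forall>u. norm (\<psi> u) \<le> B"
proof -
  have "compact (\<psi> ` {- 1..1})"
    by (intro compact_continuous_image continuous_at_imp_continuous_on ballI isCont_psi) simp
  then obtain B where B: "\<And>u. u \<in> {- 1..1} \<Longrightarrow> norm (\<psi> u) \<le> B"
    using compact_imp_bounded bounded_iff by (metis image_eqI)
  have "norm (\<psi> u) \<le> max 0 B" for u
  proof (cases "\<bar>u\<bar> \<le> 1")
    case True
    then have "u \<in> {- 1..1}" by auto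
    then show ?thesis using B[of u] by (simp add: max.coboundedI2)
  next
    case False
    then show ?thesis using psi_support[of u] by simp
  qed
  then show ?thesis by blast
qed

lemma integrable_psi: "integrable lborel \<psi>"
  using psi_bounded integrable_bounded_support[OF psi_measurable _ psi_support] by blast

lemma deconv_kernel_measurable [measurable]: "deconv_kernel p \<nu> h \<in> borel_measurable borel"
  unfolding deconv_kernel_psi[abs_def] by measurable

lemma deconv_kernel_bounded: "\<exists>B. \<forall>x. \<bar>deconv_kernel p \<nu> h x\<bar> \<le> B"
proof -
  have "\<bar>deconv_kernel p \<nu> h x\<bar> \<le> 1 / kernel_mass * (LINT u|lborel. norm (\<psi> u))" for x
  proof -
    have "\<bar>Re (ft \<psi> x)\<bar> \<le> (LINT u|lborel. norm (\<psi> u))"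
      using abs_Re_le_cmod norm_ft_le order_trans by blast
    then have "1 / kernel_mass * \<bar>Re (ft \<psi> x)\<bar> \<le> 1 / kernel_mass * (LINT u|lborel. norm (\<psi> u))"
      using integral_sinc_pow_pos[OF p] by (intro mult_left_mono) auto
    then show ?thesis
      unfolding deconv_kernel_psi abs_mult using integral_sinc_pow_pos[OF p] by simp
  qed
  then show ?thesis by blast
qed

text \<open>Unbiasedness. After exchanging integrals, the noise contributes \<open>char \<nu> (u / h)\<close>, which
cancels \<^const>\<open>recip_char\<close>. What remains is the transform of the spline, that is, the kernel.\<close>

lemma expectation_deconv_kernel:
  "(LINT e|\<nu>. deconv_kernel p \<nu> h ((y - e) / h)) = kernel p (y / h)"
proof -
  interpret L: pair_sigma_finite lborel \<nu> ..
  have one: "integrable \<nu> (\<lambda>e. 1 :: complex)" by simp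
  have intft: "integrable \<nu> (\<lambda>e. ft \<psi> ((y - e) / h))"
  proof (rule integrable_const_bound[where B = "LINT u|lborel. norm (\<psi> u)"])
    show "(\<lambda>e. ft \<psi> ((y - e) / h)) \<in> borel_measurable \<nu>" by measurable
  qed (simp add: norm_ft_le)
  have "(CLINT e|\<nu>. ft \<psi> ((y - e) / h))
     = (CLINT e|\<nu>. (CLINT u|lborel. iexp (- (u * ((y - e) / h))) * (\<psi> u * 1)))"
    by (simp add: ft_def)
  also have "\<dots> = (CLINT u|lborel. (CLINT e|\<nu>. iexp (- (u * ((y - e) / h))) * (\<psi> u * 1)))"
    using L.Fubini_bounded_times_product[OF integrable_psi one, of "\<lambda>(u, e). iexp (- (u * ((y - e) / h)))" 1]
    by (simp add: split_beta)
  also have "\<dots> = (CLINT u|lborel. iexp (- (u * (y / h))) * kernel_spline p u)"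
  proof (rule Bochner_Integration.integral_cong[OF refl])
    fix u
    have e: "- (u * ((y - e) / h)) = - (u * (y / h)) + u / h * e" for e
      by (simp add: diff_divide_distrib algebra_simps)
    have "(CLINT e|\<nu>. iexp (- (u * ((y - e) / h))) * (\<psi> u * 1))
       = (CLINT e|\<nu>. (iexp (- (u * (y / h))) * \<psi> u) * iexp (u / h * e))"
      unfolding e iexp_add by (simp only: mult_ac mult_1)
    also have "\<dots> = (iexp (- (u * (y / h))) * \<psi> u) * char \<nu> (u / h)"
      unfolding char_def by (rule integral_mult_right_zero)
    finally show "(CLINT e|\<nu>. iexp (- (u * ((y - e) / h))) * (\<psi> u * 1)) = iexp (- (u * (y / h))) * kernel_spline p u"
      using char_nz[of "u / h"] by (simp add: \<psi>_def recip_char_def)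
  qed
  also have "\<dots> = complex_of_real (sinc_pow p (y / h))"
    using ft_kernel_spline[OF p, of "y / h"] by (simp only: ft_def)
  finally have eq: "(CLINT e|\<nu>. ft \<psi> ((y - e) / h)) = complex_of_real (sinc_pow p (y / h))" .
  have "(LINT e|\<nu>. deconv_kernel p \<nu> h ((y - e) / h)) = 1 / kernel_mass * (LINT e|\<nu>. Re (ft \<psi> ((y - e) / h)))"
    unfolding deconv_kernel_psi by (rule integral_mult_right_zero)
  also have "(LINT e|\<nu>. Re (ft \<psi> ((y - e) / h))) = Re (CLINT e|\<nu>. ft \<psi> ((y - e) / h))"
    using intft by (rule integral_Re)
  finally show ?thesis by (simp add: eq kernel_eq)
qed

text \<open>Differences sample \<open>recip_char\<close> slightly outside \<open>[-1/h, 1/h]\<close>. For steps \<open>d\<close> small compared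
with \<open>\<tau> - 1\<close> all sample points stay in \<open>[-\<tau>/h, \<tau>/h]\<close>.\<close>

lemma norm_fdiff_psi_le:
  assumes \<tau>: "\<tau> > 1" and G0: "G \<ge> 0"
    and G: "\<And>l t. l \<le> q \<Longrightarrow> \<bar>t\<bar> \<le> \<tau> / h \<Longrightarrow> norm (higher_derivative l (recip_char \<nu>) t) \<le> G"
    and l: "l \<le> q" and d: "0 < d" "d \<le> (\<tau> - 1) / real q"
  shows "norm ((fdiff d ^^ l) \<psi> u) \<le> spline_const p * G * (max 1 (1 / h)) ^ q * d ^ l"
proof -
  let ?H = "(max 1 (1 / h)) ^ q"
  have qd: "real q * d \<le> \<tau> - 1" using d q_ge by (simp add: field_simps)
  have H: "(1 / h) ^ i \<le> ?H" if "i \<le> q" for i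
  proof -
    have "(1 / h) ^ i \<le> (max 1 (1 / h)) ^ i" using h by (intro power_mono) auto
    also have "\<dots> \<le> ?H" using that by (intro power_increasing) auto
    finally show ?thesis .
  qed
  have H1: "1 \<le> ?H" by (intro one_le_power) simp
  have m1: "1 \<le> real m" using m_gt by simp
  show ?thesis
  proof (cases "- 1 - real q * d \<le> u \<and> u \<le> 1")
    case True
    have "norm ((fdiff d ^^ l) (\<lambda>u. kernel_spline p u * recip_char \<nu> (u / h)) u) \<le> 2 ^ l * (real m ^ Suc q) * (G * ?H) * d ^ l"
    proof (rule norm_fdiff_funpow_mult_le)
      fix i j assume ij: "i + j \<le> l"
      have "norm ((fdiff d ^^ i) (kernel_spline p) (u + real j * d)) \<le> 1 / (2 * (1 / real m)) * (1 / (1 / real m)) ^ i * d ^ i"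
        using ij l m_gt d by (intro norm_fdiff_bspline_le) auto
      also have "\<dots> = (real m / 2 * real m ^ i) * d ^ i" by simp
      also have "\<dots> \<le> real m ^ Suc q * d ^ i"
      proof (intro mult_right_mono)
        have "real m ^ i \<le> real m ^ q" using m1 ij l by (intro power_increasing) auto
        then have "real m / 2 * real m ^ i \<le> real m * real m ^ q"
          using m1 by (intro mult_mono) auto
        then show "real m / 2 * real m ^ i \<le> real m ^ Suc q" by simp
      qed (use d in simp)
      finally show "norm ((fdiff d ^^ i) (kernel_spline p) (u + real j * d)) \<le> real m ^ Suc q * d ^ i" .
      have td: "times_differentiable i (recip_char \<nu>)"
      proof -
        have "i \<le> q" using ij l by simp
        then show ?thesis using smooth
          by (induction rule: inc_induct) (auto dest: times_differentiable_Suc_imp simp del: times_differentiable.simps)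
      qed
      have "norm ((fdiff (d / h) ^^ i) (recip_char \<nu>) ((u + real j * d) / h)) \<le> G * (d / h) ^ i"
      proof (rule norm_fdiff_funpow_le_higher_derivative[OF td])
        show "0 \<le> d / h" using d h by simp
        fix t assume t: "(u + real j * d) / h \<le> t" "t \<le> (u + real j * d) / h + real i * (d / h)"
        have "(u + real j * d) / h + real i * (d / h) = (u + real (i + j) * d) / h"
          by (simp add: add_divide_distrib algebra_simps)
        moreover have "real (i + j) * d \<le> real q * d" using ij l d by (intro mult_right_mono) auto
        then have "u + real (i + j) * d \<le> \<tau>" using True qd by linarith
        then have "(u + real (i + j) * d) / h \<le> \<tau> / h" using h by (intro divide_right_mono) auto
        moreover have "- \<tau> \<le> u" using True qd by linarith
        then have "- \<tau> \<le> u + real j * d" using d by (simp add: add_increasing2)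
        then have "(- \<tau>) / h \<le> (u + real j * d) / h" using h by (intro divide_right_mono) auto
        ultimately have "\<bar>t\<bar> \<le> \<tau> / h" using t by (simp add: abs_le_iff)
        then show "norm (higher_derivative i (recip_char \<nu>) t) \<le> G"
          using G ij l by simp
      qed
      also have "\<dots> = G * (1 / h) ^ i * d ^ i" by (simp add: power_divide)
      also have "\<dots> \<le> G * ?H * d ^ i"
        using H[of i] ij l d G0 by (intro mult_right_mono mult_left_mono) auto
      finally show "norm ((fdiff d ^^ i) (\<lambda>u. recip_char \<nu> (u / h)) (u + real j * d)) \<le> G * ?H * d ^ i"
        unfolding fdiff_funpow_scale .
    qed (use d G0 H1 m1 in auto)
    also have "\<dots> \<le> 2 ^ q * (real m ^ Suc q) * (G * ?H) * d ^ l"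
      using l d G0 H1 m1 by (intro mult_right_mono power_increasing) auto
    finally show ?thesis unfolding spline_const_def \<psi>_def[abs_def] by (simp only: mult.assoc)
  next
    case False
    have "(fdiff d ^^ l) \<psi> u = 0"
    proof (rule fdiff_funpow_eq_0)
      fix j assume j: "j \<le> l"
      have "real j * d \<le> real q * d" "0 \<le> real j * d" using j l d by (auto intro: mult_right_mono)
      then show "\<psi> (u + real j * d) = 0" using False by (intro psi_support) auto
    qed
    then show ?thesis using d G0 H1 by (simp add: spline_const_def)
  qed
qed

lemma nn_integral_moment_ft_psi_le:
  assumes \<tau>: "\<tau> > 1" and G0: "G \<ge> 0"
    and G: "\<And>l t. l \<le> q \<Longrightarrow> \<bar>t\<bar> \<le> \<tau> / h \<Longrightarrow> norm (higher_derivative l (recip_char \<nu>) t) \<le> G"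
  shows "(\<integral>\<^sup>+ v. ennreal ((1 + v ^ (2 * q)) * (norm (ft \<psi> v))\<^sup>2) \<partial>lborel)
    \<le> ennreal (2 * pi * (4 + real q) * (spline_const p * G * (max 1 (1 / h)) ^ q)\<^sup>2)"
proof -
  let ?L = "spline_const p * G * (max 1 (1 / h)) ^ q"
  obtain B where B: "\<And>u. norm (\<psi> u) \<le> B" using psi_bounded by blast
  have d0: "0 < (\<tau> - 1) / real q" using \<tau> q_ge by simp
  have b: "(\<integral>\<^sup>+ v. ennreal (v ^ (2 * l) * (norm (ft \<psi> v))\<^sup>2) \<partial>lborel) \<le> ennreal (2 * pi * (2 + real l) * ?L\<^sup>2)"
    if "l \<le> q" for l
    using that by (intro ft_weighted_bessel[OF psi_measurable B psi_support d0] norm_fdiff_psi_le[OF \<tau> G0 G]) auto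
  have "(\<integral>\<^sup>+ v. ennreal ((1 + v ^ (2 * q)) * (norm (ft \<psi> v))\<^sup>2) \<partial>lborel)
      = (\<integral>\<^sup>+ v. ennreal (v ^ (2 * 0) * (norm (ft \<psi> v))\<^sup>2) + ennreal (v ^ (2 * q) * (norm (ft \<psi> v))\<^sup>2) \<partial>lborel)"
    by (intro nn_integral_cong) (simp add: distrib_right zero_le_even_power flip: ennreal_plus)
  also have "\<dots> = (\<integral>\<^sup>+ v. ennreal (v ^ (2 * 0) * (norm (ft \<psi> v))\<^sup>2) \<partial>lborel)
      + (\<integral>\<^sup>+ v. ennreal (v ^ (2 * q) * (norm (ft \<psi> v))\<^sup>2) \<partial>lborel)"
    by (rule nn_integral_add) measurable
  also have "\<dots> \<le> ennreal (2 * pi * (2 + real 0) * ?L\<^sup>2) + ennreal (2 * pi * (2 + real q) * ?L\<^sup>2)"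
    by (intro add_mono b) auto
  also have "\<dots> = ennreal (2 * pi * (2 + real 0) * ?L\<^sup>2 + 2 * pi * (2 + real q) * ?L\<^sup>2)"
    by (intro ennreal_plus[symmetric]) auto
  also have "2 * pi * (2 + real 0) * ?L\<^sup>2 + 2 * pi * (2 + real q) * ?L\<^sup>2 = 2 * pi * (4 + real q) * ?L\<^sup>2"
    by (simp add: algebra_simps)
  finally show ?thesis .
qed

lemma nn_integral_moment_deconv_kernel_le:
  assumes "\<tau> > 1" "G \<ge> 0"
    and "\<And>l t. l \<le> q \<Longrightarrow> \<bar>t\<bar> \<le> \<tau> / h \<Longrightarrow> norm (higher_derivative l (recip_char \<nu>) t) \<le> G"
  shows "(\<integral>\<^sup>+ v. ennreal ((1 + v ^ (2 * q)) * (deconv_kernel p \<nu> h v)\<^sup>2) \<partial>lborel)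
    \<le> ennreal (deconv_const p * (G * (max 1 (1 / h)) ^ q)\<^sup>2)"
proof -
  have "(\<integral>\<^sup>+ v. ennreal ((1 + v ^ (2 * q)) * (deconv_kernel p \<nu> h v)\<^sup>2) \<partial>lborel)
     \<le> (\<integral>\<^sup>+ v. ennreal ((1 / kernel_mass)\<^sup>2) * ennreal ((1 + v ^ (2 * q)) * (norm (ft \<psi> v))\<^sup>2) \<partial>lborel)"
  proof (rule nn_integral_mono)
    fix v :: real
    have "(Re (ft \<psi> v))\<^sup>2 \<le> (norm (ft \<psi> v))\<^sup>2"
      using abs_Re_le_cmod[of "ft \<psi> v"] by (simp add: abs_le_square_iff[symmetric])
    then have "(1 / kernel_mass)\<^sup>2 * (1 + v ^ (2 * q)) * (Re (ft \<psi> v))\<^sup>2 \<le> (1 / kernel_mass)\<^sup>2 * (1 + v ^ (2 * q)) * (norm (ft \<psi> v))\<^sup>2"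
      by (intro mult_left_mono mult_nonneg_nonneg) (auto simp: zero_le_even_power')
    then have "(1 + v ^ (2 * q)) * (deconv_kernel p \<nu> h v)\<^sup>2 \<le> (1 / kernel_mass)\<^sup>2 * ((1 + v ^ (2 * q)) * (norm (ft \<psi> v))\<^sup>2)"
      unfolding deconv_kernel_psi power_mult_distrib by (simp only: mult_ac)
    then show "ennreal ((1 + v ^ (2 * q)) * (deconv_kernel p \<nu> h v)\<^sup>2)
       \<le> ennreal ((1 / kernel_mass)\<^sup>2) * ennreal ((1 + v ^ (2 * q)) * (norm (ft \<psi> v))\<^sup>2)"
      by (subst ennreal_mult[symmetric]) (auto simp: zero_le_even_power intro!: ennreal_leI)
  qed
  also have "\<dots> = ennreal ((1 / kernel_mass)\<^sup>2) * (\<integral>\<^sup>+ v. ennreal ((1 + v ^ (2 * q)) * (norm (ft \<psi> v))\<^sup>2) \<partial>lborel)"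
    by (rule nn_integral_cmult) measurable
  also have "\<dots> \<le> ennreal ((1 / kernel_mass)\<^sup>2) * ennreal (2 * pi * (4 + real q) * (spline_const p * G * (max 1 (1 / h)) ^ q)\<^sup>2)"
    by (intro mult_left_mono nn_integral_moment_ft_psi_le[OF assms]) auto
  also have "\<dots> = ennreal ((1 / kernel_mass)\<^sup>2 * (2 * pi * (4 + real q) * (spline_const p * G * (max 1 (1 / h)) ^ q)\<^sup>2))"
    by (intro ennreal_mult[symmetric]) auto
  also have "(1 / kernel_mass)\<^sup>2 * (2 * pi * (4 + real q) * (spline_const p * G * (max 1 (1 / h)) ^ q)\<^sup>2)
     = deconv_const p * (G * (max 1 (1 / h)) ^ q)\<^sup>2"
    unfolding deconv_const_def power_mult_distrib by (simp only: mult_ac)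
  finally show ?thesis .
qed

text \<open>Integrability follows from the weighted square integrability, as
\<open>x \<le> 1/w + w x\<^sup>2\<close> with \<open>w = (1 + |v|)\<^sup>2\<close>. For the integral, invert the transforms of \<open>\<psi>\<close> and of the spline
at 0, where \<open>\<psi>\<close> and the spline agree because \<open>char \<nu> 0 = 1\<close>.\<close>

lemma
  assumes \<tau>: "\<tau> > 1" and G0: "G \<ge> 0"
    and G: "\<And>l t. l \<le> q \<Longrightarrow> \<bar>t\<bar> \<le> \<tau> / h \<Longrightarrow> norm (higher_derivative l (recip_char \<nu>) t) \<le> G"
  shows integrable_deconv_kernel: "integrable lborel (deconv_kernel p \<nu> h)"
    and integral_deconv_kernel: "(LINT x|lborel. deconv_kernel p \<nu> h x) = 1"
proof -
  have w: "norm (ft \<psi> v) \<le> (1 + \<bar>v\<bar>) powr (- 2) + 4 * ((1 + v ^ (2 * q)) * (norm (ft \<psi> v))\<^sup>2)" for v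
  proof -
    have pos: "0 < (1 + \<bar>v\<bar>)\<^sup>2" by (simp add: add_pos_nonneg)
    have pw: "(1 + \<bar>v\<bar>) powr (- 2) = 1 / (1 + \<bar>v\<bar>)\<^sup>2"
      using powr_minus[of "1 + \<bar>v\<bar>" 2] powr_realpow[of "1 + \<bar>v\<bar>" 2] by (simp add: inverse_eq_divide)
    have "\<bar>v\<bar>\<^sup>2 \<le> 1 + \<bar>v\<bar> ^ (2 * q)"
    proof (cases "\<bar>v\<bar> \<le> 1")
      case True
      then show ?thesis using power_le_one[of "\<bar>v\<bar>" 2] zero_le_power[of "\<bar>v\<bar>" "2 * q"] by linarith
    next
      case False
      then have "\<bar>v\<bar>\<^sup>2 \<le> \<bar>v\<bar> ^ (2 * q)" using q_ge by (intro power_increasing) auto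
      then show ?thesis by simp
    qed
    moreover have "\<bar>v\<bar> ^ (2 * q) = v ^ (2 * q)" by (simp add: power_even_abs)
    moreover have "2 * \<bar>v\<bar> \<le> 1 + \<bar>v\<bar>\<^sup>2" using sum_squares_bound[of 1 "\<bar>v\<bar>"] by simp
    moreover have "0 \<le> v ^ (2 * q)" by (simp add: zero_le_even_power')
    moreover have "(1 + \<bar>v\<bar>)\<^sup>2 = 1 + \<bar>v\<bar>\<^sup>2 + 2 * \<bar>v\<bar>" by (simp add: power2_sum)
    moreover have "A \<le> 1 + W \<Longrightarrow> W = V \<Longrightarrow> 2 * b \<le> 1 + A \<Longrightarrow> 0 \<le> V \<Longrightarrow> E = 1 + A + 2 * b \<Longrightarrow> E \<le> 4 * (1 + V)"
      for A V W b E :: real by simp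
    ultimately have le4: "(1 + \<bar>v\<bar>)\<^sup>2 \<le> 4 * (1 + v ^ (2 * q))" by blast
    have "norm (ft \<psi> v) \<le> 1 / (1 + \<bar>v\<bar>)\<^sup>2 + (1 + \<bar>v\<bar>)\<^sup>2 * (norm (ft \<psi> v))\<^sup>2"
    proof (cases "norm (ft \<psi> v) \<le> 1 / (1 + \<bar>v\<bar>)\<^sup>2")
      case True
      then show ?thesis by (simp add: add_increasing2)
    next
      case False
      then have "1 \<le> (1 + \<bar>v\<bar>)\<^sup>2 * norm (ft \<psi> v)" using pos by (simp add: field_simps)
      then have "1 * norm (ft \<psi> v) \<le> (1 + \<bar>v\<bar>)\<^sup>2 * norm (ft \<psi> v) * norm (ft \<psi> v)"
        by (intro mult_right_mono) auto
      then have "norm (ft \<psi> v) \<le> (1 + \<bar>v\<bar>)\<^sup>2 * (norm (ft \<psi> v))\<^sup>2"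
        by (simp add: power2_eq_square mult.assoc)
      moreover have "0 \<le> 1 / (1 + \<bar>v\<bar>)\<^sup>2" by simp
      ultimately show ?thesis by linarith
    qed
    also have "(1 + \<bar>v\<bar>)\<^sup>2 * (norm (ft \<psi> v))\<^sup>2 \<le> 4 * (1 + v ^ (2 * q)) * (norm (ft \<psi> v))\<^sup>2"
      using le4 by (rule mult_right_mono) simp
    finally show ?thesis unfolding pw by (simp only: mult.assoc)
  qed
  have fin: "ennreal x < \<infinity>" for x by simp
  have iw: "integrable lborel (\<lambda>v. (1 + v ^ (2 * q)) * (norm (ft \<psi> v))\<^sup>2)"
  proof (rule integrableI_nonneg)
    show "(\<integral>\<^sup>+ v. ennreal ((1 + v ^ (2 * q)) * (norm (ft \<psi> v))\<^sup>2) \<partial>lborel) < \<infinity>"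
      by (rule order_le_less_trans[OF nn_integral_moment_ft_psi_le[OF \<tau> G0] fin]) (use G in auto)
  qed (auto intro!: AE_I2 mult_nonneg_nonneg simp: zero_le_even_power')
  have ift: "integrable lborel (ft \<psi>)"
  proof (rule Bochner_Integration.integrable_bound)
    show "integrable lborel (\<lambda>v. (1 + \<bar>v\<bar>) powr (- 2) + 4 * ((1 + v ^ (2 * q)) * (norm (ft \<psi> v))\<^sup>2))"
      by (intro Bochner_Integration.integrable_add integrable_weight integrable_mult_right iw) simp
    show "AE v in lborel. norm (ft \<psi> v) \<le> norm ((1 + \<bar>v\<bar>) powr (- 2) + 4 * ((1 + v ^ (2 * q)) * (norm (ft \<psi> v))\<^sup>2))"
      using w by (intro AE_I2) (auto intro: order_trans[OF _ abs_ge_self])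
  qed measurable
  then show "integrable lborel (deconv_kernel p \<nu> h)"
    unfolding deconv_kernel_psi[abs_def] by (intro integrable_mult_right integrable_Re)
  obtain B where B: "\<And>u. norm (\<psi> u) \<le> B" using psi_bounded by blast
  have "(CLINT x|lborel. iexp (x * 0) * ft \<psi> x) = complex_of_real (2 * pi) * \<psi> 0"
    by (rule ft_inversion[OF integrable_psi B isCont_psi ift])
  then have 1: "(CLINT x|lborel. ft \<psi> x) = complex_of_real (2 * pi) * kernel_spline p 0"
    by (simp add: \<psi>_def recip_char_def char_zero)
  have "(CLINT x|lborel. iexp (x * 0) * ft (kernel_spline p) x) = complex_of_real (2 * pi) * kernel_spline p 0"
  proof (rule ft_inversion)
    show "integrable lborel (ft (kernel_spline p))"
      unfolding ft_kernel_spline[OF p, abs_def] by (intro integrable_of_real integrable_sinc_pow p)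
  qed (use m_gt in \<open>auto intro!: integrable_bspline norm_bspline_le isCont_bspline\<close>)
  then have 2: "complex_of_real kernel_mass = complex_of_real (2 * pi) * kernel_spline p 0"
    unfolding ft_kernel_spline[OF p] by (simp add: integral_complex_of_real)
  have "(LINT x|lborel. deconv_kernel p \<nu> h x) = 1 / kernel_mass * (LINT x|lborel. Re (ft \<psi> x))"
    unfolding deconv_kernel_psi by (rule integral_mult_right_zero)
  also have "(LINT x|lborel. Re (ft \<psi> x)) = Re (CLINT x|lborel. ft \<psi> x)"
    using ift by (rule integral_Re)
  also have "\<dots> = kernel_mass" unfolding 1 2[symmetric] by simp
  finally show "(LINT x|lborel. deconv_kernel p \<nu> h x) = 1"
    using integral_sinc_pow_pos[OF p] by simp
qed

end

section \<open>Couplings\<close>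

lemma ennreal_powr_wasserstein_le:
  assumes p: "p \<ge> 1" and \<pi>: "\<pi> \<in> couplings \<mu> \<nu>"
  shows "ennreal_powr (wasserstein p \<mu> \<nu>) p \<le> (\<integral>\<^sup>+ z. ennreal (norm (fst z - snd z) powr p) \<partial>\<pi>)"
proof (cases "(\<integral>\<^sup>+ z. ennreal (norm (fst z - snd z) powr p) \<partial>\<pi>)")
  case (real r)
  have "wasserstein p \<mu> \<nu> \<le> ennreal_powr (\<integral>\<^sup>+ z. ennreal (norm (fst z - snd z) powr p) \<partial>\<pi>) (1 / p)"
    unfolding wasserstein_def by (rule INF_lower[OF \<pi>])
  then have W: "wasserstein p \<mu> \<nu> \<le> ennreal (r powr (1 / p))"
    using real by (simp add: ennreal_powr_def)
  then have "wasserstein p \<mu> \<nu> \<noteq> \<infinity>" by (auto simp: top_unique)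
  then have "ennreal_powr (wasserstein p \<mu> \<nu>) p = ennreal (enn2real (wasserstein p \<mu> \<nu>) powr p)"
    by (simp add: ennreal_powr_def)
  also have "\<dots> \<le> ennreal ((r powr (1 / p)) powr p)"
    using enn2real_mono[OF W] p by (intro ennreal_leI powr_mono2) auto
  also have "\<dots> = ennreal r" using p real by (simp add: powr_powr)
  finally show ?thesis using real by simp
qed simp

lemma norm_diff_powr_le:
  fixes x y z :: "'a::real_normed_vector"
  assumes p: "p \<ge> 1"
  shows "norm (x - y) powr p \<le> 3 powr p * (norm (x - z) powr p + norm z powr p + norm y powr p)"
proof -
  let ?m = "max (norm (x - z)) (max (norm z) (norm y))"
  have "norm (x - y) \<le> norm (x - z) + norm z + norm y"
    using norm_triangle_ineq[of "x - z" "z - y"] norm_triangle_ineq4[of z y] by simp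
  also have "\<dots> \<le> 3 * ?m" by simp
  finally have "norm (x - y) powr p \<le> (3 * ?m) powr p"
    using p by (intro powr_mono2) auto
  also have "\<dots> = 3 powr p * ?m powr p" by (intro powr_mult) 
  also have "?m powr p \<le> norm (x - z) powr p + norm z powr p + norm y powr p"
    by (auto simp: max_def)
  finally show ?thesis by simp
qed

text \<open>Given \<open>(x, z)\<close> drawn from \<open>Q\<close>, keep \<open>z\<close> with probability \<open>\<rho> z\<close> and otherwise replace it by an
independent \<open>y\<close> drawn from \<open>E\<close>. The boolean component records the choice, and the density gives its
conditional probability.\<close>

definition coupling_mixture ::
  "('a \<times> 'a) measure \<Rightarrow> ('a::euclidean_space \<Rightarrow> real) \<Rightarrow> 'a measure \<Rightarrow> ('a \<times> 'a) measure" where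
  "coupling_mixture Q \<rho> E =
     distr (density (Q \<Otimes>\<^sub>M (E \<Otimes>\<^sub>M count_space UNIV))
         (\<lambda>(xz, y, b). ennreal (if b then \<rho> (snd xz) else 1 - \<rho> (snd xz))))
       borel (\<lambda>(xz, y, b). (fst xz, if b then snd xz else y))"

lemma sets_coupling_mixture [simp, measurable_cong]: "sets (coupling_mixture Q \<rho> E) = sets borel"
  by (simp add: coupling_mixture_def)

lemma nn_integral_coupling_mixture:
  fixes Q :: "('a::euclidean_space \<times> 'a) measure" and F :: "'a \<times> 'a \<Rightarrow> ennreal"
  assumes Q: "sets Q = sets borel" and E: "prob_space E" "sets E = sets borel"
    and [measurable]: "\<rho> \<in> borel_measurable borel" "F \<in> borel_measurable borel"
  shows "(\<integral>\<^sup>+ w. F w \<partial>coupling_mixture Q \<rho> E) =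
    (\<integral>\<^sup>+ w. (\<integral>\<^sup>+ y. ennreal (\<rho> (snd w)) * F w + ennreal (1 - \<rho> (snd w)) * F (fst w, y) \<partial>E) \<partial>Q)"
proof -
  interpret E: prob_space E by fact
  interpret B: sigma_finite_measure "count_space (UNIV :: bool set)"
    by (rule sigma_finite_measure_count_space_finite) simp
  interpret EB: pair_sigma_finite E "count_space (UNIV :: bool set)" ..
  note [measurable_cong] = Q E(2)
  have sQ: "sets Q = sets (borel \<Otimes>\<^sub>M borel)" by (subst borel_prod) (rule Q)
  note [measurable_cong] = sQ
  have T: "(\<lambda>(xz, y, b). (fst xz, if b then snd xz else y))
     \<in> Q \<Otimes>\<^sub>M (E \<Otimes>\<^sub>M count_space (UNIV :: bool set)) \<rightarrow>\<^sub>M (borel \<Otimes>\<^sub>M borel)"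
    by measurable
  then have [measurable]: "(\<lambda>(xz, y, b). (fst xz, if b then snd xz else y))
     \<in> Q \<Otimes>\<^sub>M (E \<Otimes>\<^sub>M count_space (UNIV :: bool set)) \<rightarrow>\<^sub>M borel"
    by (simp only: borel_prod)
  have [measurable]: "F \<in> borel_measurable (borel \<Otimes>\<^sub>M borel)"
    unfolding borel_prod by measurable
  have "(\<integral>\<^sup>+ w. F w \<partial>coupling_mixture Q \<rho> E) =
    (\<integral>\<^sup>+ w. (case w of (xz, y, b) \<Rightarrow> ennreal (if b then \<rho> (snd xz) else 1 - \<rho> (snd xz)) * F (fst xz, if b then snd xz else y))
      \<partial>(Q \<Otimes>\<^sub>M (E \<Otimes>\<^sub>M count_space UNIV)))"
    unfolding coupling_mixture_def
    by (subst nn_integral_distr, measurable, subst nn_integral_density, measurable)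
       (simp add: split_beta')
  also have "\<dots> = (\<integral>\<^sup>+ xz. (\<integral>\<^sup>+ yb. (case yb of (y, b) \<Rightarrow> ennreal (if b then \<rho> (snd xz) else 1 - \<rho> (snd xz)) * F (fst xz, if b then snd xz else y))
      \<partial>(E \<Otimes>\<^sub>M count_space UNIV)) \<partial>Q)"
    by (subst EB.nn_integral_fst[symmetric], measurable)
  also have "\<dots> = (\<integral>\<^sup>+ xz. (\<integral>\<^sup>+ y. (\<integral>\<^sup>+ b. ennreal (if b then \<rho> (snd xz) else 1 - \<rho> (snd xz)) * F (fst xz, if b then snd xz else y)
      \<partial>count_space UNIV) \<partial>E) \<partial>Q)"
    by (intro nn_integral_cong, subst B.nn_integral_fst[symmetric], measurable)
  also have "\<dots> = (\<integral>\<^sup>+ w. (\<integral>\<^sup>+ y. ennreal (\<rho> (snd w)) * F w + ennreal (1 - \<rho> (snd w)) * F (fst w, y) \<partial>E) \<partial>Q)"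
    by (simp add: nn_integral_count_space_finite UNIV_bool add.commute)
  finally show ?thesis .
qed

text \<open>Start from a coupling \<open>Q\<close> of the target with \<open>f\<close>. Keeping \<open>z\<close> with probability
\<open>min (f z) (g z) / f z\<close> retains the mass \<open>min f g\<close>; the remaining mass is redistributed according to
the normalised positive part of \<open>g - f\<close>, so the second marginal becomes \<open>g\<close>. The cost of moving
\<open>x\<close> to a replacement \<open>y\<close> is bounded through the detour over \<open>z\<close> and the origin; the discarded \<open>z\<close> and
the new \<open>y\<close> are distributed with densities \<open>(f - g)\<^sup>+\<close> and \<open>(g - f)\<^sup>+\<close>, which add up to \<open>|f - g|\<close>. Doing both moves in one coupling avoids the gluing lemma.\<close>

theorem exists_coupling_le:
  fixes Q :: "((real ^ 'd) \<times> (real ^ 'd)) measure" and f g :: "real ^ 'd \<Rightarrow> real"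
  assumes p: "p \<ge> 1"
    and Q: "prob_space Q" "sets Q = sets borel"
    and [measurable]: "f \<in> borel_measurable borel" "g \<in> borel_measurable borel"
    and f0: "\<And>z. f z \<ge> 0" and g0: "\<And>z. g z \<ge> 0"
    and snd_Q: "distr Q borel snd = density lborel (\<lambda>z. ennreal (f z))"
    and g1: "(\<integral>\<^sup>+ z. ennreal (g z) \<partial>lborel) = 1"
  shows "\<exists>\<pi> \<in> couplings (distr Q borel fst) (density lborel (\<lambda>z. ennreal (g z))).
    (\<integral>\<^sup>+ w. ennreal (norm (fst w - snd w) powr p) \<partial>\<pi>) \<le>
      ennreal (3 powr p) * ((\<integral>\<^sup>+ w. ennreal (norm (fst w - snd w) powr p) \<partial>Q)
        + (\<integral>\<^sup>+ z. ennreal (norm z powr p * \<bar>f z - g z\<bar>) \<partial>lborel))"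
proof -
  interpret Q: prob_space Q by fact
  have sQ: "sets Q = sets (borel \<Otimes>\<^sub>M borel)" by (subst borel_prod) (rule Q)
  note [measurable_cong] = sQ
  have Qsnd: "(\<integral>\<^sup>+ w. u (snd w) \<partial>Q) = (\<integral>\<^sup>+ z. ennreal (f z) * u z \<partial>lborel)"
    if [measurable]: "u \<in> borel_measurable borel" for u
  proof -
    have "(\<integral>\<^sup>+ w. u (snd w) \<partial>Q) = (\<integral>\<^sup>+ z. u z \<partial>distr Q borel snd)"
      by (subst nn_integral_distr) measurable
    also have "\<dots> = (\<integral>\<^sup>+ z. ennreal (f z) * u z \<partial>lborel)"
      unfolding snd_Q by (subst nn_integral_density) measurable
    finally show ?thesis .
  qed
  have f1: "(\<integral>\<^sup>+ z. ennreal (f z) \<partial>lborel) = 1"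
    using Qsnd[of "\<lambda>_. 1"] Q.emeasure_space_1 by simp
  let ?pos = "\<lambda>z. ennreal (g z - f z)"
  define \<delta> where "\<delta> = (\<integral>\<^sup>+ z. ?pos z \<partial>lborel)"
  define mn where "mn = (\<integral>\<^sup>+ z. ennreal (min (f z) (g z)) \<partial>lborel)"
  have "\<delta> + mn = (\<integral>\<^sup>+ z. ennreal (g z) \<partial>lborel)"
    unfolding \<delta>_def mn_def
    by (subst nn_integral_add[symmetric])
       (auto simp: ennreal_plus_if f0 g0 min_def intro!: nn_integral_cong)
  then have dg: "\<delta> + mn = 1" by (simp add: g1)
  have "(\<integral>\<^sup>+ z. ennreal (f z - g z) \<partial>lborel) + mn = (\<integral>\<^sup>+ z. ennreal (f z) \<partial>lborel)"
    unfolding mn_def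
    by (subst nn_integral_add[symmetric])
       (auto simp: ennreal_plus_if f0 g0 min_def intro!: nn_integral_cong)
  then have df: "(\<integral>\<^sup>+ z. ennreal (f z - g z) \<partial>lborel) + mn = 1" by (simp add: f1)
  have "mn \<noteq> \<infinity>" using dg by auto
  with dg df have \<delta>_eq: "(\<integral>\<^sup>+ z. ennreal (f z - g z) \<partial>lborel) = \<delta>"
    by (metis ennreal_add_left_cancel add.commute)
  have \<delta>_fin: "\<delta> \<noteq> \<infinity>" using dg by auto
  \<comment> \<open>If \<open>f\<close> and \<open>g\<close> agree almost everywhere, nothing is resampled and any density will do.\<close>
  define e where "e y = (if \<delta> = 0 then ennreal (g y) else ?pos y / \<delta>)" for y
  have [measurable]: "e \<in> borel_measurable borel" unfolding e_def[abs_def] by measurable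
  have e1: "(\<integral>\<^sup>+ y. e y \<partial>lborel) = 1"
  proof (cases "\<delta> = 0")
    case False
    then have "(\<integral>\<^sup>+ y. e y \<partial>lborel) = (\<integral>\<^sup>+ y. ?pos y \<partial>lborel) / \<delta>"
      unfolding e_def by (simp add: nn_integral_divide)
    then show ?thesis using False \<delta>_fin by (simp add: \<delta>_def[symmetric] ennreal_divide_self less_top)
  qed (simp add: e_def g1)
  have \<delta>e: "AE y in lborel. \<delta> * e y = ?pos y"
  proof (cases "\<delta> = 0")
    case True
    then have "AE y in lborel. ?pos y = 0"
      unfolding \<delta>_def by (subst (asm) nn_integral_0_iff_AE) auto
    then show ?thesis using True by auto
  next
    case False
    then have "\<delta> * (?pos y / \<delta>) = ?pos y" for y
      using ennreal_mult_divide_eq[of \<delta> "?pos y"] \<delta>_fin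
      by (simp only: ennreal_times_divide mult.commute[of \<delta>] infinity_ennreal_def not_False_eq_True simp_thms)
    then show ?thesis using False by (intro AE_I2) (simp only: e_def if_False)
  qed
  define E where "E = density lborel e"
  have E: "prob_space E" "sets E = sets borel"
    unfolding E_def by (rule prob_spaceI) (simp_all add: emeasure_density e1)
  interpret E: prob_space E by (rule E)
  note [measurable_cong] = E(2)
  define \<rho> where "\<rho> z = (if f z \<le> g z then 1 else g z / f z)" for z
  have [measurable]: "\<rho> \<in> borel_measurable borel" unfolding \<rho>_def[abs_def] by measurable
  have \<rho>01: "0 \<le> \<rho> z" "\<rho> z \<le> 1" for z using f0[of z] g0[of z] by (auto simp: \<rho>_def)
  have f\<rho>: "f z * \<rho> z = min (f z) (g z)" for z using g0[of z] by (auto simp: \<rho>_def min_def)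
  have f\<rho>': "ennreal (f z) * ennreal (1 - \<rho> z) = ennreal (f z - g z)" for z
  proof -
    have "f z * (1 - \<rho> z) = max 0 (f z - g z)" using f\<rho>[of z] by (simp add: right_diff_distrib max_def min_def)
    then show ?thesis using f0[of z] \<rho>01[of z] by (simp add: ennreal_mult[symmetric] max_def ennreal_neg)
  qed
  let ?\<pi> = "coupling_mixture Q \<rho> E"
  note mix = nn_integral_coupling_mixture[OF Q(2) E, of \<rho>]
  have fst_marg: "(\<integral>\<^sup>+ w. u (fst w) \<partial>?\<pi>) = (\<integral>\<^sup>+ w. u (fst w) \<partial>Q)"
    if [measurable]: "u \<in> borel_measurable borel" for u
  proof -
    have [measurable]: "(\<lambda>w. u (fst w)) \<in> borel_measurable (borel :: ((real ^ 'd) \<times> (real ^ 'd)) measure)"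
      unfolding borel_prod[symmetric] by measurable
    have "(\<integral>\<^sup>+ w. u (fst w) \<partial>?\<pi>) = (\<integral>\<^sup>+ w. (\<integral>\<^sup>+ y. u (fst w) \<partial>E) \<partial>Q)"
      using \<rho>01 by (subst mix) (auto simp: distrib_right[symmetric] ennreal_plus[symmetric] simp del: ennreal_plus)
    then show ?thesis by (simp add: E.emeasure_space_1)
  qed
  have split: "(\<integral>\<^sup>+ w. (\<integral>\<^sup>+ y. ennreal (\<rho> (snd w)) * F w + ennreal (1 - \<rho> (snd w)) * u y \<partial>E) \<partial>Q)
      = (\<integral>\<^sup>+ w. ennreal (\<rho> (snd w)) * F w \<partial>Q) + (\<integral>\<^sup>+ y. ?pos y * u y \<partial>lborel)"
    if [measurable]: "u \<in> borel_measurable borel" "F \<in> borel_measurable Q" for u F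
  proof -
    have "(\<integral>\<^sup>+ w. (\<integral>\<^sup>+ y. ennreal (\<rho> (snd w)) * F w + ennreal (1 - \<rho> (snd w)) * u y \<partial>E) \<partial>Q)
      = (\<integral>\<^sup>+ w. ennreal (\<rho> (snd w)) * F w + ennreal (1 - \<rho> (snd w)) * (\<integral>\<^sup>+ y. u y \<partial>E) \<partial>Q)"
      by (intro nn_integral_cong, subst nn_integral_add, simp, simp, subst nn_integral_cmult) (auto simp: E.emeasure_space_1)
    also have "\<dots> = (\<integral>\<^sup>+ w. ennreal (\<rho> (snd w)) * F w \<partial>Q) + (\<integral>\<^sup>+ w. ennreal (1 - \<rho> (snd w)) \<partial>Q) * (\<integral>\<^sup>+ y. u y \<partial>E)"
      by (subst nn_integral_add, simp, simp, subst nn_integral_multc) auto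
    also have "(\<integral>\<^sup>+ w. ennreal (1 - \<rho> (snd w)) \<partial>Q) = \<delta>"
      using Qsnd[of "\<lambda>z. ennreal (1 - \<rho> z)"] by (simp add: f\<rho>' \<delta>_eq)
    also have "\<delta> * (\<integral>\<^sup>+ y. u y \<partial>E) = (\<integral>\<^sup>+ y. \<delta> * e y * u y \<partial>lborel)"
      unfolding E_def by (simp add: nn_integral_density nn_integral_cmult[symmetric] mult.assoc)
    also have "\<dots> = (\<integral>\<^sup>+ y. ?pos y * u y \<partial>lborel)"
      using \<delta>e by (intro nn_integral_cong_AE) auto
    finally show ?thesis .
  qed
  have snd_marg: "(\<integral>\<^sup>+ w. u (snd w) \<partial>?\<pi>) = (\<integral>\<^sup>+ z. ennreal (g z) * u z \<partial>lborel)"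
    if [measurable]: "u \<in> borel_measurable borel" for u
  proof -
    have [measurable]: "(\<lambda>w. u (snd w)) \<in> borel_measurable (borel :: ((real ^ 'd) \<times> (real ^ 'd)) measure)"
      unfolding borel_prod[symmetric] by measurable
    have "(\<integral>\<^sup>+ w. u (snd w) \<partial>?\<pi>) = (\<integral>\<^sup>+ w. ennreal (\<rho> (snd w)) * u (snd w) \<partial>Q) + (\<integral>\<^sup>+ y. ?pos y * u y \<partial>lborel)"
      by (subst mix) (simp_all add: split)
    also have "(\<integral>\<^sup>+ w. ennreal (\<rho> (snd w)) * u (snd w) \<partial>Q) = (\<integral>\<^sup>+ z. ennreal (min (f z) (g z)) * u z \<partial>lborel)"
      using Qsnd[of "\<lambda>z. ennreal (\<rho> z) * u z"] f0 \<rho>01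
      by (simp add: f\<rho>[symmetric] ennreal_mult mult.assoc)
    also have "(\<integral>\<^sup>+ z. ennreal (min (f z) (g z)) * u z \<partial>lborel) + (\<integral>\<^sup>+ y. ?pos y * u y \<partial>lborel)
       = (\<integral>\<^sup>+ z. ennreal (min (f z) (g z)) * u z + ?pos z * u z \<partial>lborel)"
      by (rule nn_integral_add[symmetric]) measurable
    also have "\<dots> = (\<integral>\<^sup>+ z. ennreal (g z) * u z \<partial>lborel)"
      using f0 g0 by (intro nn_integral_cong) (auto simp: distrib_right[symmetric] ennreal_plus_if min_def)
    finally show ?thesis .
  qed
  have emeasure_distr_eq: "emeasure (distr R borel u) A = (\<integral>\<^sup>+ w. indicator A (u w) \<partial>R)"
    if "u \<in> R \<rightarrow>\<^sub>M borel" "A \<in> sets borel" for R :: "((real ^ 'd) \<times> (real ^ 'd)) measure" and u :: "_ \<Rightarrow> real ^ 'd" and A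
    using nn_integral_distr[OF that(1), of "indicator A"] that(2) by simp
  have "prob_space ?\<pi>"
    using fst_marg[of "\<lambda>_. 1"] Q.emeasure_space_1 by (intro prob_spaceI) simp
  moreover have "distr ?\<pi> borel fst = distr Q borel fst"
  proof (rule measure_eqI)
    fix A assume "A \<in> sets (distr ?\<pi> borel fst)"
    then have [measurable]: "A \<in> sets borel" by simp
    have m: "fst \<in> ?\<pi> \<rightarrow>\<^sub>M borel" "fst \<in> Q \<rightarrow>\<^sub>M borel"
      unfolding measurable_cong_sets[OF sets_coupling_mixture refl] borel_prod[symmetric] by measurable
    show "emeasure (distr ?\<pi> borel fst) A = emeasure (distr Q borel fst) A"
      unfolding emeasure_distr_eq[OF m(1) \<open>A \<in> sets borel\<close>] emeasure_distr_eq[OF m(2) \<open>A \<in> sets borel\<close>]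
      by (rule fst_marg) simp
  qed simp
  moreover have "distr ?\<pi> borel snd = density lborel (\<lambda>z. ennreal (g z))"
  proof (rule measure_eqI)
    fix A assume "A \<in> sets (distr ?\<pi> borel snd)"
    then have [measurable]: "A \<in> sets borel" by simp
    have m: "snd \<in> ?\<pi> \<rightarrow>\<^sub>M borel"
      unfolding measurable_cong_sets[OF sets_coupling_mixture refl] borel_prod[symmetric] by measurable
    have "emeasure (distr ?\<pi> borel snd) A = (\<integral>\<^sup>+ w. indicator A (snd w) \<partial>?\<pi>)"
      by (rule emeasure_distr_eq[OF m \<open>A \<in> sets borel\<close>])
    also have "\<dots> = emeasure (density lborel (\<lambda>z. ennreal (g z))) A"
      by (subst snd_marg) (auto simp: emeasure_density)
    finally show "emeasure (distr ?\<pi> borel snd) A = emeasure (density lborel (\<lambda>z. ennreal (g z))) A" .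
  qed simp
  ultimately have "?\<pi> \<in> couplings (distr Q borel fst) (density lborel (\<lambda>z. ennreal (g z)))"
    by (simp add: couplings_def)
  moreover have "(\<integral>\<^sup>+ w. ennreal (norm (fst w - snd w) powr p) \<partial>?\<pi>) \<le>
      ennreal (3 powr p) * ((\<integral>\<^sup>+ w. ennreal (norm (fst w - snd w) powr p) \<partial>Q)
        + (\<integral>\<^sup>+ z. ennreal (norm z powr p * \<bar>f z - g z\<bar>) \<partial>lborel))"
  proof -
    let ?N = "\<lambda>z. norm z powr p"
    let ?c = "3 powr p"
    have c1: "1 \<le> ?c" using p by (intro ge_one_powr_ge_zero) auto
    let ?F = "\<lambda>w. ennreal (?c * ?N (fst w - snd w)) + ennreal (1 - \<rho> (snd w)) * ennreal (?c * ?N (snd w))"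
    have mF[measurable]: "(\<lambda>w. ennreal (norm (fst w - snd w) powr p)) \<in> borel_measurable (borel :: ((real ^ 'd) \<times> (real ^ 'd)) measure)"
    proof -
      have "(\<lambda>w. norm (fst w - snd w)) \<in> borel_measurable (borel :: ((real ^ 'd) \<times> (real ^ 'd)) measure)"
        by (intro borel_measurable_continuous_onI continuous_intros)
      from measurable_compose[OF this, of "\<lambda>t. ennreal (t powr p)" borel] show ?thesis by simp
    qed
    have "(\<integral>\<^sup>+ w. ennreal (?N (fst w - snd w)) \<partial>?\<pi>) =
       (\<integral>\<^sup>+ w. (\<integral>\<^sup>+ y. ennreal (\<rho> (snd w)) * ennreal (?N (fst w - snd w)) + ennreal (1 - \<rho> (snd w)) * ennreal (?N (fst w - y)) \<partial>E) \<partial>Q)"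
      by (subst mix[OF _ mF]) simp_all
    also have "\<dots> \<le> (\<integral>\<^sup>+ w. (\<integral>\<^sup>+ y. ?F w + ennreal (1 - \<rho> (snd w)) * ennreal (?c * ?N y) \<partial>E) \<partial>Q)"
    proof (intro nn_integral_mono)
      fix w :: "(real ^ 'd) \<times> (real ^ 'd)" and y :: "real ^ 'd"
      let ?r = "\<rho> (snd w)"
      have "?r * ?N (fst w - snd w) \<le> ?r * (?c * ?N (fst w - snd w))"
        using \<rho>01[of "snd w"] c1 by (intro mult_left_mono) (auto simp: mult_le_cancel_right1)
      moreover have "(1 - ?r) * ?N (fst w - y) \<le> (1 - ?r) * (?c * (?N (fst w - snd w) + ?N (snd w) + ?N y))"
        using \<rho>01[of "snd w"] by (intro mult_left_mono norm_diff_powr_le p) auto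
      ultimately have "?r * ?N (fst w - snd w) + (1 - ?r) * ?N (fst w - y) \<le>
         ?c * ?N (fst w - snd w) + (1 - ?r) * (?c * ?N (snd w)) + (1 - ?r) * (?c * ?N y)"
        by (simp add: algebra_simps)
      then show "ennreal ?r * ennreal (?N (fst w - snd w)) + ennreal (1 - ?r) * ennreal (?N (fst w - y))
         \<le> ?F w + ennreal (1 - ?r) * ennreal (?c * ?N y)"
        using \<rho>01[of "snd w"] by (simp add: ennreal_mult[symmetric] ennreal_plus[symmetric] del: ennreal_plus)
    qed
    also have "\<dots> = (\<integral>\<^sup>+ w. ?F w \<partial>Q) + (\<integral>\<^sup>+ y. ?pos y * ennreal (?c * ?N y) \<partial>lborel)"
    proof -
      have "(\<integral>\<^sup>+ w. (\<integral>\<^sup>+ y. ?F w + ennreal (1 - \<rho> (snd w)) * ennreal (?c * ?N y) \<partial>E) \<partial>Q)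
        = (\<integral>\<^sup>+ w. ?F w + ennreal (1 - \<rho> (snd w)) * (\<integral>\<^sup>+ y. ennreal (?c * ?N y) \<partial>E) \<partial>Q)"
        by (intro nn_integral_cong, subst nn_integral_add, simp, simp, subst nn_integral_cmult) (auto simp: E.emeasure_space_1)
      also have "\<dots> = (\<integral>\<^sup>+ w. ?F w \<partial>Q) + (\<integral>\<^sup>+ w. ennreal (1 - \<rho> (snd w)) \<partial>Q) * (\<integral>\<^sup>+ y. ennreal (?c * ?N y) \<partial>E)"
        by (subst nn_integral_add, measurable, subst nn_integral_multc) auto
      also have "(\<integral>\<^sup>+ w. ennreal (1 - \<rho> (snd w)) \<partial>Q) = \<delta>"
        using Qsnd[of "\<lambda>z. ennreal (1 - \<rho> z)"] by (simp add: f\<rho>' \<delta>_eq)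
      also have "\<delta> * (\<integral>\<^sup>+ y. ennreal (?c * ?N y) \<partial>E) = (\<integral>\<^sup>+ y. \<delta> * e y * ennreal (?c * ?N y) \<partial>lborel)"
        unfolding E_def by (simp add: nn_integral_density nn_integral_cmult[symmetric] mult.assoc)
      also have "\<dots> = (\<integral>\<^sup>+ y. ?pos y * ennreal (?c * ?N y) \<partial>lborel)"
        using \<delta>e by (intro nn_integral_cong_AE) auto
      finally show ?thesis .
    qed
    also have "(\<integral>\<^sup>+ w. ?F w \<partial>Q) = (\<integral>\<^sup>+ w. ennreal (?c * ?N (fst w - snd w)) \<partial>Q) + (\<integral>\<^sup>+ w. ennreal (1 - \<rho> (snd w)) * ennreal (?c * ?N (snd w)) \<partial>Q)"
      by (rule nn_integral_add) measurable
    also have "(\<integral>\<^sup>+ w. ennreal (1 - \<rho> (snd w)) * ennreal (?c * ?N (snd w)) \<partial>Q) = (\<integral>\<^sup>+ z. ennreal (f z - g z) * ennreal (?c * ?N z) \<partial>lborel)"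
      using Qsnd[of "\<lambda>z. ennreal (1 - \<rho> z) * ennreal (?c * ?N z)"] by (simp add: mult.assoc[symmetric] f\<rho>')
    also have "(\<integral>\<^sup>+ w. ennreal (?c * ?N (fst w - snd w)) \<partial>Q) = ennreal ?c * (\<integral>\<^sup>+ w. ennreal (?N (fst w - snd w)) \<partial>Q)"
      by (subst nn_integral_cmult[symmetric]) (auto simp: ennreal_mult[symmetric])
    also have "ennreal ?c * (\<integral>\<^sup>+ w. ennreal (?N (fst w - snd w)) \<partial>Q) + (\<integral>\<^sup>+ z. ennreal (f z - g z) * ennreal (?c * ?N z) \<partial>lborel)
        + (\<integral>\<^sup>+ y. ?pos y * ennreal (?c * ?N y) \<partial>lborel)
      = ennreal ?c * (\<integral>\<^sup>+ w. ennreal (?N (fst w - snd w)) \<partial>Q)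
        + (\<integral>\<^sup>+ z. ennreal (f z - g z) * ennreal (?c * ?N z) + ?pos z * ennreal (?c * ?N z) \<partial>lborel)"
      by (subst nn_integral_add) (simp_all add: add.assoc)
    also have "(\<integral>\<^sup>+ z. ennreal (f z - g z) * ennreal (?c * ?N z) + ?pos z * ennreal (?c * ?N z) \<partial>lborel)
      = (\<integral>\<^sup>+ z. ennreal ?c * ennreal (?N z * \<bar>f z - g z\<bar>) \<partial>lborel)"
    proof (rule nn_integral_cong)
      fix z
      have "ennreal (f z - g z) + ennreal (g z - f z) = ennreal \<bar>f z - g z\<bar>"
        by (cases "f z \<le> g z") (auto simp: ennreal_neg)
      then have "ennreal (f z - g z) * ennreal (?c * ?N z) + ?pos z * ennreal (?c * ?N z) = ennreal \<bar>f z - g z\<bar> * ennreal (?c * ?N z)"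
        by (simp only: distrib_right[symmetric])
      also have "\<dots> = ennreal ?c * ennreal (?N z * \<bar>f z - g z\<bar>)"
        by (simp add: ennreal_mult[symmetric] mult_ac)
      finally show "ennreal (f z - g z) * ennreal (?c * ?N z) + ?pos z * ennreal (?c * ?N z) = ennreal ?c * ennreal (?N z * \<bar>f z - g z\<bar>)" .
    qed
    also have "\<dots> = ennreal ?c * (\<integral>\<^sup>+ z. ennreal (?N z * \<bar>f z - g z\<bar>) \<partial>lborel)"
      by (rule nn_integral_cmult) measurable
    finally show ?thesis by (simp only: distrib_left)
  qed
  ultimately show ?thesis by blast
qed

section \<open>Product laws and independent samples\<close>

lemma borel_measurable_vec_nth [measurable]: "(\<lambda>x :: real ^ 'd. x $ j) \<in> borel_measurable borel"
  by (intro borel_measurable_continuous_onI continuous_on_component continuous_on_id)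

lemma measurable_vec_lambda:
  assumes "\<And>j. sets (N j) = sets (borel :: real measure)"
  shows "(\<lambda>x. \<chi> j. x j) \<in> Pi\<^sub>M UNIV N \<rightarrow>\<^sub>M (borel :: (real ^ 'd) measure)"
proof -
  have "(\<lambda>x. x j) \<in> borel_measurable (Pi\<^sub>M UNIV N)" for j
    using measurable_component_singleton[of j UNIV N] unfolding measurable_cong_sets[OF refl assms[of j]] by simp
  then show ?thesis
    unfolding borel_measurable_euclidean_space[of "\<lambda>x. \<chi> j. x j"]
    by (auto simp: Basis_vec_def inner_axis)
qed

text \<open>With this, Lebesgue measure and the law of the noise are instances of the same product
construction and share the factorisation lemmas below.\<close>

lemma lborel_eq_product_law: "(lborel :: (real ^ 'd) measure) = product_law (\<lambda>_. lborel)"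
proof (rule lborel_eqI)
  interpret product_sigma_finite "\<lambda>_ :: 'd. lborel :: real measure" ..
  have [measurable]: "(\<lambda>x. \<chi> j. x j) \<in> Pi\<^sub>M UNIV (\<lambda>_. lborel) \<rightarrow>\<^sub>M (borel :: (real ^ 'd) measure)"
    by (rule measurable_vec_lambda) simp
  show "sets (product_law (\<lambda>_ :: 'd. lborel)) = sets borel" by (simp add: product_law_def)
  fix l u :: "real ^ 'd" assume "\<And>b. b \<in> Basis \<Longrightarrow> l \<bullet> b \<le> u \<bullet> b"
  then have le: "l $ j \<le> u $ j" for j
    by (metis axis_in_Basis_iff inner_axis inner_real_def mult.right_neutral Basis_real_def singletonI real_inner_1_right)
  have box: "(\<lambda>x. \<chi> j. x j) -` box l u \<inter> space (Pi\<^sub>M UNIV (\<lambda>_ :: 'd. lborel)) = (\<Pi>\<^sub>E j\<in>UNIV. {l $ j <..< u $ j})"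
    by (auto simp: mem_box_cart space_PiM PiE_def Pi_def)
  have "emeasure (product_law (\<lambda>_ :: 'd. lborel)) (box l u) = (\<Prod>j\<in>UNIV. emeasure lborel {l $ j <..< u $ j})"
    unfolding product_law_def
    by (subst emeasure_distr, measurable, subst box, subst emeasure_PiM) auto
  also have "\<dots> = ennreal (\<Prod>j\<in>UNIV. u $ j - l $ j)"
    using le by (subst prod_ennreal[symmetric]) auto
  also have "(\<Prod>j\<in>UNIV. u $ j - l $ j) = (\<Prod>b\<in>Basis. (u - l) \<bullet> b)"
  proof -
    have B: "(Basis :: (real ^ 'd) set) = (\<lambda>j. axis j 1) ` UNIV" by (auto simp: Basis_vec_def)
    have inj: "inj_on (\<lambda>j :: 'd. axis j (1 :: real)) UNIV" by (auto simp: inj_on_def axis_eq_axis)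
    have "(\<Prod>b\<in>Basis. (u - l) \<bullet> b) = (\<Prod>j\<in>UNIV. (u - l) \<bullet> axis j 1)"
      unfolding B prod.reindex[OF inj] by (simp only: o_def)
    then show ?thesis by (simp add: inner_axis)
  qed
  finally show "emeasure (product_law (\<lambda>_ :: 'd. lborel)) (box l u) = ennreal (\<Prod>b\<in>Basis. (u - l) \<bullet> b)" .
qed

locale product_measure = product_sigma_finite N for N :: "'d::finite \<Rightarrow> real measure" +
  assumes sets_N: "\<And>j. sets (N j) = sets borel"
begin

lemmas vec_lambda_measurable [measurable] = measurable_vec_lambda[OF sets_N]

lemma sets_product_law [simp, measurable_cong]: "sets (product_law N) = sets borel"
  by (simp add: product_law_def)

lemma coord_measurable: "f \<in> borel_measurable borel \<Longrightarrow> f \<in> borel_measurable (N j)"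
  using measurable_cong_sets[OF sets_N refl] by blast

lemma nn_integral_product_law_prod:
  assumes [measurable]: "\<And>j. f j \<in> borel_measurable borel"
  shows "(\<integral>\<^sup>+ x. (\<Prod>j\<in>UNIV. f j (x $ j)) \<partial>product_law N) = (\<Prod>j\<in>UNIV. \<integral>\<^sup>+ t. f j t \<partial>N j)"
proof -
  have "(\<integral>\<^sup>+ x. (\<Prod>j\<in>UNIV. f j (x $ j)) \<partial>product_law N) = (\<integral>\<^sup>+ x. (\<Prod>j\<in>UNIV. f j (x j)) \<partial>Pi\<^sub>M UNIV N)"
    unfolding product_law_def by (subst nn_integral_distr) (auto intro: vec_lambda_measurable)
  also have "\<dots> = (\<Prod>j\<in>UNIV. \<integral>\<^sup>+ t. f j t \<partial>N j)"
    by (rule product_nn_integral_prod) (auto intro: coord_measurable)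
  finally show ?thesis .
qed

lemma
  fixes f :: "'d \<Rightarrow> real \<Rightarrow> real"
  assumes [measurable]: "\<And>j. f j \<in> borel_measurable borel" and int: "\<And>j. integrable (N j) (f j)"
  shows integral_product_law_prod: "(\<integral>x. (\<Prod>j\<in>UNIV. f j (x $ j)) \<partial>product_law N) = (\<Prod>j\<in>UNIV. \<integral>t. f j t \<partial>N j)"
    and integrable_product_law_prod: "integrable (product_law N) (\<lambda>x. \<Prod>j\<in>UNIV. f j (x $ j))"
proof -
  have [measurable]: "(\<lambda>x. \<Prod>j\<in>UNIV. f j (x $ j)) \<in> borel_measurable (borel :: (real ^ 'd) measure)"
    by measurable
  have "(\<integral>x. (\<Prod>j\<in>UNIV. f j (x $ j)) \<partial>product_law N) = (\<integral>x. (\<Prod>j\<in>UNIV. f j (x j)) \<partial>Pi\<^sub>M UNIV N)"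
    unfolding product_law_def by (subst integral_distr) (auto intro: vec_lambda_measurable)
  also have "\<dots> = (\<Prod>j\<in>UNIV. \<integral>t. f j t \<partial>N j)"
    by (rule product_integral_prod) (auto intro: int)
  finally show "(\<integral>x. (\<Prod>j\<in>UNIV. f j (x $ j)) \<partial>product_law N) = (\<Prod>j\<in>UNIV. \<integral>t. f j t \<partial>N j)" .
  have "integrable (Pi\<^sub>M UNIV N) (\<lambda>x. \<Prod>j\<in>UNIV. f j (x j))"
    by (rule product_integrable_prod) (auto intro: int)
  then show "integrable (product_law N) (\<lambda>x. \<Prod>j\<in>UNIV. f j (x $ j))"
    unfolding product_law_def by (subst integrable_distr_eq) (auto intro: vec_lambda_measurable)
qed

end

interpretation lborel_product: product_measure "\<lambda>_ :: 'd::finite. lborel :: real measure"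
  by unfold_locales simp

lemmas nn_integral_lborel_vec_prod = lborel_product.nn_integral_product_law_prod[folded lborel_eq_product_law]
lemmas integral_lborel_vec_prod = lborel_product.integral_product_law_prod[folded lborel_eq_product_law]
lemmas integrable_lborel_vec_prod = lborel_product.integrable_product_law_prod[folded lborel_eq_product_law]

lemma (in product_measure) prob_space_product_law:
  assumes "\<And>j. prob_space (N j)"
  shows "prob_space (product_law N)"
  unfolding product_law_def
  using prob_space_PiM[of UNIV N] assms by (intro prob_space.prob_space_distr vec_lambda_measurable) auto

lemma one_plus_abs_add_le: "1 + \<bar>x + y\<bar> \<le> (1 + \<bar>x\<bar>) * (1 + \<bar>y :: real\<bar>)"
proof -
  have "0 \<le> \<bar>x\<bar> * \<bar>y\<bar>" by simp
  moreover have "(1 + \<bar>x\<bar>) * (1 + \<bar>y\<bar>) = 1 + \<bar>x\<bar> + \<bar>y\<bar> + \<bar>x\<bar> * \<bar>y\<bar>" by (simp add: algebra_simps)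
  ultimately show ?thesis using abs_triangle_ineq[of x y] by linarith
qed

text \<open>Expand the square of the centred sum: by independence the mixed terms integrate to 0, and the
variance is at most the second moment.\<close>

lemma iid_mean_square_le:
  fixes \<xi> :: "'a \<Rightarrow> real"
  assumes L: "prob_space L" and [measurable]: "\<xi> \<in> borel_measurable L"
    and bnd: "\<And>y. \<bar>\<xi> y\<bar> \<le> B" and n: "n > 0"
  shows "(\<integral>\<^sup>+ Y. ennreal ((1 / real n * (\<Sum>i<n. \<xi> (Y i)) - (\<integral>y. \<xi> y \<partial>L))\<^sup>2) \<partial>Pi\<^sub>M {..<n} (\<lambda>_. L))
    \<le> ennreal (1 / real n) * (\<integral>\<^sup>+ y. ennreal ((\<xi> y)\<^sup>2) \<partial>L)"
proof -
  interpret L: prob_space L by fact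
  interpret product_prob_space "\<lambda>_ :: nat. L" "{..<n}" ..
  let ?P = "Pi\<^sub>M {..<n} (\<lambda>_. L)"
  interpret P: prob_space ?P by (intro prob_space_PiM L)
  define c where "c = (\<integral>y. \<xi> y \<partial>L)"
  define \<eta> where "\<eta> y = \<xi> y - c" for y
  have [measurable]: "\<eta> \<in> borel_measurable L" unfolding \<eta>_def[abs_def] by measurable
  have int: "integrable L \<xi>" by (rule L.integrable_const_bound[where B = B]) (auto simp: bnd)
  have int2: "integrable L (\<lambda>y. (\<xi> y)\<^sup>2)"
  proof (rule L.integrable_const_bound[where B = "B\<^sup>2"])
    show "AE y in L. norm ((\<xi> y)\<^sup>2) \<le> B\<^sup>2"
      using bnd by (intro AE_I2) (simp add: abs_le_square_iff[symmetric] order_trans[OF _ abs_ge_self])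
  qed measurable
  have \<eta>1: "integrable L \<eta>" "(\<integral>y. \<eta> y \<partial>L) = 0"
    using int by (simp_all add: \<eta>_def[abs_def] c_def L.prob_space)
  have eq2: "(\<eta> y)\<^sup>2 = (\<xi> y)\<^sup>2 - (2 * c) * \<xi> y + c\<^sup>2" for y by (simp add: \<eta>_def power2_diff)
  have \<eta>2: "integrable L (\<lambda>y. (\<eta> y)\<^sup>2)"
    unfolding eq2 using int int2 by simp
  have "(\<integral>y. (\<eta> y)\<^sup>2 \<partial>L) = (\<integral>y. (\<xi> y)\<^sup>2 \<partial>L) - c\<^sup>2"
    unfolding eq2 using int int2 by (simp add: L.prob_space c_def[symmetric] power2_eq_square)
  then have var: "(\<integral>y. (\<eta> y)\<^sup>2 \<partial>L) \<le> (\<integral>y. (\<xi> y)\<^sup>2 \<partial>L)" by simp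
  have cross: "integrable ?P (\<lambda>Y. \<eta> (Y i) * \<eta> (Y j))"
      "(\<integral>Y. \<eta> (Y i) * \<eta> (Y j) \<partial>?P) = (if i = j then (\<integral>y. (\<eta> y)\<^sup>2 \<partial>L) else 0)"
    if ij: "i < n" "j < n" for i j
  proof -
    \<comment> \<open>A product over all observations, so that the factorisation lemma applies also for \<open>i = j\<close>.\<close>
    define g where "g l y = (if l = i then \<eta> y else 1) * (if l = j then \<eta> y else 1)" for l y
    have gi: "integrable L (g l)" for l
      unfolding g_def[abs_def] using \<eta>1 \<eta>2 by (cases "l = i"; cases "l = j") (auto simp: power2_eq_square)
    have eq: "(\<Prod>l<n. g l (Y l)) = \<eta> (Y i) * \<eta> (Y j)" for Y
      using ij by (simp add: g_def prod.distrib prod.delta)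
    show "integrable ?P (\<lambda>Y. \<eta> (Y i) * \<eta> (Y j))"
      using product_integrable_prod[of "{..<n}" g] gi by (simp add: eq)
    have "(\<integral>Y. \<eta> (Y i) * \<eta> (Y j) \<partial>?P) = (\<Prod>l<n. \<integral>y. g l y \<partial>L)"
      using product_integral_prod[of "{..<n}" g] gi by (simp add: eq)
    also have "\<dots> = (if i = j then (\<integral>y. (\<eta> y)\<^sup>2 \<partial>L) else 0)"
    proof (cases "i = j")
      case True
      have "(\<integral>y. g l y \<partial>L) = (if l = i then (\<integral>y. (\<eta> y)\<^sup>2 \<partial>L) else 1)" for l
        using True by (simp add: g_def power2_eq_square L.prob_space)
      then show ?thesis using True ij by (simp add: prod.delta)
    next
      case False
      then have "(\<integral>y. g i y \<partial>L) = 0" using \<eta>1 by (simp add: g_def)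
      then have "(\<Prod>l<n. \<integral>y. g l y \<partial>L) = 0" using ij by (intro prod_zero) auto
      then show ?thesis using False by simp
    qed
    finally show "(\<integral>Y. \<eta> (Y i) * \<eta> (Y j) \<partial>?P) = (if i = j then (\<integral>y. (\<eta> y)\<^sup>2 \<partial>L) else 0)" .
  qed
  have sq: "(1 / real n * (\<Sum>i<n. \<xi> (Y i)) - c)\<^sup>2 = (1 / real n)\<^sup>2 * (\<Sum>i<n. \<Sum>j<n. \<eta> (Y i) * \<eta> (Y j))" for Y
  proof -
    have "1 / real n * (\<Sum>i<n. \<xi> (Y i)) - c = 1 / real n * (\<Sum>i<n. \<eta> (Y i))"
      using n by (simp add: \<eta>_def sum_subtractf field_simps)
    then show ?thesis by (simp only: power_mult_distrib power2_eq_square[of "\<Sum>i<n. \<eta> (Y i)"] sum_product)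
  qed
  have "(\<integral>\<^sup>+ Y. ennreal ((1 / real n * (\<Sum>i<n. \<xi> (Y i)) - c)\<^sup>2) \<partial>?P)
     = ennreal (\<integral>Y. (1 / real n * (\<Sum>i<n. \<xi> (Y i)) - c)\<^sup>2 \<partial>?P)"
  proof (rule nn_integral_eq_integral)
    show "integrable ?P (\<lambda>Y. (1 / real n * (\<Sum>i<n. \<xi> (Y i)) - c)\<^sup>2)"
      unfolding sq by (intro integrable_mult_right Bochner_Integration.integrable_sum cross) auto
  qed simp
  also have "(\<integral>Y. (1 / real n * (\<Sum>i<n. \<xi> (Y i)) - c)\<^sup>2 \<partial>?P) = (1 / real n)\<^sup>2 * (\<Sum>i<n. \<Sum>j<n. \<integral>Y. \<eta> (Y i) * \<eta> (Y j) \<partial>?P)"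
  proof -
    have "(\<integral>Y. (\<Sum>i<n. \<Sum>j<n. \<eta> (Y i) * \<eta> (Y j)) \<partial>?P) = (\<Sum>i<n. \<integral>Y. (\<Sum>j<n. \<eta> (Y i) * \<eta> (Y j)) \<partial>?P)"
      by (intro Bochner_Integration.integral_sum Bochner_Integration.integrable_sum cross) auto
    also have "\<dots> = (\<Sum>i<n. \<Sum>j<n. \<integral>Y. \<eta> (Y i) * \<eta> (Y j) \<partial>?P)"
      by (intro sum.cong refl Bochner_Integration.integral_sum cross) auto
    finally show ?thesis unfolding sq integral_mult_right_zero by (simp only:)
  qed
  also have "(\<Sum>i<n. \<Sum>j<n. \<integral>Y. \<eta> (Y i) * \<eta> (Y j) \<partial>?P) = (\<Sum>i<n. \<Sum>j<n. if i = j then (\<integral>y. (\<eta> y)\<^sup>2 \<partial>L) else 0)"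
    by (intro sum.cong refl cross) auto
  also have "\<dots> = real n * (\<integral>y. (\<eta> y)\<^sup>2 \<partial>L)" by simp
  also have "(1 / real n)\<^sup>2 * (real n * (\<integral>y. (\<eta> y)\<^sup>2 \<partial>L)) = 1 / real n * (\<integral>y. (\<eta> y)\<^sup>2 \<partial>L)"
    using n by (simp add: power2_eq_square)
  also have "ennreal \<dots> \<le> ennreal (1 / real n * (\<integral>y. (\<xi> y)\<^sup>2 \<partial>L))"
    using var by (intro ennreal_leI mult_left_mono) auto
  also have "\<dots> = ennreal (1 / real n) * (\<integral>\<^sup>+ y. ennreal ((\<xi> y)\<^sup>2) \<partial>L)"
  proof -
    have "(\<integral>\<^sup>+ y. ennreal ((\<xi> y)\<^sup>2) \<partial>L) = ennreal (\<integral>y. (\<xi> y)\<^sup>2 \<partial>L)"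
      using int2 by (intro nn_integral_eq_integral) auto
    moreover have "ennreal (1 / real n * (\<integral>y. (\<xi> y)\<^sup>2 \<partial>L)) = ennreal (1 / real n) * ennreal (\<integral>y. (\<xi> y)\<^sup>2 \<partial>L)"
      by (intro ennreal_mult integral_nonneg_AE) auto
    ultimately show ?thesis by (simp only:)
  qed
  finally show ?thesis by (simp only: c_def)
qed

section \<open>Unbiased product kernel estimators\<close>

lemma nn_integral_lborel_shift:
  fixes g :: "'a::euclidean_space \<Rightarrow> ennreal"
  assumes [measurable]: "g \<in> borel_measurable borel"
  shows "(\<integral>\<^sup>+ w. g (x + w) \<partial>lborel) = (\<integral>\<^sup>+ z. g z \<partial>lborel)"
proof -
  have "(\<integral>\<^sup>+ z. g z \<partial>lborel) = (\<integral>\<^sup>+ z. g z \<partial>distr lborel borel ((+) x))"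
    by (simp only: lborel_distr_plus)
  also have "\<dots> = (\<integral>\<^sup>+ w. g (x + w) \<partial>lborel)"
    by (rule nn_integral_distr) measurable
  finally show ?thesis by simp
qed

lemma norm_vec_powr_le:
  fixes z :: "real ^ 'd"
  assumes p: "p \<ge> 0"
  shows "norm z powr p \<le> real CARD('d) powr p * (\<Sum>j\<in>UNIV. \<bar>z $ j\<bar> powr p)"
proof -
  define mx where "mx = Max (range (\<lambda>j. \<bar>z $ j\<bar>))"
  have "mx \<in> range (\<lambda>j. \<bar>z $ j\<bar>)" unfolding mx_def by (rule Max_in) auto
  then obtain j0 where j0: "mx = \<bar>z $ j0\<bar>" by auto
  have le: "\<bar>z $ j\<bar> \<le> mx" for j unfolding mx_def by (rule Max_ge) auto
  have "norm z \<le> (\<Sum>j\<in>UNIV. \<bar>z $ j\<bar>)" by (rule norm_le_l1_cart)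
  also have "\<dots> \<le> real CARD('d) * mx" using le by (intro sum_bounded_above) auto
  finally have "norm z powr p \<le> (real CARD('d) * mx) powr p" using p by (intro powr_mono2) auto
  also have "\<dots> = real CARD('d) powr p * \<bar>z $ j0\<bar> powr p" unfolding j0 by (rule powr_mult)
  also have "\<bar>z $ j0\<bar> powr p \<le> (\<Sum>j\<in>UNIV. \<bar>z $ j\<bar> powr p)"
    by (rule member_le_sum[of j0 UNIV "\<lambda>j. \<bar>z $ j\<bar> powr p"]) auto
  finally show ?thesis by (simp add: mult_left_mono)
qed

text \<open>Because \<open>F\<close> integrates to 1, its positive part integrates to some \<open>I \<ge> 1\<close>, and
\<open>I - 1\<close> is at most the \<open>L\<^sup>1\<close> distance between \<open>F\<close> and \<open>f\<close>. Taking the positive part does not increase the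
distance to \<open>f \<ge> 0\<close>, and dividing by \<open>I\<close> changes it by \<open>(1 - 1/I)\<close> times itself, which is at most
\<open>(I - 1) f + |F - f|\<close>.\<close>

lemma positive_part_normalisation_le:
  fixes f F :: "'a::euclidean_space \<Rightarrow> real"
  assumes [measurable]: "f \<in> borel_measurable borel" "N \<in> borel_measurable borel"
    and f0: "\<And>z. f z \<ge> 0" and f1: "(\<integral>\<^sup>+ z. ennreal (f z) \<partial>lborel) = 1"
    and F: "integrable lborel F" and F1: "(LINT z|lborel. F z) = 1" and N0: "\<And>z. N z \<ge> 0"
  defines "I \<equiv> (LINT z|lborel. max 0 (F z))"
  shows "(\<integral>\<^sup>+ z. ennreal (1 / I * max 0 (F z)) \<partial>lborel) = 1"
    and "(\<integral>\<^sup>+ z. ennreal (N z * \<bar>f z - 1 / I * max 0 (F z)\<bar>) \<partial>lborel)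
      \<le> (2 + (\<integral>\<^sup>+ z. ennreal (N z * f z) \<partial>lborel)) * (\<integral>\<^sup>+ z. ennreal ((1 + N z) * \<bar>F z - f z\<bar>) \<partial>lborel)"
proof -
  have [measurable]: "F \<in> borel_measurable borel" using F by simp
  define P where "P z = max 0 (F z)" for z
  have P0: "0 \<le> P z" and PF: "F z \<le> P z" for z by (simp_all add: P_def)
  have [measurable]: "P \<in> borel_measurable borel" unfolding P_def[abs_def] by measurable
  have P: "integrable lborel P" unfolding P_def[abs_def] using F by (intro integrable_max) auto
  have I_eq: "I = (LINT z|lborel. P z)" by (simp add: I_def P_def)
  have "1 \<le> I"
    unfolding F1[symmetric] I_eq by (intro integral_mono F P PF)
  then have I: "1 \<le> I" "0 < I" by auto
  have nnI: "(\<integral>\<^sup>+ z. ennreal (P z) \<partial>lborel) = ennreal I"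
    unfolding I_eq using P P0 by (intro nn_integral_eq_integral) auto
  have "(\<integral>\<^sup>+ z. ennreal (1 / I * P z) \<partial>lborel) = (\<integral>\<^sup>+ z. ennreal (1 / I) * ennreal (P z) \<partial>lborel)"
    using I P0 by (intro nn_integral_cong ennreal_mult) auto
  also have "\<dots> = ennreal (1 / I) * ennreal I"
    unfolding nnI[symmetric] by (rule nn_integral_cmult) measurable
  also have "\<dots> = 1" using I by (simp add: ennreal_mult[symmetric])
  finally show "(\<integral>\<^sup>+ z. ennreal (1 / I * max 0 (F z)) \<partial>lborel) = 1" by (simp only: P_def)
  let ?D = "\<lambda>z. \<bar>F z - f z\<bar>"
  define D0 where "D0 = (\<integral>\<^sup>+ z. ennreal (?D z) \<partial>lborel)"
  define Dp where "Dp = (\<integral>\<^sup>+ z. ennreal (N z * ?D z) \<partial>lborel)"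
  define B where "B = (\<integral>\<^sup>+ z. ennreal (N z * f z) \<partial>lborel)"
  have Dsum: "D0 + Dp = (\<integral>\<^sup>+ z. ennreal ((1 + N z) * ?D z) \<partial>lborel)"
    unfolding D0_def Dp_def using N0
    by (subst nn_integral_add[symmetric]) (auto intro!: nn_integral_cong simp: distrib_right)
  have "ennreal I \<le> (\<integral>\<^sup>+ z. ennreal (f z) + ennreal (?D z) \<partial>lborel)"
    unfolding nnI[symmetric]
  proof (rule nn_integral_mono)
    fix z
    have "P z \<le> f z + ?D z" using f0[of z] by (auto simp: P_def)
    then show "ennreal (P z) \<le> ennreal (f z) + ennreal (?D z)"
      using f0[of z] by (simp add: ennreal_plus[symmetric] ennreal_leI del: ennreal_plus)
  qed
  also have "\<dots> = 1 + D0" unfolding D0_def by (subst nn_integral_add) (auto simp: f1)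
  finally have ID': "ennreal I \<le> 1 + D0" .
  have ID: "ennreal (I - 1) \<le> D0"
  proof (cases D0)
    case (real r)
    then have "ennreal I \<le> ennreal (1 + r)" using ID' by simp
    then have "I \<le> 1 + r" using real by (subst (asm) ennreal_le_iff) auto
    then show ?thesis using real by (simp add: ennreal_leI)
  qed simp
  have pt: "N z * \<bar>f z - 1 / I * P z\<bar> \<le> 2 * (N z * ?D z) + (I - 1) * (N z * f z)" for z
  proof -
    let ?P = "P z"
    have s: "\<bar>1 - 1 / I\<bar> = 1 - 1 / I" "1 - 1 / I \<le> 1" using I by auto
    have s2: "1 - 1 / I \<le> I - 1"
    proof -
      have "1 - 1 / I = (I - 1) / I" using I by (simp add: field_simps)
      also have "\<dots> \<le> (I - 1) / 1" using I by (intro divide_left_mono) auto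
      finally show ?thesis by simp
    qed
    \<comment> \<open>Compare first with the positive part, then with its normalisation.\<close>
    have "\<bar>f z - 1 / I * ?P\<bar> \<le> \<bar>f z - ?P\<bar> + (1 - 1 / I) * ?P"
    proof -
      have "f z - 1 / I * ?P = (f z - ?P) + (1 - 1 / I) * ?P" by (simp add: algebra_simps)
      then have "\<bar>f z - 1 / I * ?P\<bar> \<le> \<bar>f z - ?P\<bar> + \<bar>(1 - 1 / I) * ?P\<bar>" by (metis abs_triangle_ineq)
      then show ?thesis using s P0[of z] by (simp only: abs_mult abs_of_nonneg)
    qed
    also have "\<bar>f z - ?P\<bar> \<le> ?D z" using f0[of z] by (auto simp: P_def)
    also have "(1 - 1 / I) * ?P \<le> (1 - 1 / I) * (f z + ?D z)"
      using I f0[of z] by (intro mult_left_mono) (auto simp: P_def)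
    also have "(1 - 1 / I) * (f z + ?D z) \<le> (I - 1) * f z + 1 * ?D z"
      unfolding distrib_left using s s2 f0[of z] by (intro add_mono mult_right_mono) auto
    finally have "\<bar>f z - 1 / I * ?P\<bar> \<le> 2 * ?D z + (I - 1) * f z" by simp
    then have "N z * \<bar>f z - 1 / I * ?P\<bar> \<le> N z * (2 * ?D z + (I - 1) * f z)"
      using N0 by (rule mult_left_mono)
    then show ?thesis by (simp add: algebra_simps)
  qed
  have "(\<integral>\<^sup>+ z. ennreal (N z * \<bar>f z - 1 / I * P z\<bar>) \<partial>lborel)
    \<le> (\<integral>\<^sup>+ z. 2 * ennreal (N z * ?D z) + ennreal (I - 1) * ennreal (N z * f z) \<partial>lborel)"
  proof (rule nn_integral_mono)
    fix z
    have nn: "0 \<le> N z * ?D z" "0 \<le> N z * f z" "0 \<le> I - 1" using N0[of z] f0[of z] I by auto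
    have "2 * ennreal (N z * ?D z) + ennreal (I - 1) * ennreal (N z * f z) = ennreal (2 * (N z * ?D z) + (I - 1) * (N z * f z))"
      using nn by (subst ennreal_plus, simp, simp, subst (3 4) ennreal_mult) simp_all
    then show "ennreal (N z * \<bar>f z - 1 / I * P z\<bar>) \<le> 2 * ennreal (N z * ?D z) + ennreal (I - 1) * ennreal (N z * f z)"
      using pt[of z] by (simp add: ennreal_leI)
  qed
  also have "\<dots> = 2 * Dp + ennreal (I - 1) * B"
    unfolding Dp_def B_def by (subst nn_integral_add) (simp_all add: nn_integral_cmult)
  also have "\<dots> \<le> 2 * (D0 + Dp) + (D0 + Dp) * B"
    using ID by (intro add_mono mult_left_mono mult_right_mono) (auto simp: add_increasing2)
  also have "\<dots> = (2 + B) * (D0 + Dp)" by (simp add: algebra_simps)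
  finally show "(\<integral>\<^sup>+ z. ennreal (N z * \<bar>f z - 1 / I * max 0 (F z)\<bar>) \<partial>lborel)
      \<le> (2 + (\<integral>\<^sup>+ z. ennreal (N z * f z) \<partial>lborel)) * (\<integral>\<^sup>+ z. ennreal ((1 + N z) * ?D z) \<partial>lborel)"
    by (simp only: Dsum B_def P_def)
qed

text \<open>Weights of product form are submultiplicative along sums, so they can be passed from the
estimator's argument to the signal, the noise and the kernel separately.\<close>

definition weight :: "('d \<Rightarrow> real) \<Rightarrow> real ^ 'd \<Rightarrow> real" where
  "weight s z = (\<Prod>l\<in>UNIV. (1 + \<bar>z $ l\<bar>) powr s l)"

lemma weight_measurable [measurable]: "weight s \<in> borel_measurable borel"
  unfolding weight_def[abs_def] by measurable

lemma weight_pos: "weight s z > 0"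
  unfolding weight_def by (intro prod_pos) (auto simp: add_pos_nonneg)

lemma one_plus_abs_add_powr_le:
  assumes "s \<ge> 0"
  shows "(1 + \<bar>x + y\<bar>) powr s \<le> (1 + \<bar>x\<bar>) powr s * (1 + \<bar>y :: real\<bar>) powr s"
proof -
  have "(1 + \<bar>x + y\<bar>) powr s \<le> ((1 + \<bar>x\<bar>) * (1 + \<bar>y\<bar>)) powr s"
    using assms by (intro powr_mono2 one_plus_abs_add_le) auto
  also have "\<dots> = (1 + \<bar>x\<bar>) powr s * (1 + \<bar>y\<bar>) powr s" by (rule powr_mult)
  finally show ?thesis .
qed

lemma weight_add_le:
  assumes "\<And>l. s l \<ge> 0" shows "weight s (x + y) \<le> weight s x * weight s y"
  unfolding weight_def prod.distrib[symmetric]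
  using assms by (intro prod_mono) (auto intro!: one_plus_abs_add_powr_le)

text \<open>The exponents of the weight \<open>(1 + |z\<^sub>j|)\<^sup>2\<^sup>p \<Prod>(1 + |z\<^sub>l|)\<^sup>a\<close>.\<close>

definition exps :: "real \<Rightarrow> real \<Rightarrow> 'd \<Rightarrow> 'd \<Rightarrow> real" where
  "exps a p j l = a + (if l = j then 2 * p else 0)"

lemma weight_exps: "weight (exps a p j) z = (\<Prod>l\<in>UNIV. (1 + \<bar>z $ l\<bar>) powr a) * ((1 + \<bar>z $ j\<bar>) powr p)\<^sup>2"
proof -
  have "(1 + \<bar>z $ l\<bar>) powr exps a p j l = (1 + \<bar>z $ l\<bar>) powr a * (if l = j then ((1 + \<bar>z $ j\<bar>) powr p)\<^sup>2 else 1)" for l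
    unfolding exps_def by (cases "l = j") (simp_all only: powr_add mult_2 power2_eq_square if_True if_False refl add_0_right mult_1_right)
  then show ?thesis by (simp add: weight_def prod.distrib prod.delta)
qed

text \<open>A kernel density estimator from noisy observations whose kernel \<open>\<kappa>\<close>, averaged over the noise,
is a genuine density \<open>k\<close>. In the definitions that follow, \<open>G\<close> is the contribution of one observation, \<open>K\<close> the rescaled product
density, \<open>f\<close> the smoothed signal density and \<open>F\<close> the estimator.\<close>

locale product_estimator = product_measure \<nu> for \<nu> :: "'d::finite \<Rightarrow> real measure" +
  fixes \<mu> :: "(real ^ 'd) measure" and \<kappa> :: "'d \<Rightarrow> real \<Rightarrow> real" and k :: "real \<Rightarrow> real"
    and h :: real and n :: nat
  assumes prob_\<nu>: "\<And>j. prob_space (\<nu> j)"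
    and prob_\<mu>: "prob_space \<mu>" and sets_\<mu>: "sets \<mu> = sets borel"
    and \<kappa>_measurable [measurable]: "\<And>j. \<kappa> j \<in> borel_measurable borel"
    and \<kappa>_bounded: "\<And>j. \<exists>B. \<forall>v. \<bar>\<kappa> j v\<bar> \<le> B"
    and \<kappa>_integrable: "\<And>j. integrable lborel (\<kappa> j)"
    and \<kappa>_integral: "\<And>j. (LINT v|lborel. \<kappa> j v) = 1"
    and k_measurable [measurable]: "k \<in> borel_measurable borel"
    and k_nonneg: "\<And>v. 0 \<le> k v"
    and k_integral: "(\<integral>\<^sup>+ v. ennreal (k v) \<partial>lborel) = 1"
    and unbiased: "\<And>j y. (LINT e|\<nu> j. \<kappa> j ((y - e) / h)) = k (y / h)"
    and h_pos: "0 < h" and n_pos: "0 < n"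
begin

abbreviation "noise \<equiv> product_law \<nu>"

definition law :: "(real ^ 'd) measure" where
  "law = convolution \<mu> noise"

definition G :: "real ^ 'd \<Rightarrow> real ^ 'd \<Rightarrow> real" where
  "G z y = (\<Prod>j\<in>UNIV. 1 / h * \<kappa> j ((z $ j - y $ j) / h))"

definition K :: "real ^ 'd \<Rightarrow> real" where
  "K w = (\<Prod>j\<in>UNIV. 1 / h * k (w $ j / h))"

definition f :: "real ^ 'd \<Rightarrow> real" where
  "f z = (LINT x|\<mu>. K (z - x))"

definition F :: "(nat \<Rightarrow> real ^ 'd) \<Rightarrow> real ^ 'd \<Rightarrow> real" where
  "F Y z = 1 / real n * (\<Sum>i<n. G z (Y i))"

sublocale \<mu>: prob_space \<mu> by (rule prob_\<mu>)
sublocale noise: prob_space noise by (rule prob_space_product_law[OF prob_\<nu>])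
sublocale \<mu>_noise: pair_prob_space \<mu> noise ..

declare sets_\<mu> [measurable_cong]

lemma space_\<mu>: "space \<mu> = UNIV" using sets_eq_imp_space_eq[OF sets_\<mu>] by simp

lemma sets_law [simp, measurable_cong]: "sets law = sets borel"
  by (simp add: law_def)

sublocale law: prob_space law
  unfolding law_def convolution_def by (rule \<mu>_noise.prob_space_distr) measurable

lemma G_measurable [measurable]: "case_prod G \<in> borel_measurable (borel \<Otimes>\<^sub>M borel)"
  unfolding G_def[abs_def] by measurable

lemma G_measurable2 [measurable]: "G z \<in> borel_measurable borel"
  unfolding G_def[abs_def] by measurable

lemma K_measurable [measurable]: "K \<in> borel_measurable borel"
  unfolding K_def[abs_def] by measurable

lemma K_nonneg: "K w \<ge> 0"
  unfolding K_def using k_nonneg h_pos by (intro prod_nonneg) auto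

lemma G_bounded: "\<exists>B. \<forall>z y. \<bar>G z y\<bar> \<le> B"
proof -
  obtain B where B: "\<And>j v. \<bar>\<kappa> j v\<bar> \<le> B j" using \<kappa>_bounded by metis
  have "\<bar>G z y\<bar> \<le> (\<Prod>j\<in>UNIV. 1 / h * B j)" for z y
    unfolding G_def abs_prod using B h_pos
    by (intro prod_mono) (auto simp: abs_mult intro!: divide_right_mono)
  then show ?thesis by blast
qed

lemma k_bounded: "\<exists>B. \<forall>v. \<bar>k v\<bar> \<le> B"
proof -
  obtain B where B: "\<And>v. \<bar>\<kappa> undefined v\<bar> \<le> B" using \<kappa>_bounded by metis
  interpret \<nu>: prob_space "\<nu> undefined" by (rule prob_\<nu>)
  have "\<bar>k v\<bar> \<le> B" for v
  proof -
    have "\<bar>(LINT e|\<nu> undefined. \<kappa> undefined ((v * h - e) / h))\<bar> \<le> (LINT e|\<nu> undefined. B)"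
      unfolding real_norm_def[symmetric] using B
      by (intro order_trans[OF integral_norm_bound] integral_mono_AE') (auto intro: order_trans[OF abs_ge_zero])
    then show ?thesis
      using unbiased[of undefined "v * h"] h_pos by (simp add: \<nu>.prob_space)
  qed
  then show ?thesis by blast
qed

lemma K_bounded: "\<exists>B. \<forall>w. \<bar>K w\<bar> \<le> B"
proof -
  obtain B where B: "\<And>v. \<bar>k v\<bar> \<le> B" using k_bounded by metis
  have "\<bar>K w\<bar> \<le> (\<Prod>j\<in>(UNIV :: 'd set). 1 / h * B)" for w
    unfolding K_def abs_prod using B h_pos
    by (intro prod_mono) (auto simp: abs_mult intro!: divide_right_mono)
  then show ?thesis by blast
qed

text \<open>Independence of the coordinates of the noise lets the mean factorise, and each factor is
computed by unbiasedness.\<close>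

lemma expectation_G: "(LINT y|law. G z y) = f z"
proof -
  obtain B where B: "\<And>z y. \<bar>G z y\<bar> \<le> B" using G_bounded by blast
  have "(LINT y|law. G z y) = (LINT w|(\<mu> \<Otimes>\<^sub>M noise). G z (fst w + snd w))"
    unfolding law_def convolution_def by (subst integral_distr) (auto simp: split_beta')
  also have "\<dots> = (LINT x|\<mu>. (LINT e|noise. G z (x + e)))"
  proof -
    have "integrable (\<mu> \<Otimes>\<^sub>M noise) (\<lambda>w. G z (fst w + snd w))"
      by (rule \<mu>_noise.integrable_const_bound[where B = B]) (auto simp: B)
    from \<mu>_noise.integral_fst'[OF this] show ?thesis by simp
  qed
  also have "\<dots> = f z"
    unfolding f_def
  proof (rule Bochner_Integration.integral_cong[OF refl])
    fix x
    have int: "integrable (\<nu> j) (\<lambda>t. 1 / h * \<kappa> j ((z $ j - x $ j - t) / h))" for j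
    proof -
      interpret \<nu>: prob_space "\<nu> j" by (rule prob_\<nu>)
      obtain C where "\<And>v. \<bar>\<kappa> j v\<bar> \<le> C" using \<kappa>_bounded by metis
      then show ?thesis
        by (intro integrable_mult_right \<nu>.integrable_const_bound[where B = C]) (auto intro: coord_measurable)
    qed
    have "(LINT e|noise. G z (x + e)) = (LINT e|noise. (\<Prod>j\<in>UNIV. 1 / h * \<kappa> j ((z $ j - x $ j - e $ j) / h)))"
      unfolding G_def by (simp add: diff_diff_add)
    also have "\<dots> = (\<Prod>j\<in>UNIV. LINT t|\<nu> j. 1 / h * \<kappa> j ((z $ j - x $ j - t) / h))"
      using int by (intro integral_product_law_prod) auto
    also have "\<dots> = K (z - x)"
      unfolding K_def using unbiased by simp
    finally show "(LINT e|noise. G z (x + e)) = K (z - x)" .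
  qed
  finally show ?thesis .
qed

lemma f_measurable [measurable]: "f \<in> borel_measurable borel"
  unfolding f_def[abs_def] by measurable

lemma ennreal_f: "ennreal (f z) = (\<integral>\<^sup>+ x. ennreal (K (z - x)) \<partial>\<mu>)"
proof -
  obtain B where B: "\<And>w. \<bar>K w\<bar> \<le> B" using K_bounded by blast
  have "integrable \<mu> (\<lambda>x. K (z - x))"
    by (rule \<mu>.integrable_const_bound[where B = B]) (auto simp: B)
  then show ?thesis
    unfolding f_def using K_nonneg by (intro nn_integral_eq_integral[symmetric]) auto
qed

lemma f_nonneg: "f z \<ge> 0"
  unfolding f_def using K_nonneg by (intro integral_nonneg_AE) auto

lemma mean_square_error_le:
  "(\<integral>\<^sup>+ Y. ennreal ((F Y z - f z)\<^sup>2) \<partial>Pi\<^sub>M {..<n} (\<lambda>_. law)) \<le> ennreal (1 / real n) * (\<integral>\<^sup>+ y. ennreal ((G z y)\<^sup>2) \<partial>law)"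
proof -
  obtain B where B: "\<And>z y. \<bar>G z y\<bar> \<le> B" using G_bounded by blast
  show ?thesis
    unfolding F_def expectation_G[symmetric]
    by (rule iid_mean_square_le[OF law.prob_space_axioms _ B n_pos]) measurable
qed

lemma nn_integral_law:
  assumes [measurable]: "u \<in> borel_measurable borel"
  shows "(\<integral>\<^sup>+ y. u y \<partial>law) = (\<integral>\<^sup>+ x. (\<integral>\<^sup>+ e. u (x + e) \<partial>noise) \<partial>\<mu>)"
  unfolding law_def
  by (rule nn_integral_convolution)
     (auto simp: sets_\<mu> \<mu>.finite_measure_axioms noise.finite_measure_axioms)

lemma nn_integral_affine_h:
  assumes [measurable]: "u \<in> borel_measurable borel"
  shows "(\<integral>\<^sup>+ t. u t \<partial>lborel) = ennreal h * (\<integral>\<^sup>+ v. u (y + h * v) \<partial>lborel)"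
  using nn_integral_real_affine[of u h y] h_pos by simp

definition second_moment :: "('d \<Rightarrow> real) \<Rightarrow> ennreal" where
  "second_moment s = (\<integral>\<^sup>+ z. ennreal (weight s z) * (\<integral>\<^sup>+ y. ennreal ((G z y)\<^sup>2) \<partial>law) \<partial>lborel)"

text \<open>Substitute \<open>z = y + h v\<close> with \<open>y = x + e\<close>. The weight splits into factors depending on \<open>x\<close>,
\<open>e\<close> and \<open>h v\<close>, and the last two factorise over the coordinates.\<close>

lemma second_moment_le:
  assumes s: "\<And>l. s l \<ge> 0"
  shows "second_moment s \<le> (\<integral>\<^sup>+ x. ennreal (weight s x) \<partial>\<mu>) * (\<Prod>l\<in>UNIV. \<integral>\<^sup>+ e. ennreal ((1 + \<bar>e\<bar>) powr s l) \<partial>\<nu> l)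
     * (\<Prod>l\<in>UNIV. \<integral>\<^sup>+ v. ennreal ((1 + \<bar>h * v\<bar>) powr s l * (1 / h * (\<kappa> l v)\<^sup>2)) \<partial>lborel)"
proof -
  interpret PL: pair_sigma_finite law lborel ..
  define A where "A l = (\<integral>\<^sup>+ v. ennreal ((1 + \<bar>h * v\<bar>) powr s l * (1 / h * (\<kappa> l v)\<^sup>2)) \<partial>lborel)" for l
  have w_prod: "ennreal (weight s x) = (\<Prod>l\<in>UNIV. ennreal ((1 + \<bar>x $ l\<bar>) powr s l))" for x
    unfolding weight_def by (rule prod_ennreal[symmetric]) simp
  have inner: "(\<integral>\<^sup>+ z. ennreal (weight s z) * ennreal ((G z y)\<^sup>2) \<partial>lborel) \<le> ennreal (weight s y) * (\<Prod>l\<in>UNIV. A l)" for y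
  proof -
    have "ennreal (weight s z) * ennreal ((G z y)\<^sup>2)
       = (\<Prod>l\<in>UNIV. ennreal ((1 + \<bar>z $ l\<bar>) powr s l * (1 / h * \<kappa> l ((z $ l - y $ l) / h))\<^sup>2))" for z
    proof -
      have "ennreal (weight s z) * ennreal ((G z y)\<^sup>2) = ennreal (weight s z * (G z y)\<^sup>2)"
        using weight_pos[of s z] by (intro ennreal_mult[symmetric]) auto
      also have "weight s z * (G z y)\<^sup>2 = (\<Prod>l\<in>UNIV. (1 + \<bar>z $ l\<bar>) powr s l * (1 / h * \<kappa> l ((z $ l - y $ l) / h))\<^sup>2)"
        unfolding weight_def G_def prod_power_distrib prod.distrib[symmetric] by (rule refl)
      finally show ?thesis by (subst prod_ennreal) auto
    qed
    then have "(\<integral>\<^sup>+ z. ennreal (weight s z) * ennreal ((G z y)\<^sup>2) \<partial>lborel)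
       = (\<integral>\<^sup>+ z. (\<Prod>l\<in>UNIV. ennreal ((1 + \<bar>z $ l\<bar>) powr s l * (1 / h * \<kappa> l ((z $ l - y $ l) / h))\<^sup>2)) \<partial>lborel)"
      by simp
    also have "\<dots> = (\<Prod>l\<in>UNIV. \<integral>\<^sup>+ t. ennreal ((1 + \<bar>t\<bar>) powr s l * (1 / h * \<kappa> l ((t - y $ l) / h))\<^sup>2) \<partial>lborel)"
      by (rule nn_integral_lborel_vec_prod) measurable
    also have "\<dots> \<le> (\<Prod>l\<in>UNIV. ennreal ((1 + \<bar>y $ l\<bar>) powr s l) * A l)"
    proof (rule prod_mono_ennreal)
      fix l
      have "(\<integral>\<^sup>+ t. ennreal ((1 + \<bar>t\<bar>) powr s l * (1 / h * \<kappa> l ((t - y $ l) / h))\<^sup>2) \<partial>lborel)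
        = ennreal h * (\<integral>\<^sup>+ v. ennreal ((1 + \<bar>y $ l + h * v\<bar>) powr s l * (1 / h * \<kappa> l v)\<^sup>2) \<partial>lborel)"
        by (subst nn_integral_affine_h[of _ "y $ l"]) (use h_pos in simp_all)
      also have "\<dots> = (\<integral>\<^sup>+ v. ennreal h * ennreal ((1 + \<bar>y $ l + h * v\<bar>) powr s l * (1 / h * \<kappa> l v)\<^sup>2) \<partial>lborel)"
        by (rule nn_integral_cmult[symmetric]) measurable
      also have "\<dots> \<le> (\<integral>\<^sup>+ v. ennreal ((1 + \<bar>y $ l\<bar>) powr s l) * ennreal ((1 + \<bar>h * v\<bar>) powr s l * (1 / h * (\<kappa> l v)\<^sup>2)) \<partial>lborel)"
      proof (rule nn_integral_mono)
        fix v
        have "h * ((1 + \<bar>y $ l + h * v\<bar>) powr s l * (1 / h * \<kappa> l v)\<^sup>2)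
           = (1 + \<bar>y $ l + h * v\<bar>) powr s l * (1 / h * (\<kappa> l v)\<^sup>2)"
          using h_pos by (simp add: power2_eq_square field_simps)
        also have "\<dots> \<le> ((1 + \<bar>y $ l\<bar>) powr s l * (1 + \<bar>h * v\<bar>) powr s l) * (1 / h * (\<kappa> l v)\<^sup>2)"
          using h_pos by (intro mult_right_mono one_plus_abs_add_powr_le s) auto
        finally have "h * ((1 + \<bar>y $ l + h * v\<bar>) powr s l * (1 / h * \<kappa> l v)\<^sup>2)
          \<le> (1 + \<bar>y $ l\<bar>) powr s l * ((1 + \<bar>h * v\<bar>) powr s l * (1 / h * (\<kappa> l v)\<^sup>2))" by (simp only: mult.assoc)
        then show "ennreal h * ennreal ((1 + \<bar>y $ l + h * v\<bar>) powr s l * (1 / h * \<kappa> l v)\<^sup>2)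
          \<le> ennreal ((1 + \<bar>y $ l\<bar>) powr s l) * ennreal ((1 + \<bar>h * v\<bar>) powr s l * (1 / h * (\<kappa> l v)\<^sup>2))"
          using h_pos by (subst (1 2) ennreal_mult[symmetric]) (auto intro!: ennreal_leI)
      qed
      also have "\<dots> = ennreal ((1 + \<bar>y $ l\<bar>) powr s l) * A l"
        unfolding A_def by (rule nn_integral_cmult) measurable
      finally show "(\<integral>\<^sup>+ t. ennreal ((1 + \<bar>t\<bar>) powr s l * (1 / h * \<kappa> l ((t - y $ l) / h))\<^sup>2) \<partial>lborel) \<le> \<dots>" .
    qed
    also have "\<dots> = ennreal (weight s y) * (\<Prod>l\<in>UNIV. A l)"
      unfolding prod.distrib w_prod by (rule refl)
    finally show ?thesis .
  qed
  have "second_moment s = (\<integral>\<^sup>+ z. (\<integral>\<^sup>+ y. ennreal (weight s z) * ennreal ((G z y)\<^sup>2) \<partial>law) \<partial>lborel)"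
    unfolding second_moment_def by (intro nn_integral_cong nn_integral_cmult[symmetric]) measurable
  also have "\<dots> = (\<integral>\<^sup>+ y. (\<integral>\<^sup>+ z. ennreal (weight s z) * ennreal ((G z y)\<^sup>2) \<partial>lborel) \<partial>law)"
    by (rule PL.Fubini') measurable
  also have "\<dots> \<le> (\<integral>\<^sup>+ y. ennreal (weight s y) * (\<Prod>l\<in>UNIV. A l) \<partial>law)"
    by (intro nn_integral_mono inner)
  also have "\<dots> = (\<integral>\<^sup>+ y. ennreal (weight s y) \<partial>law) * (\<Prod>l\<in>UNIV. A l)"
    by (rule nn_integral_multc) measurable
  also have "(\<integral>\<^sup>+ y. ennreal (weight s y) \<partial>law) \<le> (\<integral>\<^sup>+ x. ennreal (weight s x) \<partial>\<mu>) * (\<Prod>l\<in>UNIV. \<integral>\<^sup>+ e. ennreal ((1 + \<bar>e\<bar>) powr s l) \<partial>\<nu> l)"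
  proof -
    have "(\<integral>\<^sup>+ y. ennreal (weight s y) \<partial>law) = (\<integral>\<^sup>+ x. (\<integral>\<^sup>+ e. ennreal (weight s (x + e)) \<partial>noise) \<partial>\<mu>)"
      by (rule nn_integral_law) measurable
    also have "\<dots> \<le> (\<integral>\<^sup>+ x. (\<integral>\<^sup>+ e. ennreal (weight s x) * ennreal (weight s e) \<partial>noise) \<partial>\<mu>)"
    proof (intro nn_integral_mono)
      fix x e :: "real ^ 'd"
      have "ennreal (weight s (x + e)) \<le> ennreal (weight s x * weight s e)"
        by (intro ennreal_leI weight_add_le s)
      also have "\<dots> = ennreal (weight s x) * ennreal (weight s e)"
        by (intro ennreal_mult less_imp_le[OF weight_pos])
      finally show "ennreal (weight s (x + e)) \<le> ennreal (weight s x) * ennreal (weight s e)" .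
    qed
    also have "\<dots> = (\<integral>\<^sup>+ x. ennreal (weight s x) * (\<integral>\<^sup>+ e. ennreal (weight s e) \<partial>noise) \<partial>\<mu>)"
      by (intro nn_integral_cong nn_integral_cmult) measurable
    also have "\<dots> = (\<integral>\<^sup>+ x. ennreal (weight s x) \<partial>\<mu>) * (\<integral>\<^sup>+ e. ennreal (weight s e) \<partial>noise)"
      by (rule nn_integral_multc) measurable
    also have "(\<integral>\<^sup>+ e. ennreal (weight s e) \<partial>noise) = (\<Prod>l\<in>UNIV. \<integral>\<^sup>+ e. ennreal ((1 + \<bar>e\<bar>) powr s l) \<partial>\<nu> l)"
      unfolding w_prod by (rule nn_integral_product_law_prod) measurable
    finally show ?thesis .
  qed
  finally show ?thesis unfolding A_def by (simp add: mult_right_mono)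
qed

lemma F_measurable [measurable]:
  "case_prod F \<in> borel_measurable (Pi\<^sub>M {..<n} (\<lambda>_. law) \<Otimes>\<^sub>M borel)"
proof -
  have "(\<lambda>w. G (snd w) (fst w i)) \<in> borel_measurable (Pi\<^sub>M {..<n} (\<lambda>_. law) \<Otimes>\<^sub>M borel)" if "i \<in> {..<n}" for i
  proof -
    have "(\<lambda>w. fst w i) \<in> Pi\<^sub>M {..<n} (\<lambda>_. law) \<Otimes>\<^sub>M (borel :: (real ^ 'd) measure) \<rightarrow>\<^sub>M law"
      by (rule measurable_compose[OF measurable_fst measurable_component_singleton[OF that]])
    then have "(\<lambda>w. fst w i) \<in> Pi\<^sub>M {..<n} (\<lambda>_. law) \<Otimes>\<^sub>M (borel :: (real ^ 'd) measure) \<rightarrow>\<^sub>M borel"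
      unfolding measurable_cong_sets[OF refl sets_law] .
    from measurable_compose[OF measurable_Pair[OF measurable_snd this] G_measurable] show ?thesis by simp
  qed
  then show ?thesis
    unfolding F_def[abs_def] split_beta' by (intro borel_measurable_times borel_measurable_const borel_measurable_sum)
qed

text \<open>With \<open>V = \<Prod>(1 + |z\<^sub>l|)\<^sup>-\<^sup>a\<close> integrable, \<open>x \<le> \<theta> V / 2 + x\<^sup>2 / (2 \<theta> V)\<close>. Keeping the parameter \<open>\<theta>\<close>
free makes this as good as the Cauchy-Schwarz inequality and avoids integrating a square root of
the variance.\<close>

lemma expected_weighted_L1_error_le:
  assumes \<theta>: "\<theta> > 0"
  shows "(\<integral>\<^sup>+ Y. (\<integral>\<^sup>+ z. ennreal ((1 + \<bar>z $ j\<bar>) powr p * \<bar>F Y z - f z\<bar>) \<partial>lborel) \<partial>Pi\<^sub>M {..<n} (\<lambda>_. law))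
    \<le> ennreal (\<theta> / 2) * (\<integral>\<^sup>+ t. ennreal ((1 + \<bar>t\<bar>) powr (- a)) \<partial>lborel) ^ CARD('d)
      + ennreal (1 / (2 * \<theta> * real n)) * second_moment (exps a p j)"
proof -
  let ?P = "Pi\<^sub>M {..<n} (\<lambda>_. law)"
  interpret P: prob_space ?P by (intro prob_space_PiM law.prob_space_axioms)
  interpret PP: pair_sigma_finite ?P "lborel :: (real ^ 'd) measure" ..
  define V where "V z = (\<Prod>l\<in>UNIV. (1 + \<bar>z $ l\<bar>) powr (- a))" for z :: "real ^ 'd"
  have V_pos: "V z > 0" for z unfolding V_def by (intro prod_pos) (auto simp: add_pos_nonneg)
  have [measurable]: "V \<in> borel_measurable borel" unfolding V_def[abs_def] by measurable
  have VW: "weight (exps a p j) z = ((1 + \<bar>z $ j\<bar>) powr p)\<^sup>2 / V z" for z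
  proof -
    have "V z = inverse (\<Prod>l\<in>UNIV. (1 + \<bar>z $ l\<bar>) powr a)"
      unfolding V_def powr_minus by (rule prod_inversef[unfolded o_def])
    then show ?thesis unfolding weight_exps by (simp only: divide_inverse inverse_inverse_eq mult.commute)
  qed
  have am_gm: "(1 + \<bar>z $ j\<bar>) powr p * D \<le> \<theta> / 2 * V z + 1 / (2 * \<theta>) * (weight (exps a p j) z * D\<^sup>2)" for z D
  proof -
    define x where "x = (1 + \<bar>z $ j\<bar>) powr p * D"
    define c where "c = \<theta> * V z"
    have c: "c > 0" unfolding c_def using \<theta> V_pos[of z] by simp
    have "0 \<le> (x - c)\<^sup>2" by simp
    then have "2 * x * c \<le> x\<^sup>2 + c\<^sup>2" by (simp add: power2_diff)
    then have "x \<le> c / 2 + x\<^sup>2 / (2 * c)" using c by (simp add: field_simps power2_eq_square)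
    moreover have "x\<^sup>2 / (2 * c) = 1 / (2 * \<theta>) * (weight (exps a p j) z * D\<^sup>2)"
      unfolding VW c_def x_def by (simp add: power_mult_distrib)
    ultimately show ?thesis by (simp add: x_def c_def)
  qed
  have V_int: "(\<integral>\<^sup>+ z. ennreal (V z) \<partial>lborel) = (\<integral>\<^sup>+ t. ennreal ((1 + \<bar>t\<bar>) powr (- a)) \<partial>lborel) ^ CARD('d)"
  proof -
    have "ennreal (V z) = (\<Prod>l\<in>UNIV. ennreal ((1 + \<bar>z $ l\<bar>) powr (- a)))" for z
      unfolding V_def by (rule prod_ennreal[symmetric]) simp
    then have "(\<integral>\<^sup>+ z. ennreal (V z) \<partial>lborel) = (\<integral>\<^sup>+ z. (\<Prod>l\<in>UNIV. ennreal ((1 + \<bar>z $ l\<bar>) powr (- a))) \<partial>(lborel :: (real ^ 'd) measure))"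
      by simp
    also have "\<dots> = (\<Prod>l\<in>(UNIV :: 'd set). \<integral>\<^sup>+ t. ennreal ((1 + \<bar>t\<bar>) powr (- a)) \<partial>lborel)"
      by (rule nn_integral_lborel_vec_prod[where f = "\<lambda>_ t. ennreal ((1 + \<bar>t\<bar>) powr (- a))"]) measurable
    finally show ?thesis by simp
  qed
  have "(\<integral>\<^sup>+ Y. (\<integral>\<^sup>+ z. ennreal ((1 + \<bar>z $ j\<bar>) powr p * \<bar>F Y z - f z\<bar>) \<partial>lborel) \<partial>?P)
     = (\<integral>\<^sup>+ z. (\<integral>\<^sup>+ Y. ennreal ((1 + \<bar>z $ j\<bar>) powr p * \<bar>F Y z - f z\<bar>) \<partial>?P) \<partial>lborel)"
    by (rule PP.Fubini'[symmetric]) measurable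
  also have "\<dots> \<le> (\<integral>\<^sup>+ z. ennreal (\<theta> / 2) * ennreal (V z) + ennreal (1 / (2 * \<theta> * real n)) * (ennreal (weight (exps a p j) z) * (\<integral>\<^sup>+ y. ennreal ((G z y)\<^sup>2) \<partial>law)) \<partial>lborel)"
  proof (rule nn_integral_mono)
    fix z :: "real ^ 'd"
    let ?w = "weight (exps a p j) z"
    have w: "0 \<le> ?w" by (rule less_imp_le[OF weight_pos])
    have [measurable]: "(\<lambda>Y. F Y z) \<in> borel_measurable ?P" by measurable
    have "(\<integral>\<^sup>+ Y. ennreal ((1 + \<bar>z $ j\<bar>) powr p * \<bar>F Y z - f z\<bar>) \<partial>?P)
      \<le> (\<integral>\<^sup>+ Y. ennreal (\<theta> / 2 * V z) + ennreal (1 / (2 * \<theta>) * ?w) * ennreal ((F Y z - f z)\<^sup>2) \<partial>?P)"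
    proof (rule nn_integral_mono)
      fix Y
      have "ennreal ((1 + \<bar>z $ j\<bar>) powr p * \<bar>F Y z - f z\<bar>) \<le> ennreal (\<theta> / 2 * V z + 1 / (2 * \<theta>) * ?w * (F Y z - f z)\<^sup>2)"
        using am_gm[of z "\<bar>F Y z - f z\<bar>"] by (intro ennreal_leI) (simp add: mult.assoc)
      also have "\<dots> = ennreal (\<theta> / 2 * V z) + ennreal (1 / (2 * \<theta>) * ?w) * ennreal ((F Y z - f z)\<^sup>2)"
        using \<theta> w V_pos[of z] by (subst ennreal_plus) (auto simp: ennreal_mult[symmetric])
      finally show "ennreal ((1 + \<bar>z $ j\<bar>) powr p * \<bar>F Y z - f z\<bar>) \<le> \<dots>" .
    qed
    also have "\<dots> = ennreal (\<theta> / 2 * V z) + ennreal (1 / (2 * \<theta>) * ?w) * (\<integral>\<^sup>+ Y. ennreal ((F Y z - f z)\<^sup>2) \<partial>?P)"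
      by (subst nn_integral_add, measurable, subst nn_integral_cmult) (auto simp: P.emeasure_space_1)
    also have "\<dots> \<le> ennreal (\<theta> / 2 * V z) + ennreal (1 / (2 * \<theta>) * ?w) * (ennreal (1 / real n) * (\<integral>\<^sup>+ y. ennreal ((G z y)\<^sup>2) \<partial>law))"
      by (intro add_left_mono mult_left_mono mean_square_error_le) simp
    also have "ennreal (\<theta> / 2 * V z) = ennreal (\<theta> / 2) * ennreal (V z)"
      using \<theta> V_pos[of z] by (intro ennreal_mult) auto
    also have "ennreal (1 / (2 * \<theta>) * ?w) * (ennreal (1 / real n) * (\<integral>\<^sup>+ y. ennreal ((G z y)\<^sup>2) \<partial>law))
       = ennreal (1 / (2 * \<theta> * real n)) * (ennreal ?w * (\<integral>\<^sup>+ y. ennreal ((G z y)\<^sup>2) \<partial>law))"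
    proof -
      have "ennreal (1 / (2 * \<theta>) * ?w) * ennreal (1 / real n) = ennreal (1 / (2 * \<theta> * real n)) * ennreal ?w"
        using \<theta> w by (subst (1 2) ennreal_mult[symmetric]) auto
      then show ?thesis by (simp only: mult.assoc[symmetric])
    qed
    finally show "(\<integral>\<^sup>+ Y. ennreal ((1 + \<bar>z $ j\<bar>) powr p * \<bar>F Y z - f z\<bar>) \<partial>?P)
      \<le> ennreal (\<theta> / 2) * ennreal (V z) + ennreal (1 / (2 * \<theta> * real n)) * (ennreal ?w * (\<integral>\<^sup>+ y. ennreal ((G z y)\<^sup>2) \<partial>law))" .
  qed
  also have "\<dots> = ennreal (\<theta> / 2) * (\<integral>\<^sup>+ z. ennreal (V z) \<partial>lborel) + ennreal (1 / (2 * \<theta> * real n)) * second_moment (exps a p j)"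
    unfolding second_moment_def
    by (subst nn_integral_add, measurable, subst nn_integral_cmult, measurable, subst nn_integral_cmult) measurable
  finally show ?thesis unfolding V_int .
qed

end

lemma emeasure_distr_eq_nn_integral:
  "v \<in> R \<rightarrow>\<^sub>M borel \<Longrightarrow> A \<in> sets borel \<Longrightarrow> emeasure (distr R borel v) A = (\<integral>\<^sup>+ w. indicator A (v w) \<partial>R)"
  using nn_integral_distr[of v R borel "indicator A"] by simp

context product_estimator
begin

lemma
  shows F_integrable: "integrable lborel (F Y)" and F_integral: "(LINT z|lborel. F Y z) = 1"
proof -
  have 1: "integrable lborel (\<lambda>t. 1 / h * \<kappa> j ((t - y) / h))" "(LINT t|lborel. 1 / h * \<kappa> j ((t - y) / h)) = 1" for j y
  proof -
    have e: "(t - y) / h = - y / h + 1 / h * t" for t by (simp add: diff_divide_distrib)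
    show "integrable lborel (\<lambda>t. 1 / h * \<kappa> j ((t - y) / h))"
      unfolding e using h_pos by (intro integrable_mult_right lborel_integrable_real_affine \<kappa>_integrable) auto
    have "(LINT v|lborel. \<kappa> j v) = \<bar>1 / h\<bar> *\<^sub>R (LINT t|lborel. \<kappa> j (- y / h + 1 / h * t))"
      using h_pos by (intro lborel_integral_real_affine) auto
    then show "(LINT t|lborel. 1 / h * \<kappa> j ((t - y) / h)) = 1"
      unfolding e integral_mult_right_zero using \<kappa>_integral[of j] h_pos by simp
  qed
  have G: "integrable lborel (\<lambda>z. G z y)" "(LINT z|lborel. G z y) = 1" for y
  proof -
    show "integrable lborel (\<lambda>z. G z y)"
      unfolding G_def by (intro integrable_lborel_vec_prod 1) measurable
    have "(LINT z|lborel. G z y) = (\<Prod>j\<in>UNIV. LINT t|lborel. 1 / h * \<kappa> j ((t - y $ j) / h))"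
      unfolding G_def by (intro integral_lborel_vec_prod 1) measurable
    then show "(LINT z|lborel. G z y) = 1" by (simp only: 1 prod.neutral_const)
  qed
  show "integrable lborel (F Y)"
    unfolding F_def[abs_def] by (intro integrable_mult_right Bochner_Integration.integrable_sum G)
  have "(LINT z|lborel. F Y z) = 1 / real n * (\<Sum>i<n. LINT z|lborel. G z (Y i))"
    unfolding F_def integral_mult_right_zero by (subst Bochner_Integration.integral_sum) (auto intro: G)
  then show "(LINT z|lborel. F Y z) = 1" using n_pos by (simp add: G)
qed

lemma nn_integral_K_coord:
  assumes [measurable]: "u \<in> borel_measurable borel"
  shows "(\<integral>\<^sup>+ w. ennreal (K w) * u (w $ j) \<partial>lborel) = (\<integral>\<^sup>+ v. ennreal (k v) * u (h * v) \<partial>lborel)"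
proof -
  have 1: "(\<integral>\<^sup>+ t. ennreal (1 / h * k (t / h)) * g t \<partial>lborel) = (\<integral>\<^sup>+ v. ennreal (k v) * g (h * v) \<partial>lborel)"
    if [measurable]: "g \<in> borel_measurable borel" for g
  proof -
    have "(\<integral>\<^sup>+ t. ennreal (1 / h * k (t / h)) * g t \<partial>lborel)
      = ennreal h * (\<integral>\<^sup>+ v. ennreal (1 / h * k v) * g (h * v) \<partial>lborel)"
      by (subst nn_integral_affine_h[of _ 0]) (use h_pos in simp_all)
    also have "\<dots> = (\<integral>\<^sup>+ v. ennreal h * (ennreal (1 / h * k v) * g (h * v)) \<partial>lborel)"
      by (rule nn_integral_cmult[symmetric]) measurable
    also have "\<dots> = (\<integral>\<^sup>+ v. ennreal (k v) * g (h * v) \<partial>lborel)"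
    proof (rule nn_integral_cong)
      fix v
      have "ennreal h * ennreal (1 / h * k v) = ennreal (h * (1 / h * k v))"
        using h_pos k_nonneg by (intro ennreal_mult[symmetric]) auto
      then show "ennreal h * (ennreal (1 / h * k v) * g (h * v)) = ennreal (k v) * g (h * v)"
        using h_pos by (simp add: mult.assoc[symmetric])
    qed
    finally show ?thesis .
  qed
  \<comment> \<open>All coordinates but \<open>j\<close> integrate to 1.\<close>
  let ?g = "\<lambda>l t. if l = j then u t else 1"
  have "ennreal (K w) * u (w $ j) = (\<Prod>l\<in>UNIV. ennreal (1 / h * k (w $ l / h)) * ?g l (w $ l))" for w
  proof -
    have "ennreal (K w) = (\<Prod>l\<in>UNIV. ennreal (1 / h * k (w $ l / h)))"
      unfolding K_def using h_pos k_nonneg by (intro prod_ennreal[symmetric]) auto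
    moreover have "(\<Prod>l\<in>UNIV. ?g l (w $ l)) = u (w $ j)" by (simp add: prod.delta)
    ultimately show ?thesis by (simp only: prod.distrib)
  qed
  then have "(\<integral>\<^sup>+ w. ennreal (K w) * u (w $ j) \<partial>lborel) = (\<integral>\<^sup>+ w. (\<Prod>l\<in>UNIV. ennreal (1 / h * k (w $ l / h)) * ?g l (w $ l)) \<partial>lborel)"
    by (simp only:)
  also have "\<dots> = (\<Prod>l\<in>UNIV. \<integral>\<^sup>+ t. ennreal (1 / h * k (t / h)) * ?g l t \<partial>lborel)"
    by (rule nn_integral_lborel_vec_prod) measurable
  also have "\<dots> = (\<Prod>l\<in>UNIV. if l = j then (\<integral>\<^sup>+ v. ennreal (k v) * u (h * v) \<partial>lborel) else 1)"
  proof (rule prod.cong[OF refl])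
    fix l
    have "(\<integral>\<^sup>+ t. ennreal (1 / h * k (t / h)) * ?g l t \<partial>lborel) = (\<integral>\<^sup>+ v. ennreal (k v) * ?g l (h * v) \<partial>lborel)"
      by (rule 1) measurable
    then show "(\<integral>\<^sup>+ t. ennreal (1 / h * k (t / h)) * ?g l t \<partial>lborel) = (if l = j then (\<integral>\<^sup>+ v. ennreal (k v) * u (h * v) \<partial>lborel) else 1)"
      by (cases "l = j") (simp_all add: k_integral)
  qed
  finally show ?thesis by (simp add: prod.delta)
qed

lemma nn_integral_K: "(\<integral>\<^sup>+ w. ennreal (K w) \<partial>lborel) = 1"
  using nn_integral_K_coord[of "\<lambda>_. 1" undefined] by (simp add: k_integral)

lemma nn_integral_f:
  assumes [measurable]: "u \<in> borel_measurable borel"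
  shows "(\<integral>\<^sup>+ z. ennreal (f z) * u z \<partial>lborel) = (\<integral>\<^sup>+ x. (\<integral>\<^sup>+ w. ennreal (K w) * u (x + w) \<partial>lborel) \<partial>\<mu>)"
proof -
  interpret PL: pair_sigma_finite \<mu> "lborel :: (real ^ 'd) measure" ..
  have "(\<integral>\<^sup>+ z. ennreal (f z) * u z \<partial>lborel) = (\<integral>\<^sup>+ z. (\<integral>\<^sup>+ x. ennreal (K (z - x)) * u z \<partial>\<mu>) \<partial>lborel)"
    unfolding ennreal_f by (intro nn_integral_cong nn_integral_multc[symmetric]) measurable
  also have "\<dots> = (\<integral>\<^sup>+ x. (\<integral>\<^sup>+ z. ennreal (K (z - x)) * u z \<partial>lborel) \<partial>\<mu>)"
    by (rule PL.Fubini') measurable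
  also have "\<dots> = (\<integral>\<^sup>+ x. (\<integral>\<^sup>+ w. ennreal (K w) * u (x + w) \<partial>lborel) \<partial>\<mu>)"
  proof (rule nn_integral_cong)
    fix x
    show "(\<integral>\<^sup>+ z. ennreal (K (z - x)) * u z \<partial>lborel) = (\<integral>\<^sup>+ w. ennreal (K w) * u (x + w) \<partial>lborel)"
      by (subst nn_integral_lborel_shift[symmetric, of _ x]) simp_all
  qed
  finally show ?thesis .
qed

lemma nn_integral_f_one: "(\<integral>\<^sup>+ z. ennreal (f z) \<partial>lborel) = 1"
  using nn_integral_f[of "\<lambda>_. 1"] by (simp add: nn_integral_K \<mu>.emeasure_space_1)

text \<open>The joint law of \<open>X\<close> and \<open>X + h Z\<close>.\<close>

definition smoothing_coupling :: "((real ^ 'd) \<times> (real ^ 'd)) measure" where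
  "smoothing_coupling = distr (\<mu> \<Otimes>\<^sub>M density lborel (\<lambda>w. ennreal (K w))) borel (\<lambda>(x, w). (x, x + w))"

lemma smoothing_map_measurable:
  "(\<lambda>(x, w). (x, x + w)) \<in> \<mu> \<Otimes>\<^sub>M density lborel (\<lambda>w. ennreal (K w)) \<rightarrow>\<^sub>M borel"
proof -
  have "(\<lambda>(x, w). (x, x + w)) \<in> \<mu> \<Otimes>\<^sub>M density lborel (\<lambda>w. ennreal (K w)) \<rightarrow>\<^sub>M (borel \<Otimes>\<^sub>M borel)"
    by measurable
  then show ?thesis by (simp only: borel_prod)
qed

lemma prob_space_K: "prob_space (density lborel (\<lambda>w. ennreal (K w)))"
  by (rule prob_spaceI) (simp add: emeasure_density nn_integral_K)

lemma prob_space_smoothing_coupling: "prob_space smoothing_coupling"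
proof -
  interpret KP: prob_space "density lborel (\<lambda>w. ennreal (K w))" by (rule prob_space_K)
  interpret pair_prob_space \<mu> "density lborel (\<lambda>w. ennreal (K w))" ..
  show ?thesis
    unfolding smoothing_coupling_def by (rule prob_space_distr[OF smoothing_map_measurable])
qed

lemma sets_smoothing_coupling: "sets smoothing_coupling = sets borel"
  by (simp add: smoothing_coupling_def)

lemma nn_integral_smoothing_coupling:
  assumes u[measurable]: "u \<in> borel_measurable (borel \<Otimes>\<^sub>M borel)"
  shows "(\<integral>\<^sup>+ w. u w \<partial>smoothing_coupling) = (\<integral>\<^sup>+ x. (\<integral>\<^sup>+ w. ennreal (K w) * u (x, x + w) \<partial>lborel) \<partial>\<mu>)"
proof -
  interpret KP: prob_space "density lborel (\<lambda>w. ennreal (K w))" by (rule prob_space_K)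
  have ub: "u \<in> borel_measurable borel" using u by (simp only: borel_prod)
  have "(\<integral>\<^sup>+ w. u w \<partial>smoothing_coupling)
     = (\<integral>\<^sup>+ xw. u (fst xw, fst xw + snd xw) \<partial>(\<mu> \<Otimes>\<^sub>M density lborel (\<lambda>w. ennreal (K w))))"
    unfolding smoothing_coupling_def
    by (subst nn_integral_distr[OF smoothing_map_measurable]) (use ub in \<open>simp_all add: split_beta'\<close>)
  also have "\<dots> = (\<integral>\<^sup>+ x. (\<integral>\<^sup>+ w. u (x, x + w) \<partial>density lborel (\<lambda>w. ennreal (K w))) \<partial>\<mu>)"
    by (subst KP.nn_integral_fst[symmetric]) simp_all
  also have "\<dots> = (\<integral>\<^sup>+ x. (\<integral>\<^sup>+ w. ennreal (K w) * u (x, x + w) \<partial>lborel) \<partial>\<mu>)"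
    by (intro nn_integral_cong nn_integral_density) measurable
  finally show ?thesis .
qed

lemma marginals_smoothing_coupling:
  shows "distr smoothing_coupling borel fst = \<mu>"
    and "distr smoothing_coupling borel snd = density lborel (\<lambda>z. ennreal (f z))"
proof -
  have m: "fst \<in> smoothing_coupling \<rightarrow>\<^sub>M borel" "snd \<in> smoothing_coupling \<rightarrow>\<^sub>M borel"
    unfolding measurable_cong_sets[OF sets_smoothing_coupling refl] borel_prod[symmetric] by measurable
  show "distr smoothing_coupling borel fst = \<mu>"
  proof (rule measure_eqI)
    fix A assume "A \<in> sets (distr smoothing_coupling borel fst)"
    then have A[measurable]: "A \<in> sets borel" by simp
    have "emeasure (distr smoothing_coupling borel fst) A = (\<integral>\<^sup>+ x. (\<integral>\<^sup>+ w. ennreal (K w) * indicator A x \<partial>lborel) \<partial>\<mu>)"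
      unfolding emeasure_distr_eq_nn_integral[OF m(1) A]
      by (subst nn_integral_smoothing_coupling[OF measurable_compose[OF measurable_fst borel_measurable_indicator[OF A]]]) simp
    also have "\<dots> = (\<integral>\<^sup>+ x. indicator A x \<partial>\<mu>)"
      by (subst nn_integral_multc) (simp_all add: nn_integral_K)
    finally show "emeasure (distr smoothing_coupling borel fst) A = emeasure \<mu> A" by (simp add: sets_\<mu>)
  qed (simp add: sets_\<mu>)
  show "distr smoothing_coupling borel snd = density lborel (\<lambda>z. ennreal (f z))"
  proof (rule measure_eqI)
    fix A assume "A \<in> sets (distr smoothing_coupling borel snd)"
    then have A[measurable]: "A \<in> sets borel" by simp
    have "emeasure (distr smoothing_coupling borel snd) A = (\<integral>\<^sup>+ x. (\<integral>\<^sup>+ w. ennreal (K w) * indicator A (x + w) \<partial>lborel) \<partial>\<mu>)"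
      unfolding emeasure_distr_eq_nn_integral[OF m(2) A]
      by (subst nn_integral_smoothing_coupling[OF measurable_compose[OF measurable_snd borel_measurable_indicator[OF A]]]) simp
    also have "\<dots> = (\<integral>\<^sup>+ z. ennreal (f z) * indicator A z \<partial>lborel)"
      by (rule nn_integral_f[symmetric]) measurable
    finally show "emeasure (distr smoothing_coupling borel snd) A = emeasure (density lborel (\<lambda>z. ennreal (f z))) A"
      by (simp add: emeasure_density)
  qed simp
qed

lemma smoothing_cost:
  "(\<integral>\<^sup>+ w. ennreal (norm (fst w - snd w) powr p) \<partial>smoothing_coupling) = (\<integral>\<^sup>+ w. ennreal (K w) * ennreal (norm w powr p) \<partial>lborel)"
proof -
  have [measurable]: "(\<lambda>w :: (real ^ 'd) \<times> (real ^ 'd). norm (fst w - snd w)) \<in> borel_measurable (borel \<Otimes>\<^sub>M borel)"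
    by measurable
  have "(\<integral>\<^sup>+ w. ennreal (norm (fst w - snd w) powr p) \<partial>smoothing_coupling)
     = (\<integral>\<^sup>+ x. (\<integral>\<^sup>+ w. ennreal (K w) * ennreal (norm (x - (x + w)) powr p) \<partial>lborel) \<partial>\<mu>)"
    by (subst nn_integral_smoothing_coupling) simp_all
  then show ?thesis by (simp add: \<mu>.emeasure_space_1)
qed

definition g :: "(nat \<Rightarrow> real ^ 'd) \<Rightarrow> real ^ 'd \<Rightarrow> real" where
  "g Y z = 1 / (LINT z|lborel. max 0 (F Y z)) * max 0 (F Y z)"

definition f_moment :: "real \<Rightarrow> ennreal" where
  "f_moment p = (\<integral>\<^sup>+ z. ennreal (norm z powr p * f z) \<partial>lborel)"

text \<open>Apply \<open>exists_coupling_le\<close> to the smoothing coupling: the first term is the cost of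
smoothing, the second that of replacing \<open>f\<close> by the normalised positive part of \<open>F\<close>.\<close>

lemma wasserstein_estimator_le:
  assumes p: "p \<ge> 1"
  shows "ennreal_powr (wasserstein p \<mu> (density lborel (\<lambda>z. ennreal (g Y z)))) p \<le>
    ennreal (3 powr p) * ((\<integral>\<^sup>+ w. ennreal (K w) * ennreal (norm w powr p) \<partial>lborel)
      + (2 + f_moment p) * (\<integral>\<^sup>+ z. ennreal ((1 + norm z powr p) * \<bar>F Y z - f z\<bar>) \<partial>lborel))"
proof -
  let ?I = "LINT z|lborel. max 0 (F Y z)"
  have [measurable]: "F Y \<in> borel_measurable borel" using F_integrable[of Y] by simp
  have gm[measurable]: "g Y \<in> borel_measurable borel" unfolding g_def[abs_def] by measurable
  have Nm: "(\<lambda>z :: real ^ 'd. norm z powr p) \<in> borel_measurable borel" by measurable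
  note norm_le = positive_part_normalisation_le[OF f_measurable Nm f_nonneg nn_integral_f_one F_integrable[of Y] F_integral[of Y]]
  have g1: "(\<integral>\<^sup>+ z. ennreal (g Y z) \<partial>lborel) = 1"
    unfolding g_def by (rule norm_le(1)) simp
  have g0: "g Y z \<ge> 0" for z
    unfolding g_def by (intro mult_nonneg_nonneg divide_nonneg_nonneg integral_nonneg_AE) auto
  obtain \<pi> where \<pi>: "\<pi> \<in> couplings (distr smoothing_coupling borel fst) (density lborel (\<lambda>z. ennreal (g Y z)))"
    and cost: "(\<integral>\<^sup>+ w. ennreal (norm (fst w - snd w) powr p) \<partial>\<pi>) \<le>
      ennreal (3 powr p) * ((\<integral>\<^sup>+ w. ennreal (norm (fst w - snd w) powr p) \<partial>smoothing_coupling)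
        + (\<integral>\<^sup>+ z. ennreal (norm z powr p * \<bar>f z - g Y z\<bar>) \<partial>lborel))"
    using exists_coupling_le[OF p prob_space_smoothing_coupling sets_smoothing_coupling f_measurable gm
        f_nonneg g0 marginals_smoothing_coupling(2) g1] by blast
  have "ennreal_powr (wasserstein p \<mu> (density lborel (\<lambda>z. ennreal (g Y z)))) p \<le> (\<integral>\<^sup>+ w. ennreal (norm (fst w - snd w) powr p) \<partial>\<pi>)"
    using \<pi> unfolding marginals_smoothing_coupling(1) by (rule ennreal_powr_wasserstein_le[OF p])
  also note cost
  also have "(\<integral>\<^sup>+ z. ennreal (norm z powr p * \<bar>f z - g Y z\<bar>) \<partial>lborel)
     \<le> (2 + f_moment p) * (\<integral>\<^sup>+ z. ennreal ((1 + norm z powr p) * \<bar>F Y z - f z\<bar>) \<partial>lborel)"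
    unfolding g_def f_moment_def by (rule norm_le(2)) simp
  finally show ?thesis unfolding smoothing_cost by (simp add: mult_left_mono add_left_mono)
qed

lemma one_plus_norm_powr_le:
  fixes z :: "real ^ 'd"
  assumes p: "p \<ge> 0"
  shows "1 + norm z powr p \<le> (1 + real CARD('d) powr p) * (\<Sum>j\<in>UNIV. (1 + \<bar>z $ j\<bar>) powr p)"
proof -
  let ?S = "\<Sum>j\<in>UNIV. (1 + \<bar>z $ j\<bar>) powr p"
  have "1 \<le> (1 + \<bar>z $ undefined\<bar>) powr p" using p by (intro ge_one_powr_ge_zero) auto
  also have "\<dots> \<le> ?S" by (rule member_le_sum[of undefined UNIV "\<lambda>j. (1 + \<bar>z $ j\<bar>) powr p"]) auto
  finally have "1 \<le> ?S" .
  moreover have "norm z powr p \<le> real CARD('d) powr p * ?S"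
  proof -
    have "(\<Sum>j\<in>UNIV. \<bar>z $ j\<bar> powr p) \<le> ?S" using p by (intro sum_mono powr_mono2) auto
    then show ?thesis
      by (intro order_trans[OF norm_vec_powr_le[OF p]] mult_left_mono) auto
  qed
  ultimately show ?thesis by (simp add: distrib_right)
qed

lemma smoothing_bias_le:
  assumes p: "p \<ge> 0"
  shows "(\<integral>\<^sup>+ w. ennreal (K w) * ennreal (norm w powr p) \<partial>lborel)
    \<le> ennreal (real CARD('d) powr p) * (of_nat CARD('d) * (ennreal (h powr p) * (\<integral>\<^sup>+ v. ennreal (k v) * ennreal (\<bar>v\<bar> powr p) \<partial>lborel)))"
proof -
  let ?c = "real CARD('d) powr p"
  have 1: "(\<integral>\<^sup>+ w. ennreal (K w) * ennreal (\<bar>w $ j\<bar> powr p) \<partial>lborel) = ennreal (h powr p) * (\<integral>\<^sup>+ v. ennreal (k v) * ennreal (\<bar>v\<bar> powr p) \<partial>lborel)" for j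
  proof -
    have "(\<integral>\<^sup>+ w. ennreal (K w) * ennreal (\<bar>w $ j\<bar> powr p) \<partial>lborel) = (\<integral>\<^sup>+ v. ennreal (k v) * ennreal (\<bar>h * v\<bar> powr p) \<partial>lborel)"
      by (rule nn_integral_K_coord[of "\<lambda>t. ennreal (\<bar>t\<bar> powr p)"]) measurable
    also have "\<dots> = (\<integral>\<^sup>+ v. ennreal (h powr p) * (ennreal (k v) * ennreal (\<bar>v\<bar> powr p)) \<partial>lborel)"
      using h_pos by (intro nn_integral_cong) (simp add: abs_mult powr_mult ennreal_mult mult.left_commute)
    also have "\<dots> = ennreal (h powr p) * (\<integral>\<^sup>+ v. ennreal (k v) * ennreal (\<bar>v\<bar> powr p) \<partial>lborel)"
      by (rule nn_integral_cmult) measurable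
    finally show ?thesis .
  qed
  have "(\<integral>\<^sup>+ w. ennreal (K w) * ennreal (norm w powr p) \<partial>lborel)
    \<le> (\<integral>\<^sup>+ w. ennreal ?c * (\<Sum>j\<in>UNIV. ennreal (K w) * ennreal (\<bar>w $ j\<bar> powr p)) \<partial>lborel)"
  proof (rule nn_integral_mono)
    fix w :: "real ^ 'd"
    have "ennreal (norm w powr p) \<le> ennreal (?c * (\<Sum>j\<in>UNIV. \<bar>w $ j\<bar> powr p))"
      by (intro ennreal_leI norm_vec_powr_le p)
    also have "\<dots> = ennreal ?c * (\<Sum>j\<in>UNIV. ennreal (\<bar>w $ j\<bar> powr p))"
      by (subst ennreal_mult) (auto intro: sum_nonneg simp: sum_ennreal)
    finally have "ennreal (K w) * ennreal (norm w powr p) \<le> ennreal (K w) * (ennreal ?c * (\<Sum>j\<in>UNIV. ennreal (\<bar>w $ j\<bar> powr p)))"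
      by (rule mult_left_mono) simp
    then show "ennreal (K w) * ennreal (norm w powr p) \<le> ennreal ?c * (\<Sum>j\<in>UNIV. ennreal (K w) * ennreal (\<bar>w $ j\<bar> powr p))"
      by (simp only: sum_distrib_left[symmetric] mult.left_commute)
  qed
  also have "\<dots> = ennreal ?c * (\<Sum>j\<in>UNIV. \<integral>\<^sup>+ w. ennreal (K w) * ennreal (\<bar>w $ j\<bar> powr p) \<partial>lborel)"
    by (subst nn_integral_cmult, measurable, subst nn_integral_sum) measurable
  finally show ?thesis by (simp add: 1)
qed

lemma f_moment_le:
  assumes p: "p \<ge> 0"
  shows "f_moment p \<le> ennreal (real CARD('d) powr p) *
    (\<Sum>j\<in>UNIV. (\<integral>\<^sup>+ x. ennreal ((1 + \<bar>x $ j\<bar>) powr p) \<partial>\<mu>) * (\<integral>\<^sup>+ v. ennreal (k v) * ennreal ((1 + \<bar>h * v\<bar>) powr p) \<partial>lborel))"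
proof -
  let ?c = "real CARD('d) powr p"
  have 1: "(\<integral>\<^sup>+ z. ennreal (f z) * ennreal ((1 + \<bar>z $ j\<bar>) powr p) \<partial>lborel)
    \<le> (\<integral>\<^sup>+ x. ennreal ((1 + \<bar>x $ j\<bar>) powr p) \<partial>\<mu>) * (\<integral>\<^sup>+ v. ennreal (k v) * ennreal ((1 + \<bar>h * v\<bar>) powr p) \<partial>lborel)" for j
  proof -
    have "(\<integral>\<^sup>+ z. ennreal (f z) * ennreal ((1 + \<bar>z $ j\<bar>) powr p) \<partial>lborel)
      = (\<integral>\<^sup>+ x. (\<integral>\<^sup>+ w. ennreal (K w) * ennreal ((1 + \<bar>(x + w) $ j\<bar>) powr p) \<partial>lborel) \<partial>\<mu>)"
      by (rule nn_integral_f) measurable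
    also have "\<dots> \<le> (\<integral>\<^sup>+ x. (\<integral>\<^sup>+ w. ennreal ((1 + \<bar>x $ j\<bar>) powr p) * (ennreal (K w) * ennreal ((1 + \<bar>w $ j\<bar>) powr p)) \<partial>lborel) \<partial>\<mu>)"
    proof (intro nn_integral_mono)
      fix x w :: "real ^ 'd"
      have "ennreal ((1 + \<bar>(x + w) $ j\<bar>) powr p) \<le> ennreal ((1 + \<bar>x $ j\<bar>) powr p) * ennreal ((1 + \<bar>w $ j\<bar>) powr p)"
        using one_plus_abs_add_powr_le[OF p, of "x $ j" "w $ j"] by (simp add: ennreal_mult[symmetric] ennreal_leI)
      then have "ennreal (K w) * ennreal ((1 + \<bar>(x + w) $ j\<bar>) powr p) \<le> ennreal (K w) * (ennreal ((1 + \<bar>x $ j\<bar>) powr p) * ennreal ((1 + \<bar>w $ j\<bar>) powr p))"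
        by (rule mult_left_mono) simp
      then show "ennreal (K w) * ennreal ((1 + \<bar>(x + w) $ j\<bar>) powr p) \<le> ennreal ((1 + \<bar>x $ j\<bar>) powr p) * (ennreal (K w) * ennreal ((1 + \<bar>w $ j\<bar>) powr p))"
        by (simp only: mult.left_commute)
    qed
    also have "\<dots> = (\<integral>\<^sup>+ x. ennreal ((1 + \<bar>x $ j\<bar>) powr p) * (\<integral>\<^sup>+ w. ennreal (K w) * ennreal ((1 + \<bar>w $ j\<bar>) powr p) \<partial>lborel) \<partial>\<mu>)"
      by (intro nn_integral_cong nn_integral_cmult) measurable
    also have "\<dots> = (\<integral>\<^sup>+ x. ennreal ((1 + \<bar>x $ j\<bar>) powr p) \<partial>\<mu>) * (\<integral>\<^sup>+ w. ennreal (K w) * ennreal ((1 + \<bar>w $ j\<bar>) powr p) \<partial>lborel)"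
      by (rule nn_integral_multc) measurable
    also have "(\<integral>\<^sup>+ w. ennreal (K w) * ennreal ((1 + \<bar>w $ j\<bar>) powr p) \<partial>lborel) = (\<integral>\<^sup>+ v. ennreal (k v) * ennreal ((1 + \<bar>h * v\<bar>) powr p) \<partial>lborel)"
      by (rule nn_integral_K_coord[of "\<lambda>t. ennreal ((1 + \<bar>t\<bar>) powr p)"]) measurable
    finally show ?thesis .
  qed
  have "f_moment p \<le> (\<integral>\<^sup>+ z. ennreal ?c * (\<Sum>j\<in>UNIV. ennreal (f z) * ennreal ((1 + \<bar>z $ j\<bar>) powr p)) \<partial>lborel)"
    unfolding f_moment_def
  proof (rule nn_integral_mono)
    fix z :: "real ^ 'd"
    have "norm z powr p \<le> ?c * (\<Sum>j\<in>UNIV. (1 + \<bar>z $ j\<bar>) powr p)"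
      using p by (intro order_trans[OF norm_vec_powr_le[OF p]] mult_left_mono sum_mono powr_mono2) auto
    then have "norm z powr p * f z \<le> ?c * (\<Sum>j\<in>UNIV. (1 + \<bar>z $ j\<bar>) powr p) * f z"
      using f_nonneg by (rule mult_right_mono)
    also have "\<dots> = ?c * (\<Sum>j\<in>UNIV. f z * (1 + \<bar>z $ j\<bar>) powr p)"
      by (simp add: sum_distrib_left mult_ac)
    finally have "ennreal (norm z powr p * f z) \<le> ennreal (?c * (\<Sum>j\<in>UNIV. f z * (1 + \<bar>z $ j\<bar>) powr p))"
      by (rule ennreal_leI)
    also have "\<dots> = ennreal ?c * (\<Sum>j\<in>UNIV. ennreal (f z) * ennreal ((1 + \<bar>z $ j\<bar>) powr p))"
      using f_nonneg by (subst ennreal_mult) (auto intro!: sum_nonneg simp: sum_ennreal[symmetric] ennreal_mult)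
    finally show "ennreal (norm z powr p * f z) \<le> \<dots>" .
  qed
  also have "\<dots> = ennreal ?c * (\<Sum>j\<in>UNIV. \<integral>\<^sup>+ z. ennreal (f z) * ennreal ((1 + \<bar>z $ j\<bar>) powr p) \<partial>lborel)"
    by (subst nn_integral_cmult, measurable, subst nn_integral_sum) measurable
  also have "\<dots> \<le> ennreal ?c * (\<Sum>j\<in>UNIV. (\<integral>\<^sup>+ x. ennreal ((1 + \<bar>x $ j\<bar>) powr p) \<partial>\<mu>) * (\<integral>\<^sup>+ v. ennreal (k v) * ennreal ((1 + \<bar>h * v\<bar>) powr p) \<partial>lborel))"
    by (intro mult_left_mono sum_mono 1) simp
  finally show ?thesis .
qed

text \<open>The upper integral is monotone, so it is enough that the bound in \<open>wasserstein_estimator_le\<close> is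
measurable in the sample.\<close>

theorem risk_le:
  assumes p: "p \<ge> 1" and \<theta>: "\<theta> > 0"
  shows "(\<integral>\<^sup>+ Y. ennreal_powr (wasserstein p \<mu> (density lborel (\<lambda>z. ennreal (g Y z)))) p \<partial>Pi\<^sub>M {..<n} (\<lambda>_. law)) \<le>
    ennreal (3 powr p) * ((\<integral>\<^sup>+ w. ennreal (K w) * ennreal (norm w powr p) \<partial>lborel)
      + (2 + f_moment p) * (ennreal (1 + real CARD('d) powr p) *
        (\<Sum>j\<in>UNIV. ennreal (\<theta> / 2) * (\<integral>\<^sup>+ t. ennreal ((1 + \<bar>t\<bar>) powr (- a)) \<partial>lborel) ^ CARD('d)
          + ennreal (1 / (2 * \<theta> * real n)) * second_moment (exps a p j))))"
proof -
  let ?P = "Pi\<^sub>M {..<n} (\<lambda>_. law)"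
  interpret P: prob_space ?P by (intro prob_space_PiM law.prob_space_axioms)
  let ?c = "1 + real CARD('d) powr p"
  let ?bias = "\<integral>\<^sup>+ w. ennreal (K w) * ennreal (norm w powr p) \<partial>lborel"
  let ?H = "\<lambda>Y. \<integral>\<^sup>+ z. ennreal ((1 + norm z powr p) * \<bar>F Y z - f z\<bar>) \<partial>lborel"
  let ?E = "\<lambda>j Y. \<integral>\<^sup>+ z. ennreal ((1 + \<bar>z $ j\<bar>) powr p * \<bar>F Y z - f z\<bar>) \<partial>lborel"
  have Em[measurable]: "?E j \<in> borel_measurable ?P" for j by measurable
  have Hm[measurable]: "?H \<in> borel_measurable ?P" by measurable
  have HE: "?H Y \<le> ennreal ?c * (\<Sum>j\<in>UNIV. ?E j Y)" for Y
  proof -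
    have [measurable]: "F Y \<in> borel_measurable borel" using F_integrable[of Y] by simp
    have "?H Y \<le> (\<integral>\<^sup>+ z. ennreal ?c * (\<Sum>j\<in>UNIV. ennreal ((1 + \<bar>z $ j\<bar>) powr p * \<bar>F Y z - f z\<bar>)) \<partial>lborel)"
    proof (rule nn_integral_mono)
      fix z :: "real ^ 'd"
      have "(1 + norm z powr p) * \<bar>F Y z - f z\<bar> \<le> ?c * (\<Sum>j\<in>UNIV. (1 + \<bar>z $ j\<bar>) powr p) * \<bar>F Y z - f z\<bar>"
        using p by (intro mult_right_mono one_plus_norm_powr_le) auto
      also have "\<dots> = ?c * (\<Sum>j\<in>UNIV. (1 + \<bar>z $ j\<bar>) powr p * \<bar>F Y z - f z\<bar>)"
        by (simp only: sum_distrib_right mult.assoc)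
      finally have "ennreal ((1 + norm z powr p) * \<bar>F Y z - f z\<bar>) \<le> ennreal (?c * (\<Sum>j\<in>UNIV. (1 + \<bar>z $ j\<bar>) powr p * \<bar>F Y z - f z\<bar>))"
        by (rule ennreal_leI)
      also have "\<dots> = ennreal ?c * ennreal (\<Sum>j\<in>UNIV. (1 + \<bar>z $ j\<bar>) powr p * \<bar>F Y z - f z\<bar>)"
        by (intro ennreal_mult add_nonneg_nonneg sum_nonneg) auto
      also have "ennreal (\<Sum>j\<in>UNIV. (1 + \<bar>z $ j\<bar>) powr p * \<bar>F Y z - f z\<bar>) = (\<Sum>j\<in>UNIV. ennreal ((1 + \<bar>z $ j\<bar>) powr p * \<bar>F Y z - f z\<bar>))"
        by (intro sum_ennreal[symmetric]) auto
      finally show "ennreal ((1 + norm z powr p) * \<bar>F Y z - f z\<bar>) \<le> ennreal ?c * (\<Sum>j\<in>UNIV. ennreal ((1 + \<bar>z $ j\<bar>) powr p * \<bar>F Y z - f z\<bar>))" .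
    qed
    also have "\<dots> = ennreal ?c * (\<Sum>j\<in>UNIV. ?E j Y)"
      by (subst nn_integral_cmult, measurable, subst nn_integral_sum) measurable
    finally show ?thesis .
  qed
  have "(\<integral>\<^sup>+ Y. ennreal_powr (wasserstein p \<mu> (density lborel (\<lambda>z. ennreal (g Y z)))) p \<partial>?P)
    \<le> (\<integral>\<^sup>+ Y. ennreal (3 powr p) * (?bias + (2 + f_moment p) * ?H Y) \<partial>?P)"
    by (intro nn_integral_mono wasserstein_estimator_le p)
  also have "\<dots> = ennreal (3 powr p) * (?bias + (2 + f_moment p) * (\<integral>\<^sup>+ Y. ?H Y \<partial>?P))"
    by (subst nn_integral_cmult, measurable, subst nn_integral_add, measurable, subst nn_integral_cmult, measurable)
       (simp add: P.emeasure_space_1)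
  also have "(\<integral>\<^sup>+ Y. ?H Y \<partial>?P) \<le> (\<integral>\<^sup>+ Y. ennreal ?c * (\<Sum>j\<in>UNIV. ?E j Y) \<partial>?P)"
    by (intro nn_integral_mono HE)
  also have "\<dots> = ennreal ?c * (\<Sum>j\<in>UNIV. \<integral>\<^sup>+ Y. ?E j Y \<partial>?P)"
    by (subst nn_integral_cmult, measurable, subst nn_integral_sum) measurable
  also have "\<dots> \<le> ennreal ?c * (\<Sum>j\<in>UNIV. ennreal (\<theta> / 2) * (\<integral>\<^sup>+ t. ennreal ((1 + \<bar>t\<bar>) powr (- a)) \<partial>lborel) ^ CARD('d)
          + ennreal (1 / (2 * \<theta> * real n)) * second_moment (exps a p j))"
    by (intro mult_left_mono sum_mono expected_weighted_L1_error_le \<theta>) simp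
  finally show ?thesis by (simp add: mult_left_mono add_left_mono)
qed

end

section \<open>The rate of convergence\<close>

text \<open>The choice \<open>\<theta> = h\<^sup>p\<close> makes the deterministic half of the stochastic error comparable to the
smoothing cost; the other half is divided by \<open>n\<close>.\<close>

lemma (in product_estimator) risk_le_real:
  assumes p: "p \<ge> 1" and nonneg: "0 \<le> V" "0 \<le> m1" "0 \<le> m2" "0 \<le> W" "0 \<le> N" "0 \<le> A" and a: "a \<ge> 0"
    and V: "(\<integral>\<^sup>+ t. ennreal ((1 + \<bar>t\<bar>) powr (- a)) \<partial>lborel) \<le> ennreal V"
    and m1: "(\<integral>\<^sup>+ v. ennreal (k v) * ennreal (\<bar>v\<bar> powr p) \<partial>lborel) \<le> ennreal m1"
    and m2: "(\<integral>\<^sup>+ v. ennreal (k v) * ennreal ((1 + \<bar>h * v\<bar>) powr p) \<partial>lborel) \<le> ennreal m2"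
    and W: "\<And>j. (\<integral>\<^sup>+ x. ennreal (weight (exps a p j) x) \<partial>\<mu>) \<le> ennreal W"
    and N: "\<And>j l. (\<integral>\<^sup>+ e. ennreal ((1 + \<bar>e\<bar>) powr exps a p j l) \<partial>\<nu> l) \<le> ennreal N"
    and A: "\<And>j l. (\<integral>\<^sup>+ v. ennreal ((1 + \<bar>h * v\<bar>) powr exps a p j l * (1 / h * (\<kappa> l v)\<^sup>2)) \<partial>lborel) \<le> ennreal A"
  shows "(\<integral>\<^sup>+ Y. ennreal_powr (wasserstein p \<mu> (density lborel (\<lambda>z. ennreal (g Y z)))) p \<partial>Pi\<^sub>M {..<n} (\<lambda>_. law)) \<le>
    ennreal (3 powr p * (real CARD('d) powr p * (real CARD('d) * (h powr p * m1))
      + (2 + real CARD('d) powr p * (real CARD('d) * (W * m2))) * ((1 + real CARD('d) powr p) *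
        (real CARD('d) * (h powr p / 2 * V ^ CARD('d)
          + 1 / (2 * h powr p * real n) * (W * N ^ CARD('d) * A ^ CARD('d)))))))"
proof -
  let ?d = "CARD('d)" and ?c = "real CARD('d) powr p"
  have p0: "p \<ge> 0" using p by simp
  have bias: "(\<integral>\<^sup>+ w. ennreal (K w) * ennreal (norm w powr p) \<partial>lborel) \<le> ennreal (?c * (real ?d * (h powr p * m1)))"
  proof -
    have "(\<integral>\<^sup>+ w. ennreal (K w) * ennreal (norm w powr p) \<partial>lborel)
       \<le> ennreal ?c * (of_nat ?d * (ennreal (h powr p) * ennreal m1))"
      by (intro order_trans[OF smoothing_bias_le[OF p0]] mult_left_mono m1) auto
    also have "\<dots> = ennreal (?c * (real ?d * (h powr p * m1)))"
      using nonneg by (simp add: ennreal_mult ennreal_of_nat_eq_real_of_nat)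
    finally show ?thesis .
  qed
  have fm: "f_moment p \<le> ennreal (?c * (real ?d * (W * m2)))"
  proof -
    have 1: "(\<integral>\<^sup>+ x. ennreal ((1 + \<bar>x $ j\<bar>) powr p) \<partial>\<mu>) \<le> ennreal W" for j
    proof (rule order_trans[OF nn_integral_mono W[of j]])
      fix x :: "real ^ 'd"
      have ge1: "1 \<le> (\<Prod>l\<in>UNIV. (1 + \<bar>x $ l\<bar>) powr a)"
        using a by (intro prod_ge_1 ge_one_powr_ge_zero) auto
      have P1: "1 \<le> (1 + \<bar>x $ j\<bar>) powr p" using p by (intro ge_one_powr_ge_zero) auto
      have "(1 + \<bar>x $ j\<bar>) powr p * 1 \<le> (1 + \<bar>x $ j\<bar>) powr p * (1 + \<bar>x $ j\<bar>) powr p"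
        using P1 by (intro mult_left_mono) auto
      also have "\<dots> = 1 * ((1 + \<bar>x $ j\<bar>) powr p)\<^sup>2" by (simp add: power2_eq_square)
      also have "\<dots> \<le> weight (exps a p j) x"
        unfolding weight_exps using ge1 by (intro mult_right_mono) auto
      finally show "ennreal ((1 + \<bar>x $ j\<bar>) powr p) \<le> ennreal (weight (exps a p j) x)"
        by (intro ennreal_leI) simp
    qed
    have "f_moment p \<le> ennreal ?c * (\<Sum>j\<in>(UNIV :: 'd set). ennreal W * ennreal m2)"
      by (intro order_trans[OF f_moment_le[OF p0]] mult_left_mono sum_mono mult_mono 1 m2) auto
    also have "\<dots> = ennreal (?c * (real ?d * (W * m2)))"
      using nonneg by (simp add: ennreal_mult ennreal_of_nat_eq_real_of_nat)
    finally show ?thesis .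
  qed
  have sm: "second_moment (exps a p j) \<le> ennreal (W * N ^ ?d * A ^ ?d)" for j
  proof -
    have s0: "0 \<le> exps a p j l" for l using a p0 by (simp add: exps_def)
    have "second_moment (exps a p j) \<le> ennreal W * (\<Prod>l\<in>(UNIV :: 'd set). ennreal N) * (\<Prod>l\<in>(UNIV :: 'd set). ennreal A)"
      by (intro order_trans[OF second_moment_le[OF s0]] mult_mono prod_mono_ennreal W N A) auto
    also have "\<dots> = ennreal (W * N ^ ?d * A ^ ?d)"
      using nonneg by (simp add: ennreal_mult ennreal_power)
    finally show ?thesis .
  qed
  let ?S = "h powr p / 2 * V ^ ?d + 1 / (2 * h powr p * real n) * (W * N ^ ?d * A ^ ?d)"
  have hp: "h powr p > 0" using h_pos by simp
  have S0: "0 \<le> ?S" using nonneg hp by (intro add_nonneg_nonneg mult_nonneg_nonneg) auto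
  have S: "ennreal (h powr p / 2) * (\<integral>\<^sup>+ t. ennreal ((1 + \<bar>t\<bar>) powr (- a)) \<partial>lborel) ^ ?d
          + ennreal (1 / (2 * h powr p * real n)) * second_moment (exps a p j) \<le> ennreal ?S" for j
  proof -
    have "ennreal (h powr p / 2) * (\<integral>\<^sup>+ t. ennreal ((1 + \<bar>t\<bar>) powr (- a)) \<partial>lborel) ^ ?d
          + ennreal (1 / (2 * h powr p * real n)) * second_moment (exps a p j)
       \<le> ennreal (h powr p / 2) * ennreal V ^ ?d + ennreal (1 / (2 * h powr p * real n)) * ennreal (W * N ^ ?d * A ^ ?d)"
      by (intro add_mono mult_left_mono power_mono V sm) auto
    also have "ennreal (h powr p / 2) * ennreal V ^ ?d = ennreal (h powr p / 2 * V ^ ?d)"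
      unfolding ennreal_power[OF nonneg(1)] using nonneg by (intro ennreal_mult[symmetric]) auto
    also have "ennreal (1 / (2 * h powr p * real n)) * ennreal (W * N ^ ?d * A ^ ?d)
       = ennreal (1 / (2 * h powr p * real n) * (W * N ^ ?d * A ^ ?d))"
      using nonneg hp by (intro ennreal_mult[symmetric] mult_nonneg_nonneg) auto
    also have "ennreal (h powr p / 2 * V ^ ?d) + ennreal (1 / (2 * h powr p * real n) * (W * N ^ ?d * A ^ ?d)) = ennreal ?S"
      using nonneg hp by (intro ennreal_plus[symmetric] mult_nonneg_nonneg) auto
    finally show ?thesis .
  qed
  let ?B = "?c * (real ?d * (W * m2))"
  have B0: "0 \<le> ?B" using nonneg by (intro mult_nonneg_nonneg) auto
  have two: "2 + ennreal x = ennreal (2 + x)" if "0 \<le> x" for x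
    using that by (subst ennreal_plus) simp_all
  have "(\<integral>\<^sup>+ Y. ennreal_powr (wasserstein p \<mu> (density lborel (\<lambda>z. ennreal (g Y z)))) p \<partial>Pi\<^sub>M {..<n} (\<lambda>_. law)) \<le>
    ennreal (3 powr p) * (ennreal (?c * (real ?d * (h powr p * m1)))
      + (2 + ennreal ?B) * (ennreal (1 + ?c) * (\<Sum>j\<in>(UNIV :: 'd set). ennreal ?S)))"
    by (intro order_trans[OF risk_le[OF p hp, of a]] mult_left_mono add_mono mult_mono bias fm sum_mono S order_refl) auto
  also have "\<dots> = ennreal (3 powr p * (?c * (real ?d * (h powr p * m1)) + (2 + ?B) * ((1 + ?c) * (real ?d * ?S))))"
  proof -
    have "ennreal (3 powr p) * (ennreal b + (2 + ennreal B) * (ennreal D * (\<Sum>j\<in>(UNIV :: 'd set). ennreal S)))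
       = ennreal (3 powr p * (b + (2 + B) * (D * (real ?d * S))))"
      if "0 \<le> b" "0 \<le> B" "0 \<le> D" "0 \<le> S" for b B D S :: real
      using that by (simp add: ennreal_mult ennreal_of_nat_eq_real_of_nat)
    moreover have "0 \<le> ?c * (real ?d * (h powr p * m1))" using nonneg by (intro mult_nonneg_nonneg) auto
    moreover have "0 \<le> 1 + ?c" by (intro add_nonneg_nonneg) auto
    ultimately show ?thesis using S0 B0 by blast
  qed
  finally show ?thesis .
qed

text \<open>The bound for one coordinate of the weighted second moment when \<open>G\<close> bounds the derivatives of the
reciprocal characteristic function.\<close>

definition coord_bound :: "real \<Rightarrow> real \<Rightarrow> real \<Rightarrow> real" where
  "coord_bound p G h = (max 1 h) ^ (2 * deriv_order p) * 4 ^ deriv_order p * (1 / h) *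
     (deconv_const p * (G * (max 1 (1 / h)) ^ deriv_order p)\<^sup>2)"

lemma deconv_const_nonneg: "deconv_const p \<ge> 0"
  unfolding deconv_const_def by (intro mult_nonneg_nonneg) auto

lemma (in deconvolution) weighted_deconv_kernel_le:
  assumes \<tau>: "\<tau> > 1" and G0: "G \<ge> 0"
    and G: "\<And>l t. l \<le> q \<Longrightarrow> \<bar>t\<bar> \<le> \<tau> / h \<Longrightarrow> norm (higher_derivative l (recip_char \<nu>) t) \<le> G"
    and s: "s \<le> 2 * real q"
  shows "(\<integral>\<^sup>+ v. ennreal ((1 + \<bar>h * v\<bar>) powr s * (1 / h * (deconv_kernel p \<nu> h v)\<^sup>2)) \<partial>lborel)
    \<le> ennreal (coord_bound p G h)"
proof -
  let ?c = "(max 1 h) ^ (2 * q) * 4 ^ q * (1 / h)"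
  have c0: "0 \<le> ?c" using h by simp
  have pw: "(1 + \<bar>h * v\<bar>) powr s \<le> (max 1 h) ^ (2 * q) * 4 ^ q * (1 + v ^ (2 * q))" for v
  proof -
    have "(1 + \<bar>h * v\<bar>) powr s \<le> (1 + \<bar>h * v\<bar>) powr real (2 * q)"
      using s by (intro powr_mono) auto
    also have "\<dots> = (1 + \<bar>h * v\<bar>) ^ (2 * q)" by (rule powr_realpow) (simp add: add_pos_nonneg)
    also have "\<dots> \<le> (max 1 h * (2 * max 1 \<bar>v\<bar>)) ^ (2 * q)"
    proof (rule power_mono)
      have "h * \<bar>v\<bar> \<le> max 1 h * max 1 \<bar>v\<bar>" using h by (intro mult_mono) auto
      moreover have "1 * 1 \<le> max 1 h * max 1 \<bar>v\<bar>" by (intro mult_mono) auto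
      ultimately show "1 + \<bar>h * v\<bar> \<le> max 1 h * (2 * max 1 \<bar>v\<bar>)" using h by (simp add: abs_mult)
    qed simp
    also have "\<dots> = (max 1 h) ^ (2 * q) * 4 ^ q * (max 1 \<bar>v\<bar>) ^ (2 * q)"
      by (simp add: power_mult_distrib power_mult)
    also have "\<dots> \<le> (max 1 h) ^ (2 * q) * 4 ^ q * (1 + v ^ (2 * q))"
    proof (rule mult_left_mono)
      have "\<bar>v\<bar> ^ (2 * q) = v ^ (2 * q)" by (simp add: power_even_abs)
      moreover have "0 \<le> v ^ (2 * q)" by (rule zero_le_even_power')
      ultimately show "(max 1 \<bar>v\<bar>) ^ (2 * q) \<le> 1 + v ^ (2 * q)" by (simp add: max_def)
    qed simp
    finally show ?thesis .
  qed
  have "(\<integral>\<^sup>+ v. ennreal ((1 + \<bar>h * v\<bar>) powr s * (1 / h * (deconv_kernel p \<nu> h v)\<^sup>2)) \<partial>lborel)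
    \<le> (\<integral>\<^sup>+ v. ennreal ?c * ennreal ((1 + v ^ (2 * q)) * (deconv_kernel p \<nu> h v)\<^sup>2) \<partial>lborel)"
  proof (rule nn_integral_mono)
    fix v
    have "(1 + \<bar>h * v\<bar>) powr s * (1 / h * (deconv_kernel p \<nu> h v)\<^sup>2)
      \<le> (max 1 h) ^ (2 * q) * 4 ^ q * (1 + v ^ (2 * q)) * (1 / h * (deconv_kernel p \<nu> h v)\<^sup>2)"
      using h by (intro mult_right_mono pw) auto
    also have "\<dots> = ?c * ((1 + v ^ (2 * q)) * (deconv_kernel p \<nu> h v)\<^sup>2)" by (simp only: mult_ac)
    finally have "ennreal ((1 + \<bar>h * v\<bar>) powr s * (1 / h * (deconv_kernel p \<nu> h v)\<^sup>2)) \<le> ennreal (?c * ((1 + v ^ (2 * q)) * (deconv_kernel p \<nu> h v)\<^sup>2))"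
      by (rule ennreal_leI)
    also have "\<dots> = ennreal ?c * ennreal ((1 + v ^ (2 * q)) * (deconv_kernel p \<nu> h v)\<^sup>2)"
      using h by (intro ennreal_mult mult_nonneg_nonneg add_nonneg_nonneg zero_le_even_power') auto
    finally show "ennreal ((1 + \<bar>h * v\<bar>) powr s * (1 / h * (deconv_kernel p \<nu> h v)\<^sup>2)) \<le> \<dots>" .
  qed
  also have "\<dots> = ennreal ?c * (\<integral>\<^sup>+ v. ennreal ((1 + v ^ (2 * q)) * (deconv_kernel p \<nu> h v)\<^sup>2) \<partial>lborel)"
    by (rule nn_integral_cmult) measurable
  also have "\<dots> \<le> ennreal ?c * ennreal (deconv_const p * (G * (max 1 (1 / h)) ^ q)\<^sup>2)"
    by (intro mult_left_mono nn_integral_moment_deconv_kernel_le[OF \<tau> G0]) (use G in auto)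
  also have "\<dots> = ennreal (coord_bound p G h)"
    unfolding coord_bound_def using h deconv_const_nonneg by (intro ennreal_mult[symmetric] mult_nonneg_nonneg) auto
  finally show ?thesis .
qed

text \<open>Exponential decay beats any power; \<open>ln t \<le> t - 1\<close> at \<open>t = (1 + x) / (4 b)\<close> gives an explicit
constant.\<close>

lemma powr_mult_exp_bounded:
  fixes b :: real
  assumes b: "b > 0"
  shows "\<exists>C>0. \<forall>x\<ge>0. (1 + x) powr b * exp (- x / 4) \<le> C"
proof (intro exI conjI allI impI)
  let ?\<delta> = "1 / (4 * b)"
  show "0 < exp (- b - b * ln ?\<delta> + 1 / 4)" by simp
  fix x :: real assume x: "x \<ge> 0"
  have "ln (?\<delta> * (1 + x)) \<le> ?\<delta> * (1 + x) - 1" using b x by (intro ln_le_minus_one) auto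
  moreover have "ln (?\<delta> * (1 + x)) = ln ?\<delta> + ln (1 + x)" using b x by (intro ln_mult_pos) auto
  ultimately have "b * ln (1 + x) \<le> b * (?\<delta> * (1 + x) - 1 - ln ?\<delta>)" using b by (intro mult_left_mono) auto
  also have "\<dots> = (1 + x) / 4 - b - b * ln ?\<delta>" using b by (simp add: right_diff_distrib)
  finally have "exp (b * ln (1 + x)) * exp (- x / 4) \<le> exp (- b - b * ln ?\<delta> + 1 / 4)"
    unfolding exp_add[symmetric] by (simp add: field_simps)
  then show "(1 + x) powr b * exp (- x / 4) \<le> exp (- b - b * ln ?\<delta> + 1 / 4)"
    using x by (simp add: powr_def)
qed

text \<open>Write \<open>x = ln n\<close>. The bandwidth satisfies \<open>h\<^sup>-\<^sup>\<beta> = \<gamma> x / (4 d)\<close>, so the exponential in the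
derivative bound is \<open>exp (3 x / (8 d))\<close>. Squared and multiplied over \<open>d\<close> coordinates it becomes
\<open>exp (3 x / 4)\<close>, against \<open>n = exp x\<close> on the right; the spare factor \<open>exp (- x / 4)\<close> absorbs all powers
of \<open>1/h\<close>, that is, of \<open>x\<close>.\<close>

lemma coord_bound_rate:
  fixes \<beta> \<beta>' \<gamma> c p :: real and d :: nat
  assumes \<beta>: "\<beta> > 0" and \<beta>': "\<beta>' \<ge> 0" and \<gamma>: "\<gamma> > 0" and c: "c > 0" and p: "p \<ge> 1" and d: "d > 0"
  defines "H \<equiv> \<lambda>n :: nat. (4 * real d / (\<gamma> * ln (real n))) powr (1 / \<beta>)"
    and "T \<equiv> \<lambda>h. (3 / 2) powr (1 / \<beta>) / h"
  shows "\<exists>C>0. \<forall>n\<ge>2. coord_bound p (c * (2 + T (H n) powr \<beta>') * exp (T (H n) powr \<beta> / \<gamma>)) (H n) ^ d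
    \<le> C * (H n powr p * H n powr p * real n)"
proof -
  let ?q = "deriv_order p"
  let ?\<tau> = "(3 / 2 :: real) powr (1 / \<beta>)"
  define H0 where "H0 = max 1 (H 2)"
  define C0 where "C0 = H0 ^ (2 * ?q) * 4 ^ ?q * (deconv_const p * (c * (2 + ?\<tau> powr \<beta>'))\<^sup>2)"
  define E where "E = 1 + 2 * \<beta>' + 2 * real ?q"
  define M where "M = real d * E + 2 * p"
  define c3 where "c3 = max 1 ((\<gamma> / (4 * real d)) powr (1 / \<beta>))"
  have E0: "E > 0" using \<beta>' by (simp add: E_def)
  have M0: "M > 0" using E0 p d by (simp add: M_def add_nonneg_pos)
  obtain C1 where C1: "C1 > 0" "\<And>x. x \<ge> 0 \<Longrightarrow> (1 + x) powr (M / \<beta>) * exp (- x / 4) \<le> C1"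
    using powr_mult_exp_bounded[of "M / \<beta>"] M0 \<beta> by auto
  have C00: "C0 \<ge> 0" unfolding C0_def H0_def using deconv_const_nonneg by (intro mult_nonneg_nonneg) auto
  have c31: "c3 \<ge> 1" by (simp add: c3_def)
  have main: "coord_bound p (c * (2 + T (H n) powr \<beta>') * exp (T (H n) powr \<beta> / \<gamma>)) (H n) ^ d
     \<le> (C0 ^ d * c3 powr M * C1) * (H n powr p * H n powr p * real n)" if n: "n \<ge> 2" for n
  proof -
    define x where "x = ln (real n)"
    have x2: "x \<ge> ln 2" using n by (simp add: x_def)
    have x0: "x > 0" by (rule less_le_trans[OF _ x2]) simp
    define h where "h = H n"
    have h: "h > 0" unfolding h_def H_def using x0 \<gamma> d by (simp add: x_def)
    have hH0: "max 1 h \<le> H0"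
    proof -
      have "4 * real d / (\<gamma> * x) \<le> 4 * real d / (\<gamma> * ln 2)"
        using x2 x0 \<gamma> d by (intro divide_left_mono mult_left_mono mult_pos_pos) auto
      then have "h \<le> H 2" unfolding h_def H_def x_def[symmetric]
        using \<beta> \<gamma> x0 by (intro powr_mono2) auto
      then show ?thesis by (simp add: H0_def)
    qed
    have y: "1 / h = (\<gamma> * x / (4 * real d)) powr (1 / \<beta>)"
    proof -
      have inv_powr: "1 / (A powr b) = (1 / A) powr b" if "A > 0" for A b :: real
        using that by (simp add: powr_divide)
      have "1 / h = (1 / (4 * real d / (\<gamma> * x))) powr (1 / \<beta>)"
        unfolding h_def H_def x_def[symmetric] using x0 \<gamma> d by (intro inv_powr divide_pos_pos mult_pos_pos) auto
      then show ?thesis by simp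
    qed
    have hb: "(1 / h) powr \<beta> = \<gamma> * x / (4 * real d)"
      unfolding y using \<beta> x0 \<gamma> d by (simp add: powr_powr)
    define Y where "Y = max 1 (1 / h)"
    have Y1: "Y \<ge> 1" and Yh: "1 / h \<le> Y" by (simp_all add: Y_def)
    have T: "T h = ?\<tau> * (1 / h)" by (simp add: T_def)
    have Texp: "T h powr \<beta> / \<gamma> = 3 * x / (8 * real d)"
    proof -
      have "T h powr \<beta> = ?\<tau> powr \<beta> * (1 / h) powr \<beta>" unfolding T using h by (intro powr_mult) 
      also have "?\<tau> powr \<beta> = 3 / 2" using \<beta> by (simp add: powr_powr)
      finally show ?thesis unfolding hb using \<gamma> by simp
    qed
    have Tb: "2 + T h powr \<beta>' \<le> (2 + ?\<tau> powr \<beta>') * Y powr \<beta>'"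
    proof -
      have "T h powr \<beta>' = ?\<tau> powr \<beta>' * (1 / h) powr \<beta>'" unfolding T using h by (intro powr_mult) 
      also have "\<dots> \<le> ?\<tau> powr \<beta>' * Y powr \<beta>'"
        using Yh h \<beta>' by (intro mult_left_mono powr_mono2) auto
      finally have "T h powr \<beta>' \<le> ?\<tau> powr \<beta>' * Y powr \<beta>'" .
      moreover have "1 \<le> Y powr \<beta>'" using Y1 \<beta>' by (rule ge_one_powr_ge_zero)
      ultimately show ?thesis by (simp add: distrib_right)
    qed
    let ?e = "exp (3 * x / (8 * real d))"
    let ?G = "c * (2 + T h powr \<beta>') * ?e"
    have G: "?G * Y ^ ?q \<le> c * (2 + ?\<tau> powr \<beta>') * ?e * Y powr (\<beta>' + real ?q)"
    proof -
      have "?G * Y ^ ?q \<le> c * ((2 + ?\<tau> powr \<beta>') * Y powr \<beta>') * ?e * Y ^ ?q"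
        using Tb c Y1 by (intro mult_right_mono mult_left_mono) auto
      also have "\<dots> = c * (2 + ?\<tau> powr \<beta>') * ?e * (Y powr \<beta>' * Y ^ ?q)" by (simp only: mult_ac)
      also have "Y powr \<beta>' * Y ^ ?q = Y powr (\<beta>' + real ?q)" using Y1 by (simp add: powr_add powr_realpow)
      finally show ?thesis .
    qed
    have G0: "0 \<le> ?G * Y ^ ?q" using c Y1 by (intro mult_nonneg_nonneg add_nonneg_nonneg) auto
    \<comment> \<open>\<open>max 1 h\<close> is bounded since \<open>h\<close> decreases in \<open>n\<close>; everything else is a power of \<open>Y = max 1 (1/h)\<close>.\<close>
    have "coord_bound p ?G h \<le> H0 ^ (2 * ?q) * 4 ^ ?q * Y * (deconv_const p * (c * (2 + ?\<tau> powr \<beta>') * ?e * Y powr (\<beta>' + real ?q))\<^sup>2)"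
      unfolding coord_bound_def Y_def[symmetric]
    proof (rule mult_mono)
      have "max 1 h ^ (2 * ?q) \<le> H0 ^ (2 * ?q)" using hH0 by (intro power_mono) auto
      then show "max 1 h ^ (2 * ?q) * 4 ^ ?q * (1 / h) \<le> H0 ^ (2 * ?q) * 4 ^ ?q * Y"
        using Yh h by (intro mult_mono mult_nonneg_nonneg) auto
      show "deconv_const p * (?G * Y ^ ?q)\<^sup>2 \<le> deconv_const p * (c * (2 + ?\<tau> powr \<beta>') * ?e * Y powr (\<beta>' + real ?q))\<^sup>2"
        by (intro mult_left_mono power_mono G G0 deconv_const_nonneg)
      show "0 \<le> H0 ^ (2 * ?q) * 4 ^ ?q * Y" using Y1 by (simp add: H0_def)
      show "0 \<le> deconv_const p * (?G * Y ^ ?q)\<^sup>2" using deconv_const_nonneg by simp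
    qed
    also have "\<dots> = C0 * (Y * (Y powr (\<beta>' + real ?q))\<^sup>2) * ?e\<^sup>2"
      unfolding C0_def power_mult_distrib by (simp only: mult_ac)
    also have "Y * (Y powr (\<beta>' + real ?q))\<^sup>2 = Y powr E"
    proof -
      have "(Y powr (\<beta>' + real ?q))\<^sup>2 = Y powr (2 * (\<beta>' + real ?q))"
        by (simp add: power2_eq_square powr_add[symmetric])
      then have "Y * (Y powr (\<beta>' + real ?q))\<^sup>2 = Y powr 1 * Y powr (2 * (\<beta>' + real ?q))" using Y1 by simp
      also have "\<dots> = Y powr E" unfolding powr_add[symmetric] E_def by (simp add: algebra_simps)
      finally show ?thesis .
    qed
    also have "?e\<^sup>2 = exp (3 * x / (4 * real d))"
      by (simp add: power2_eq_square exp_add[symmetric] field_simps)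
    finally have cb: "coord_bound p ?G h \<le> C0 * Y powr E * exp (3 * x / (4 * real d))" .
    have cb0: "0 \<le> coord_bound p ?G h"
      unfolding coord_bound_def using h deconv_const_nonneg by (intro mult_nonneg_nonneg) auto
    have "coord_bound p ?G h ^ d \<le> (C0 * Y powr E * exp (3 * x / (4 * real d))) ^ d"
      using cb cb0 by (rule power_mono)
    also have "\<dots> = C0 ^ d * Y powr (real d * E) * exp (3 * x / 4)"
    proof -
      have "(Y powr E) ^ d = Y powr (real d * E)" using Y1 by (simp add: powr_realpow[symmetric] powr_powr mult.commute)
      moreover have "exp (3 * x / (4 * real d)) ^ d = exp (3 * x / 4)"
        using d by (simp add: exp_of_nat_mult[symmetric])
      ultimately show ?thesis by (simp add: power_mult_distrib)
    qed
    finally have step: "coord_bound p ?G h ^ d \<le> C0 ^ d * Y powr (real d * E) * exp (3 * x / 4)" .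
    have hp1: "1 \<le> Y powr (2 * p) * (h powr p * h powr p)"
    proof -
      have "1 = (1 / h) powr (2 * p) * h powr (2 * p)" using h by (subst powr_mult[symmetric]) auto
      also have "\<dots> \<le> Y powr (2 * p) * h powr (2 * p)"
        using Yh h p by (intro mult_right_mono powr_mono2) auto
      also have "h powr (2 * p) = h powr p * h powr p" by (simp add: powr_add[symmetric])
      finally show ?thesis .
    qed
    have YM: "Y powr M * exp (- x / 4) \<le> c3 powr M * C1"
    proof -
      have "1 / h = (\<gamma> / (4 * real d)) powr (1 / \<beta>) * x powr (1 / \<beta>)"
        unfolding y using x0 \<gamma> d by (subst powr_mult[symmetric]) auto
      also have "\<dots> \<le> c3 * (1 + x) powr (1 / \<beta>)"
        using x0 \<beta> by (intro mult_mono powr_mono2) (auto simp: c3_def)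
      finally have "1 / h \<le> c3 * (1 + x) powr (1 / \<beta>)" .
      moreover have "1 * 1 \<le> c3 * (1 + x) powr (1 / \<beta>)"
        using c31 x0 \<beta> by (intro mult_mono ge_one_powr_ge_zero) auto
      ultimately have "Y \<le> c3 * (1 + x) powr (1 / \<beta>)" by (simp add: Y_def)
      then have "Y powr M \<le> (c3 * (1 + x) powr (1 / \<beta>)) powr M" using Y1 M0 by (intro powr_mono2) auto
      also have "\<dots> = c3 powr M * (1 + x) powr (M / \<beta>)"
        using c31 by (subst powr_mult) (auto simp: powr_powr)
      finally have "Y powr M * exp (- x / 4) \<le> c3 powr M * (1 + x) powr (M / \<beta>) * exp (- x / 4)"
        by (rule mult_right_mono) simp
      also have "\<dots> = c3 powr M * ((1 + x) powr (M / \<beta>) * exp (- x / 4))" by (simp only: mult.assoc)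
      also have "\<dots> \<le> c3 powr M * C1" using x0 by (intro mult_left_mono C1) auto
      finally show ?thesis .
    qed
    have "C0 ^ d * Y powr (real d * E) * exp (3 * x / 4) * 1
       \<le> C0 ^ d * Y powr (real d * E) * exp (3 * x / 4) * (Y powr (2 * p) * (h powr p * h powr p))"
      using C00 by (intro mult_left_mono hp1) auto
    also have "\<dots> = C0 ^ d * (Y powr M * exp (- x / 4)) * (h powr p * h powr p * exp x)"
    proof -
      have e: "exp (3 * x / 4) = exp (- x / 4) * exp x" by (simp add: exp_add[symmetric])
      have y: "Y powr (real d * E) * Y powr (2 * p) = Y powr M" by (simp add: M_def powr_add)
      have "C0 ^ d * Y powr (real d * E) * exp (3 * x / 4) * (Y powr (2 * p) * (h powr p * h powr p))
         = C0 ^ d * (Y powr (real d * E) * Y powr (2 * p)) * exp (3 * x / 4) * (h powr p * h powr p)"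
        by (simp only: mult_ac)
      also have "\<dots> = C0 ^ d * Y powr M * (exp (- x / 4) * exp x) * (h powr p * h powr p)"
        by (simp only: e y)
      also have "\<dots> = C0 ^ d * (Y powr M * exp (- x / 4)) * (h powr p * h powr p * exp x)"
        by (simp only: mult_ac)
      finally show ?thesis .
    qed
    also have "\<dots> \<le> C0 ^ d * (c3 powr M * C1) * (h powr p * h powr p * exp x)"
      using C00 YM by (intro mult_right_mono mult_left_mono) auto
    also have "exp x = real n" using n by (simp add: x_def)
    finally have "C0 ^ d * Y powr (real d * E) * exp (3 * x / 4) \<le> (C0 ^ d * c3 powr M * C1) * (h powr p * h powr p * real n)"
      by (simp only: mult_1_right mult.assoc)
    with step have "coord_bound p ?G h ^ d \<le> (C0 ^ d * c3 powr M * C1) * (h powr p * h powr p * real n)"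
      by (rule order_trans)
    then show ?thesis unfolding Texp[symmetric] h_def .
  qed
  show ?thesis
  proof (intro exI conjI allI impI)
    show "0 < C0 ^ d * c3 powr M * C1 + 1" using C00 C1(1) by (intro add_nonneg_pos mult_nonneg_nonneg) auto
    fix n :: nat assume "n \<ge> 2"
    from main[OF this] show "coord_bound p (c * (2 + T (H n) powr \<beta>') * exp (T (H n) powr \<beta> / \<gamma>)) (H n) ^ d
       \<le> (C0 ^ d * c3 powr M * C1 + 1) * (H n powr p * H n powr p * real n)"
      by (rule order_trans) (intro mult_right_mono mult_nonneg_nonneg, auto)
  qed
qed

lemma one_plus_abs_powr_le:
  assumes "s \<ge> 0" shows "(1 + \<bar>x :: real\<bar>) powr s \<le> 2 powr s * (1 + \<bar>x\<bar> powr s)"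
proof -
  have "(1 + \<bar>x\<bar>) powr s \<le> (2 * max 1 \<bar>x\<bar>) powr s" using assms by (intro powr_mono2) auto
  also have "\<dots> = 2 powr s * max 1 \<bar>x\<bar> powr s" by (intro powr_mult) 
  also have "max 1 \<bar>x\<bar> powr s \<le> 1 + \<bar>x\<bar> powr s" by (auto simp: max_def)
  finally show ?thesis by simp
qed

text \<open>The moment class bounds products of \<open>1 + |x|\<^sup>s\<close>; the weight has factors \<open>(1 + |x|)\<^sup>s\<close>, which
are larger by at most \<open>2\<^sup>s\<close>. Lowering \<open>a\<close> to \<open>a'\<close> only decreases the weight, as its bases are at least 1.\<close>

lemma nn_integral_weight_moment_class:
  fixes \<mu> :: "(real ^ 'd::finite) measure"
  assumes \<mu>: "\<mu> \<in> moment_class M p a" and p: "p \<ge> 1" and a: "a > 1" and a': "a' \<le> a" "0 \<le> M"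
  shows "(\<integral>\<^sup>+ x. ennreal (weight (exps a' p j) x) \<partial>\<mu>) \<le> ennreal (2 powr (2 * p + a) * (2 powr a) ^ (CARD('d) - 1) * M)"
proof -
  let ?c = "2 powr (2 * p + a) * (2 powr a) ^ (CARD('d) - 1)"
  let ?m = "\<lambda>x. (1 + \<bar>x $ j\<bar> powr (2 * p + a)) * (\<Prod>l\<in>UNIV - {j}. 1 + \<bar>x $ l\<bar> powr a)"
  have sets: "sets \<mu> = sets borel" using \<mu> by (simp add: moment_class_def)
  note [measurable_cong] = sets
  have "(\<integral>\<^sup>+ x. ennreal (?m x) \<partial>\<mu>) \<le> (SUP j. \<integral>\<^sup>+ x. ennreal ((1 + \<bar>x $ j\<bar> powr (2 * p + a)) * (\<Prod>l\<in>UNIV - {j}. 1 + \<bar>x $ l\<bar> powr a)) \<partial>\<mu>)"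
    by (rule SUP_upper2[of j]) auto
  also have "\<dots> \<le> ennreal M" using \<mu> by (simp add: moment_class_def)
  finally have mM: "(\<integral>\<^sup>+ x. ennreal (?m x) \<partial>\<mu>) \<le> ennreal M" .
  have pt: "weight (exps a' p j) x \<le> ?c * ?m x" for x :: "real ^ 'd"
  proof -
    have one: "(1 + \<bar>t\<bar>) powr s' \<le> 2 powr s * (1 + \<bar>t\<bar> powr s)" if "s' \<le> s" "0 \<le> s" for s s' t :: real
      using that by (intro order_trans[OF powr_mono one_plus_abs_powr_le]) auto
    have "weight (exps a' p j) x = (1 + \<bar>x $ j\<bar>) powr exps a' p j j * (\<Prod>l\<in>UNIV - {j}. (1 + \<bar>x $ l\<bar>) powr exps a' p j l)"
      unfolding weight_def by (rule prod.remove) auto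
    also have "\<dots> \<le> (2 powr (2 * p + a) * (1 + \<bar>x $ j\<bar> powr (2 * p + a))) * (\<Prod>l\<in>UNIV - {j}. 2 powr a * (1 + \<bar>x $ l\<bar> powr a))"
      using a' a p by (intro mult_mono prod_mono conjI one prod_nonneg) (auto simp: exps_def)
    also have "\<dots> = ?c * ?m x" by (simp add: prod.distrib card_Diff_singleton mult_ac)
    finally show ?thesis .
  qed
  have m0: "0 \<le> ?m x" for x :: "real ^ 'd" by (intro mult_nonneg_nonneg prod_nonneg) auto
  have "(\<integral>\<^sup>+ x. ennreal (weight (exps a' p j) x) \<partial>\<mu>) \<le> (\<integral>\<^sup>+ x. ennreal ?c * ennreal (?m x) \<partial>\<mu>)"
    using pt m0 by (intro nn_integral_mono) (simp add: ennreal_mult[symmetric] ennreal_leI del: ennreal_mult')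
  also have "\<dots> = ennreal ?c * (\<integral>\<^sup>+ x. ennreal (?m x) \<partial>\<mu>)"
    by (rule nn_integral_cmult) measurable
  also have "\<dots> \<le> ennreal ?c * ennreal M" by (intro mult_left_mono mM) simp
  also have "\<dots> = ennreal (?c * M)" using a' by (intro ennreal_mult[symmetric]) auto
  finally show ?thesis .
qed

lemma abs_powr_le:
  assumes "\<bar>t\<bar> \<le> T" "b \<ge> 0" shows "1 + abs_powr t b \<le> 2 + T powr b"
  using powr_mono2[of b "\<bar>t\<bar>" T] assms by (auto simp: abs_powr_def)

theorem theorem4:
  fixes \<mu>\<epsilon> :: "'d::finite \<Rightarrow> real measure"
    and M p a \<beta> \<beta>' \<gamma>\<^sub>2 c\<^sub>2 :: real
  assumes "M > 0" and "p \<ge> 1" and "a > 1"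
    and "\<And>j. real_distribution (\<mu>\<epsilon> j)"
    and "\<And>j. integrable (\<mu>\<epsilon> j) (\<lambda>x. \<bar>x\<bar> powr (2 * p + a))"
    and "\<beta> > 0" and "\<beta>' \<ge> 0" and "\<gamma>\<^sub>2 > 0" and "c\<^sub>2 > 0"
    and "\<And>j l t. l \<le> nat \<lceil>p\<rceil> + 1 \<Longrightarrow>
           cmod (higher_derivative l (recip_char (\<mu>\<epsilon> j)) t)
             \<le> c\<^sub>2 * (1 + abs_powr t \<beta>') * exp (\<bar>t\<bar> powr \<beta> / \<gamma>\<^sub>2)"
  shows "\<exists>C>0. \<forall>n\<ge>2.
           (SUP \<mu> \<in> (moment_class M p a :: (real ^ 'd) measure set).
              \<integral>\<^sup>+ Y. ennreal_powr
                   (wasserstein p \<mu>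
                      (mu_hat p \<mu>\<epsilon>
                         (\<lambda>_. (4 * real CARD('d) / (\<gamma>\<^sub>2 * ln (real n))) powr (1 / \<beta>)) n Y)) p
                 \<partial>sample_law n \<mu> \<mu>\<epsilon>)
           \<le> ennreal (C * ln (real n) powr (- p / \<beta>))"
proof -
  note M = assms(1) and p = assms(2) and a = assms(3) and rd = assms(4) and mom = assms(5)
    and \<beta> = assms(6) and \<beta>' = assms(7) and \<gamma> = assms(8) and c = assms(9) and der = assms(10)
  let ?d = "CARD('d)" and ?q = "deriv_order p"
  have d: "0 < ?d" by simp
  \<comment> \<open>The weight \<open>1 + v\<^sup>2\<^sup>q\<close> dominates \<open>|v|\<close> to the power \<open>2 p + a\<close> only for \<open>a \<le> 2\<close>.\<close>
  define a' where "a' = min a 2"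
  have a': "1 < a'" "a' \<le> a" "a' \<le> 2" using a by (auto simp: a'_def)
  \<comment> \<open>Any \<open>\<tau> > 1\<close> with \<open>\<tau>\<^sup>\<beta> < 2\<close> would do: it leaves a negative power of \<open>n\<close>.\<close>
  define \<tau> where "\<tau> = (3 / 2 :: real) powr (1 / \<beta>)"
  have \<tau>: "\<tau> > 1" unfolding \<tau>_def using \<beta> by (intro gr_one_powr) auto
  have der_le: "cmod (higher_derivative l (recip_char (\<mu>\<epsilon> j)) t) \<le> c\<^sub>2 * (2 + T powr \<beta>') * exp (T powr \<beta> / \<gamma>\<^sub>2)"
    if "l \<le> ?q" "\<bar>t\<bar> \<le> T" for j l t T
  proof -
    have "c\<^sub>2 * (1 + abs_powr t \<beta>') * exp (\<bar>t\<bar> powr \<beta> / \<gamma>\<^sub>2) \<le> c\<^sub>2 * (2 + T powr \<beta>') * exp (T powr \<beta> / \<gamma>\<^sub>2)"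
      using that c \<beta> \<gamma> abs_powr_le[OF that(2) \<beta>']
      by (intro mult_mono mult_left_mono) (auto intro!: divide_right_mono powr_mono2)
    then show ?thesis using der[of l j t] that by (simp add: deriv_order_def)
  qed
  have char_nz: "char (\<mu>\<epsilon> j) t \<noteq> 0" for j t
  proof (rule real_distribution.char_nonzero[OF rd])
    fix T show "\<exists>B. \<forall>t. \<bar>t\<bar> \<le> T \<longrightarrow> norm (recip_char (\<mu>\<epsilon> j) t) \<le> B"
      using der_le[of 0 _ T j] by (auto simp: higher_derivative_def)
  qed
  have smooth: "times_differentiable ?q (recip_char (\<mu>\<epsilon> j))" for j
  proof (rule real_distribution.times_differentiable_recip_char[OF rd mom _ char_nz])
    have "real (nat \<lceil>p\<rceil>) \<le> p + 1" using p by linarith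
    moreover have "real ?q = real (nat \<lceil>p\<rceil>) + 1" by (simp only: deriv_order_def of_nat_add of_nat_1)
    ultimately show "real ?q \<le> 2 * p + a" using p a by linarith
  qed
  have s_q: "exps a' p j l \<le> 2 * real ?q" for j l :: 'd
  proof -
    have "p \<le> real (nat \<lceil>p\<rceil>)" by (rule real_nat_ceiling_ge)
    moreover have "real ?q = real (nat \<lceil>p\<rceil>) + 1" by (simp only: deriv_order_def of_nat_add of_nat_1)
    moreover have "exps a' p j l \<le> a' + 2 * p" using p by (simp add: exps_def)
    ultimately show ?thesis using a' by linarith
  qed

  define H where "H n = (4 * real ?d / (\<gamma>\<^sub>2 * ln (real n))) powr (1 / \<beta>)" for n :: nat
  define Gn where "Gn h = c\<^sub>2 * (2 + (\<tau> / h) powr \<beta>') * exp ((\<tau> / h) powr \<beta> / \<gamma>\<^sub>2)" for h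
  obtain C where C: "C > 0" "\<And>n. n \<ge> 2 \<Longrightarrow> coord_bound p (Gn (H n)) (H n) ^ ?d \<le> C * (H n powr p * H n powr p * real n)"
    using coord_bound_rate[OF \<beta> \<beta>' \<gamma> c p d] unfolding H_def Gn_def \<tau>_def by auto
  define H0 where "H0 = max 1 (H 2)"

  obtain V where V: "V \<ge> 0" "(\<integral>\<^sup>+ t. ennreal ((1 + \<bar>t :: real\<bar>) powr (- a')) \<partial>lborel) = ennreal V"
    using nn_integral_weight_finite[OF a'(1)] by (cases "\<integral>\<^sup>+ t. ennreal ((1 + \<bar>t :: real\<bar>) powr (- a')) \<partial>lborel") auto
  define m where "m = (LINT v|lborel. (1 + \<bar>v\<bar>) powr p * kernel p v)"
  have m0: "m \<ge> 0" unfolding m_def using kernel_nonneg[OF p] by (intro integral_nonneg_AE) auto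
  have m: "(\<integral>\<^sup>+ v. ennreal ((1 + \<bar>v\<bar>) powr p * kernel p v) \<partial>lborel) = ennreal m"
    unfolding m_def using kernel_nonneg[OF p] integrable_moment_kernel[OF p]
    by (intro nn_integral_eq_integral) auto
  have m1: "(\<integral>\<^sup>+ v. ennreal (kernel p v) * ennreal (\<bar>v\<bar> powr p) \<partial>lborel) \<le> ennreal m"
    unfolding m[symmetric]
  proof (rule nn_integral_mono)
    fix v :: real
    have "kernel p v * \<bar>v\<bar> powr p \<le> kernel p v * (1 + \<bar>v\<bar>) powr p"
      using kernel_nonneg[OF p] p by (intro mult_left_mono powr_mono2) auto
    then show "ennreal (kernel p v) * ennreal (\<bar>v\<bar> powr p) \<le> ennreal ((1 + \<bar>v\<bar>) powr p * kernel p v)"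
      using kernel_nonneg[OF p, of v] by (subst ennreal_mult[symmetric]) (auto intro!: ennreal_leI simp: mult.commute)
  qed
  have m2: "(\<integral>\<^sup>+ v. ennreal (kernel p v) * ennreal ((1 + \<bar>h * v\<bar>) powr p) \<partial>lborel) \<le> ennreal (H0 powr p * m)"
    if h: "0 < h" "h \<le> H0" for h
  proof -
    have "(\<integral>\<^sup>+ v. ennreal (kernel p v) * ennreal ((1 + \<bar>h * v\<bar>) powr p) \<partial>lborel)
      \<le> (\<integral>\<^sup>+ v. ennreal (H0 powr p) * ennreal ((1 + \<bar>v\<bar>) powr p * kernel p v) \<partial>lborel)"
    proof (rule nn_integral_mono)
      fix v :: real
      have "h * \<bar>v\<bar> \<le> H0 * \<bar>v\<bar>" using h by (intro mult_right_mono) auto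
      moreover have "1 \<le> H0" by (simp add: H0_def)
      ultimately have "1 + \<bar>h * v\<bar> \<le> H0 * (1 + \<bar>v\<bar>)" using h by (simp add: abs_mult distrib_left)
      then have "(1 + \<bar>h * v\<bar>) powr p \<le> (H0 * (1 + \<bar>v\<bar>)) powr p" using p by (intro powr_mono2) auto
      also have "\<dots> = H0 powr p * (1 + \<bar>v\<bar>) powr p" by (rule powr_mult)
      finally have "kernel p v * (1 + \<bar>h * v\<bar>) powr p \<le> kernel p v * (H0 powr p * (1 + \<bar>v\<bar>) powr p)"
        using kernel_nonneg[OF p] by (rule mult_left_mono)
      then have "kernel p v * (1 + \<bar>h * v\<bar>) powr p \<le> H0 powr p * ((1 + \<bar>v\<bar>) powr p * kernel p v)"
        by (simp only: mult_ac)
      then show "ennreal (kernel p v) * ennreal ((1 + \<bar>h * v\<bar>) powr p) \<le> ennreal (H0 powr p) * ennreal ((1 + \<bar>v\<bar>) powr p * kernel p v)"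
        using kernel_nonneg[OF p, of v] by (subst (1 2) ennreal_mult[symmetric]) (auto intro!: ennreal_leI)
    qed
    also have "\<dots> = ennreal (H0 powr p) * ennreal m"
      unfolding m[symmetric] by (rule nn_integral_cmult) measurable
    also have "\<dots> = ennreal (H0 powr p * m)" using m0 by (intro ennreal_mult[symmetric]) auto
    finally show ?thesis .
  qed

  define Nj where "Nj l = (LINT e|\<mu>\<epsilon> l. 2 powr (2 * p + a) * (1 + \<bar>e\<bar> powr (2 * p + a)))" for l
  define N where "N = (\<Sum>l\<in>UNIV. Nj l)"
  have Nj0: "Nj l \<ge> 0" for l unfolding Nj_def by (intro integral_nonneg_AE) auto
  have N0: "N \<ge> 0" unfolding N_def by (intro sum_nonneg Nj0)
  have N: "(\<integral>\<^sup>+ e. ennreal ((1 + \<bar>e\<bar>) powr exps a' p j l) \<partial>\<mu>\<epsilon> l) \<le> ennreal N" for j l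
  proof -
    interpret real_distribution "\<mu>\<epsilon> l" by (rule rd)
    have "(\<integral>\<^sup>+ e. ennreal ((1 + \<bar>e\<bar>) powr exps a' p j l) \<partial>\<mu>\<epsilon> l)
       \<le> (\<integral>\<^sup>+ e. ennreal (2 powr (2 * p + a) * (1 + \<bar>e\<bar> powr (2 * p + a))) \<partial>\<mu>\<epsilon> l)"
    proof (intro nn_integral_mono ennreal_leI)
      fix e :: real
      have "(1 + \<bar>e\<bar>) powr exps a' p j l \<le> (1 + \<bar>e\<bar>) powr (2 * p + a)"
        using a' p by (intro powr_mono) (auto simp: exps_def)
      also have "\<dots> \<le> 2 powr (2 * p + a) * (1 + \<bar>e\<bar> powr (2 * p + a))"
        using p a by (intro one_plus_abs_powr_le) auto
      finally show "(1 + \<bar>e\<bar>) powr exps a' p j l \<le> 2 powr (2 * p + a) * (1 + \<bar>e\<bar> powr (2 * p + a))" .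
    qed
    also have "\<dots> = ennreal (Nj l)"
      unfolding Nj_def using mom[of l] by (intro nn_integral_eq_integral) auto
    also have "\<dots> \<le> ennreal N"
      unfolding N_def using Nj0 by (intro ennreal_leI member_le_sum) auto
    finally show ?thesis .
  qed
  define W where "W = 2 powr (2 * p + a) * (2 powr a) ^ (?d - 1) * M"
  have W0: "W \<ge> 0" unfolding W_def using M by (intro mult_nonneg_nonneg) auto

  let ?dp = "real ?d powr p"
  define C1 where "C1 = 3 powr p * (?dp * (real ?d * m) + (2 + ?dp * (real ?d * (W * (H0 powr p * m)))) *
     ((1 + ?dp) * (real ?d * (V ^ ?d / 2 + W * N ^ ?d * C / 2))))"
  have C10: "C1 \<ge> 0"
    unfolding C1_def using m0 W0 N0 V C(1) by (intro mult_nonneg_nonneg add_nonneg_nonneg) auto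
  have bound: "(\<integral>\<^sup>+ Y. ennreal_powr (wasserstein p \<mu> (mu_hat p \<mu>\<epsilon> (\<lambda>_. H n) n Y)) p \<partial>sample_law n \<mu> \<mu>\<epsilon>)
      \<le> ennreal (C1 * H n powr p)"
    if n: "n \<ge> 2" and \<mu>: "\<mu> \<in> moment_class M p a" for n and \<mu> :: "(real ^ 'd) measure"
  proof -
    have x2: "ln (real n) \<ge> ln 2" using n by simp
    have x0: "ln (real n) > 0" by (rule less_le_trans[OF _ x2]) simp
    define h where "h = H n"
    have h: "h > 0" unfolding h_def H_def using x0 \<gamma> by simp
    have hH0: "h \<le> H0"
    proof -
      have "4 * real ?d / (\<gamma>\<^sub>2 * ln (real n)) \<le> 4 * real ?d / (\<gamma>\<^sub>2 * ln 2)"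
        using x2 x0 \<gamma> by (intro divide_left_mono mult_left_mono mult_pos_pos) auto
      then have "h \<le> H 2" unfolding h_def H_def
        using \<beta> \<gamma> x0 by (intro powr_mono2) auto
      then show ?thesis by (simp add: H0_def)
    qed
    have G0: "Gn h \<ge> 0" unfolding Gn_def using c by (intro mult_nonneg_nonneg add_nonneg_nonneg) auto
    have G: "cmod (higher_derivative l (recip_char (\<mu>\<epsilon> j)) t) \<le> Gn h" if "l \<le> ?q" "\<bar>t\<bar> \<le> \<tau> / h" for j l t
      unfolding Gn_def by (rule der_le[OF that])
    have dec: "deconvolution (\<mu>\<epsilon> j) p h" for j
      using rd[of j] p h char_nz smooth by (simp add: deconvolution_def deconvolution_axioms_def)
    have \<mu>': "prob_space \<mu>" "sets \<mu> = sets borel" using \<mu> by (auto simp: moment_class_def)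
    have prob: "prob_space (\<mu>\<epsilon> j)" for j using rd[of j] by (simp add: real_distribution_def)
    interpret PE: product_estimator \<mu>\<epsilon> \<mu> "\<lambda>j. deconv_kernel p (\<mu>\<epsilon> j) h" "kernel p" h n
    proof (intro product_estimator.intro product_measure.intro product_sigma_finite.intro product_measure_axioms.intro product_estimator_axioms.intro)
      fix j
      interpret D: deconvolution "\<mu>\<epsilon> j" p h by (rule dec)
      show "sigma_finite_measure (\<mu>\<epsilon> j)" by (rule D.sigma_finite_measure_axioms)
      show "sets (\<mu>\<epsilon> j) = sets borel" by (rule D.events_eq_borel)
      show "prob_space (\<mu>\<epsilon> j)" by (rule prob)
      show "deconv_kernel p (\<mu>\<epsilon> j) h \<in> borel_measurable borel" by (rule D.deconv_kernel_measurable)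
      show "\<exists>B. \<forall>v. \<bar>deconv_kernel p (\<mu>\<epsilon> j) h v\<bar> \<le> B" by (rule D.deconv_kernel_bounded)
      show "integrable lborel (deconv_kernel p (\<mu>\<epsilon> j) h)" by (rule D.integrable_deconv_kernel[OF \<tau> G0 G])
      show "(LINT v|lborel. deconv_kernel p (\<mu>\<epsilon> j) h v) = 1" by (rule D.integral_deconv_kernel[OF \<tau> G0 G])
      show "(LINT e|\<mu>\<epsilon> j. deconv_kernel p (\<mu>\<epsilon> j) h ((y - e) / h)) = kernel p (y / h)" for y
        by (rule D.expectation_deconv_kernel)
    next
      show "(\<integral>\<^sup>+ v. ennreal (kernel p v) \<partial>lborel) = 1"
        using kernel_nonneg[OF p] integrable_kernel[OF p] integral_kernel[OF p]
        by (subst nn_integral_eq_integral) auto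
    qed (use \<mu>' kernel_nonneg[OF p] h n in auto)
    have A0: "coord_bound p (Gn h) h \<ge> 0"
      unfolding coord_bound_def using h deconv_const_nonneg by (intro mult_nonneg_nonneg) auto
    have A: "(\<integral>\<^sup>+ v. ennreal ((1 + \<bar>h * v\<bar>) powr exps a' p j l * (1 / h * (deconv_kernel p (\<mu>\<epsilon> l) h v)\<^sup>2)) \<partial>lborel)
       \<le> ennreal (coord_bound p (Gn h) h)" for j l :: 'd
      by (rule deconvolution.weighted_deconv_kernel_le[OF dec \<tau> G0 G s_q])
    have eq: "mu_hat p \<mu>\<epsilon> (\<lambda>_. H n) n Y = density lborel (\<lambda>z. ennreal (PE.g Y z))" for Y
      unfolding mu_hat_def g_hat_def f_hat_plus_def f_hat_def PE.g_def PE.F_def PE.G_def h_def[symmetric]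
      by (rule refl)
    have law: "sample_law n \<mu> \<mu>\<epsilon> = Pi\<^sub>M {..<n} (\<lambda>_. PE.law)"
      by (simp add: sample_law_def PE.law_def)
    have Wb: "(\<integral>\<^sup>+ x. ennreal (weight (exps a' p j) x) \<partial>\<mu>) \<le> ennreal W" for j
      unfolding W_def using M by (intro nn_integral_weight_moment_class[OF \<mu> p a a'(2)]) auto
    let ?R = "\<lambda>X. 3 powr p * (?dp * (real ?d * (h powr p * m))
      + (2 + ?dp * (real ?d * (W * (H0 powr p * m)))) * ((1 + ?dp) * (real ?d * (h powr p / 2 * V ^ ?d + X))))"
    let ?X = "1 / (2 * h powr p * real n) * (W * N ^ ?d * coord_bound p (Gn h) h ^ ?d)"
    have "(\<integral>\<^sup>+ Y. ennreal_powr (wasserstein p \<mu> (mu_hat p \<mu>\<epsilon> (\<lambda>_. H n) n Y)) p \<partial>sample_law n \<mu> \<mu>\<epsilon>)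
      \<le> ennreal (?R ?X)"
      unfolding eq law
      using a' V m0 W0 N0 A0
      by (intro PE.risk_le_real[where a = a'] p m1 m2 h hH0 Wb N A eq_refl[OF V(2)] mult_nonneg_nonneg) auto
    also have "?R ?X \<le> ?R (h powr p * (W * N ^ ?d * C / 2))"
    proof -
      have "?X \<le> 1 / (2 * h powr p * real n) * (W * N ^ ?d * (C * (h powr p * h powr p * real n)))"
        using C(2)[OF n] W0 N0 n unfolding h_def[symmetric] by (intro mult_left_mono mult_nonneg_nonneg) auto
      also have "\<dots> = h powr p * (W * N ^ ?d * C / 2)" using h n by (simp add: field_simps)
      finally have "?X \<le> h powr p * (W * N ^ ?d * C / 2)" .
      then show ?thesis
        using W0 m0 by (intro mult_left_mono add_left_mono mult_nonneg_nonneg add_nonneg_nonneg) auto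
    qed
    also have "?R (h powr p * (W * N ^ ?d * C / 2)) = C1 * h powr p"
      unfolding C1_def by (simp add: algebra_simps)
    finally show ?thesis by (simp add: h_def ennreal_leI)
  qed
  let ?C = "C1 * (4 * real ?d / \<gamma>\<^sub>2) powr (p / \<beta>) + 1"
  show ?thesis
  proof (intro exI conjI allI impI)
    show "0 < ?C" using C10 by (intro add_nonneg_pos mult_nonneg_nonneg) auto
    fix n :: nat assume n: "n \<ge> 2"
    have x0: "ln (real n) > 0" using n by simp
    have "H n powr p = (4 * real ?d / \<gamma>\<^sub>2 * (1 / ln (real n))) powr (p / \<beta>)"
      unfolding H_def by (simp add: powr_powr)
    also have "\<dots> = (4 * real ?d / \<gamma>\<^sub>2) powr (p / \<beta>) * (1 / ln (real n)) powr (p / \<beta>)"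
      by (rule powr_mult)
    also have "(1 / ln (real n)) powr (p / \<beta>) = ln (real n) powr (- p / \<beta>)"
      using x0 by (simp add: powr_minus_divide powr_divide)
    finally have Hp: "H n powr p = (4 * real ?d / \<gamma>\<^sub>2) powr (p / \<beta>) * ln (real n) powr (- p / \<beta>)" .
    have "C1 * H n powr p \<le> ?C * ln (real n) powr (- p / \<beta>)"
      unfolding Hp by (simp add: distrib_right mult.assoc)
    then have "ennreal (C1 * H n powr p) \<le> ennreal (?C * ln (real n) powr (- p / \<beta>))"
      by (rule ennreal_leI)
    then show "(SUP \<mu> \<in> (moment_class M p a :: (real ^ 'd) measure set).
              \<integral>\<^sup>+ Y. ennreal_powr
                   (wasserstein p \<mu>
                      (mu_hat p \<mu>\<epsilon>
                         (\<lambda>_. (4 * real CARD('d) / (\<gamma>\<^sub>2 * ln (real n))) powr (1 / \<beta>)) n Y)) p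
                 \<partial>sample_law n \<mu> \<mu>\<epsilon>)
           \<le> ennreal (?C * ln (real n) powr (- p / \<beta>))"
      using bound[OF n] unfolding H_def by (intro SUP_least) (rule order_trans)
  qed
qed

end
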